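(* The hyperfinite II$_1$ factor $\mathcal{R}$ is an existentially closed model of its universal theory $\operatorname{Th}_\forall(\mathcal{R})$. That is, for every model $M$ of $\operatorname{Th}_\forall(\mathcal{R})$ with $\mathcal{R}\subseteq M$, every quantifier-free formula $\varphi(x,y)$ ($x,y$ finite tuples of variables) in the language of tracial von Neumann algebras, and every tuple $a$ from $\mathcal{R}$, $$\inf_{c\in\mathcal{R}}\varphi^{\mathcal{R}}(c,a)=\inf_{b\in M}\varphi^{M}(b,a).$$
   Context: All von Neumann algebras are tracial, i.e. equipped with a fixed faithful normal tracial state $\operatorname{tr}$, and are regarded as metric structures in continuous logic: the variables range over operator-norm balls of fixed radii (the sorts of the language), the metric is induced by $\|x\|_2=\operatorname{tr}(x^*x)^{1/2}$, and quantifier-free formulas are built by applying continuous real-valued connectives to the real and imaginary parts of $\operatorname{tr}(p(x,y))$ for $*$-polynomials $p$. The infima above are taken over tuples in the balls attached to the variables $x$. Inclusions $\mathcal{R}\subseteq M$ are unital and trace-preserving. $\operatorname{Th}_\forall(\mathcal{R})$ is the universal theory of $\mathcal{R}$: the set of conditions $\sup_x\psi(x)=0$, with $\psi\geq 0$ quantifier-free, that are true in $\mathcal{R}$. Its models are the tracial von Neumann algebras, not necessarily separable, that embed (by a unital trace-preserving $*$-homomorphism) into some tracial ultrapower of $\mathcal{R}$, with respect to an ultrafilter on an arbitrary index set. The separable ones are exactly those which embed into $\mathcal{R}^{\mathcal{U}}$ for some (equivalently, every) nonprincipal ultrafilter $\mathcal{U}$ on $\mathbb{N}$. *)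

theory Defs
  imports "HOL-Analysis.Analysis"
begin

section \<open>Complex Hilbert spaces and their bounded operators\<close>

text \<open>The complex inner product is linear in its first argument. The real inner product, and hence
  the norm, of the underlying real Hilbert space is its real part.\<close>

class complex_hilbert = real_inner + complete_space +
  fixes scaleC :: "complex \<Rightarrow> 'a \<Rightarrow> 'a" (infixr "*\<^sub>C" 75)
    and cinner :: "'a \<Rightarrow> 'a \<Rightarrow> complex"
  assumes scaleC_add_right: "c *\<^sub>C (x + y) = c *\<^sub>C x + c *\<^sub>C y"
    and scaleC_add_left: "(c + d) *\<^sub>C x = c *\<^sub>C x + d *\<^sub>C x"
    and scaleC_scaleC: "c *\<^sub>C d *\<^sub>C x = (c * d) *\<^sub>C x"
    and scaleC_of_real: "complex_of_real r *\<^sub>C x = r *\<^sub>R x"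
    and cinner_add_left: "cinner (x + y) z = cinner x z + cinner y z"
    and cinner_scaleC_left: "cinner (c *\<^sub>C x) y = c * cinner x y"
    and cinner_commute: "cinner x y = cnj (cinner y x)"
    and Re_cinner: "Re (cinner x y) = inner x y"

lemma norm_scaleC:
  fixes x :: "'a::complex_hilbert"
  shows "norm (c *\<^sub>C x) = cmod c * norm x"
proof -
  have "cinner (c *\<^sub>C x) (c *\<^sub>C x) = c * cnj c * cinner x x"
    by (metis (no_types, lifting) cinner_scaleC_left cinner_commute complex_cnj_mult mult.assoc)
  also have "\<dots> = complex_of_real ((cmod c)\<^sup>2) * cinner x x"
    by (simp add: complex_norm_square del: of_real_power)
  finally have "inner (c *\<^sub>C x) (c *\<^sub>C x) = (cmod c)\<^sup>2 * inner x x"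
    using Re_cinner by (metis Re_complex_of_real complex_of_real_def Re_divide_of_real
        times_complex.simps(1) Im_complex_of_real diff_zero mult_zero_left)
  then have "(norm (c *\<^sub>C x))\<^sup>2 = (cmod c * norm x)\<^sup>2"
    by (simp add: power2_norm_eq_inner power_mult_distrib)
  then show ?thesis
    by simp
qed

lemma bounded_linear_scaleC:
  "bounded_linear (\<lambda>x::'a::complex_hilbert. c *\<^sub>C x)"
proof (rule bounded_linear_intro[where K = "cmod c"])
  fix r :: real and x :: 'a
  show "c *\<^sub>C r *\<^sub>R x = r *\<^sub>R c *\<^sub>C x"
    by (simp add: scaleC_scaleC mult.commute flip: scaleC_of_real)
qed (simp_all add: scaleC_add_right norm_scaleC mult.commute)

lift_definition scalar_op :: "complex \<Rightarrow> 'a::complex_hilbert \<Rightarrow>\<^sub>L 'a" is "\<lambda>c x. c *\<^sub>C x"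
  by (rule bounded_linear_scaleC)

text \<open>The type of bounded operators in the library consists of real-linear maps.\<close>

definition bounded_ops :: "('a::complex_hilbert \<Rightarrow>\<^sub>L 'a) set" where
  "bounded_ops = {T. \<forall>c x. blinfun_apply T (c *\<^sub>C x) = c *\<^sub>C blinfun_apply T x}"

definition is_cadjoint :: "('a::complex_hilbert \<Rightarrow>\<^sub>L 'a) \<Rightarrow> ('a \<Rightarrow>\<^sub>L 'a) \<Rightarrow> bool" where
  "is_cadjoint T S \<longleftrightarrow> (\<forall>x y. cinner (blinfun_apply T x) y = cinner x (blinfun_apply S y))"

definition cadjoint :: "('a::complex_hilbert \<Rightarrow>\<^sub>L 'a) \<Rightarrow> ('a \<Rightarrow>\<^sub>L 'a)" where
  "cadjoint T = (THE S. is_cadjoint T S)"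

lemma cadjoint_eqI:
  assumes "is_cadjoint T S"
  shows "cadjoint T = S"
  unfolding cadjoint_def
proof (rule the_equality)
  show "is_cadjoint T S"
    by (rule assms)
next
  fix S' assume S': "is_cadjoint T S'"
  show "S' = S"
  proof (rule blinfun_eqI)
    fix y
    have "inner x (blinfun_apply S' y) = inner x (blinfun_apply S y)" for x
      using assms S' unfolding is_cadjoint_def by (metis Re_cinner)
    then show "blinfun_apply S' y = blinfun_apply S y"
      by (metis vector_eq_rdot inner_commute)
  qed
qed

section \<open>Tracial von Neumann algebras\<close>

definition commutant :: "('a::complex_hilbert \<Rightarrow>\<^sub>L 'a) set \<Rightarrow> ('a \<Rightarrow>\<^sub>L 'a) set" where
  "commutant A = {T \<in> bounded_ops. \<forall>S\<in>A. T o\<^sub>L S = S o\<^sub>L T}"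

definition unital_star_subalgebra :: "('a::complex_hilbert \<Rightarrow>\<^sub>L 'a) set \<Rightarrow> bool" where
  "unital_star_subalgebra A \<longleftrightarrow>
     A \<subseteq> bounded_ops \<and> range scalar_op \<subseteq> A \<and>
     (\<forall>S\<in>A. \<forall>T\<in>A. S + T \<in> A \<and> S o\<^sub>L T \<in> A) \<and>
     (\<forall>T\<in>A. \<exists>S\<in>A. is_cadjoint T S)"

definition von_neumann_algebra :: "('a::complex_hilbert \<Rightarrow>\<^sub>L 'a) set \<Rightarrow> bool" where
  "von_neumann_algebra M \<longleftrightarrow> unital_star_subalgebra M \<and> commutant (commutant M) = M"

text \<open>Normality of a functional is ultraweak continuity, which amounts to a representation
  \<open>\<tau> T = (\<Sum>n. \<langle>T (\<xi> n), \<eta> n\<rangle>)\<close> with square-summable sequences of vectors. Only the values of \<open>\<tau>\<close> on the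
  algebra matter.\<close>

definition normal_functional ::
    "('a::complex_hilbert \<Rightarrow>\<^sub>L 'a) set \<Rightarrow> (('a \<Rightarrow>\<^sub>L 'a) \<Rightarrow> complex) \<Rightarrow> bool" where
  "normal_functional M \<tau> \<longleftrightarrow>
     (\<exists>\<xi> \<eta>. summable (\<lambda>n::nat. (norm (\<xi> n))\<^sup>2) \<and> summable (\<lambda>n. (norm (\<eta> n))\<^sup>2) \<and>
        (\<forall>T\<in>M. (\<lambda>n. cinner (blinfun_apply T (\<xi> n)) (\<eta> n)) sums \<tau> T))"

definition faithful_normal_tracial_state ::
    "('a::complex_hilbert \<Rightarrow>\<^sub>L 'a) set \<Rightarrow> (('a \<Rightarrow>\<^sub>L 'a) \<Rightarrow> complex) \<Rightarrow> bool" where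
  "faithful_normal_tracial_state M \<tau> \<longleftrightarrow>
     (\<forall>S\<in>M. \<forall>T\<in>M. \<tau> (S + T) = \<tau> S + \<tau> T) \<and>
     (\<forall>c. \<forall>T\<in>M. \<tau> (scalar_op c o\<^sub>L T) = c * \<tau> T) \<and>
     \<tau> id_blinfun = 1 \<and>
     (\<forall>T\<in>M. Im (\<tau> (cadjoint T o\<^sub>L T)) = 0 \<and> 0 \<le> Re (\<tau> (cadjoint T o\<^sub>L T))) \<and>
     (\<forall>T\<in>M. \<tau> (cadjoint T o\<^sub>L T) = 0 \<longrightarrow> T = 0) \<and>
     (\<forall>S\<in>M. \<forall>T\<in>M. \<tau> (S o\<^sub>L T) = \<tau> (T o\<^sub>L S)) \<and>
     normal_functional M \<tau>"

definition tracial_von_neumann_algebra ::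
    "('a::complex_hilbert \<Rightarrow>\<^sub>L 'a) set \<Rightarrow> (('a \<Rightarrow>\<^sub>L 'a) \<Rightarrow> complex) \<Rightarrow> bool" where
  "tracial_von_neumann_algebra M \<tau> \<longleftrightarrow>
     von_neumann_algebra M \<and> faithful_normal_tracial_state M \<tau>"

definition two_norm ::
    "(('a::complex_hilbert \<Rightarrow>\<^sub>L 'a) \<Rightarrow> complex) \<Rightarrow> ('a \<Rightarrow>\<^sub>L 'a) \<Rightarrow> real" where
  "two_norm \<tau> T = sqrt (Re (\<tau> (cadjoint T o\<^sub>L T)))"

definition trace_preserving_embedding ::
    "('a::complex_hilbert \<Rightarrow>\<^sub>L 'a) set \<Rightarrow> (('a \<Rightarrow>\<^sub>L 'a) \<Rightarrow> complex) \<Rightarrow>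
     ('b::complex_hilbert \<Rightarrow>\<^sub>L 'b) set \<Rightarrow> (('b \<Rightarrow>\<^sub>L 'b) \<Rightarrow> complex) \<Rightarrow>
     (('a \<Rightarrow>\<^sub>L 'a) \<Rightarrow> ('b \<Rightarrow>\<^sub>L 'b)) \<Rightarrow> bool" where
  "trace_preserving_embedding N \<tau> M \<sigma> \<iota> \<longleftrightarrow>
     \<iota> ` N \<subseteq> M \<and>
     (\<forall>c. \<iota> (scalar_op c) = scalar_op c) \<and>
     (\<forall>S\<in>N. \<forall>T\<in>N. \<iota> (S + T) = \<iota> S + \<iota> T \<and> \<iota> (S o\<^sub>L T) = \<iota> S o\<^sub>L \<iota> T) \<and>
     (\<forall>T\<in>N. \<iota> (cadjoint T) = cadjoint (\<iota> T) \<and> \<sigma> (\<iota> T) = \<tau> T)"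

section \<open>The hyperfinite II$_1$ factor\<close>

text \<open>Real and complex finite-dimensionality agree, so the real span of the library suffices.\<close>

definition finite_dim :: "('a::real_vector) set \<Rightarrow> bool" where
  "finite_dim B \<longleftrightarrow> (\<exists>F. finite F \<and> B \<subseteq> span F)"

definition factor :: "('a::complex_hilbert \<Rightarrow>\<^sub>L 'a) set \<Rightarrow> bool" where
  "factor M \<longleftrightarrow> von_neumann_algebra M \<and> M \<inter> commutant M = range scalar_op"

definition II1_factor ::
    "('a::complex_hilbert \<Rightarrow>\<^sub>L 'a) set \<Rightarrow> (('a \<Rightarrow>\<^sub>L 'a) \<Rightarrow> complex) \<Rightarrow> bool" where
  "II1_factor M \<tau> \<longleftrightarrow> tracial_von_neumann_algebra M \<tau> \<and> factor M \<and> \<not> finite_dim M"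

text \<open>Hyperfiniteness is witnessed by a sequence, so it includes separability; by Murray and von
  Neumann the algebra is then unique up to trace-preserving isomorphism.\<close>

definition hyperfinite ::
    "('a::complex_hilbert \<Rightarrow>\<^sub>L 'a) set \<Rightarrow> (('a \<Rightarrow>\<^sub>L 'a) \<Rightarrow> complex) \<Rightarrow> bool" where
  "hyperfinite M \<tau> \<longleftrightarrow>
     (\<exists>B :: nat \<Rightarrow> ('a \<Rightarrow>\<^sub>L 'a) set.
        (\<forall>n. unital_star_subalgebra (B n) \<and> finite_dim (B n) \<and> B n \<subseteq> M \<and> B n \<subseteq> B (Suc n)) \<and>
        (\<forall>T\<in>M. \<forall>\<epsilon>>0. \<exists>n. \<exists>S\<in>B n. two_norm \<tau> (T - S) < \<epsilon>))"

definition hyperfinite_II1_factor ::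
    "('a::complex_hilbert \<Rightarrow>\<^sub>L 'a) set \<Rightarrow> (('a \<Rightarrow>\<^sub>L 'a) \<Rightarrow> complex) \<Rightarrow> bool" where
  "hyperfinite_II1_factor M \<tau> \<longleftrightarrow> II1_factor M \<tau> \<and> hyperfinite M \<tau>"

section \<open>Quantifier-free formulas\<close>

text \<open>Variables are numbered; a tuple of operators is a list whose entry \<open>i\<close> is the value of the
  variable \<open>i\<close>.\<close>

datatype star_poly =
    Var nat
  | Scalar complex
  | Plus star_poly star_poly
  | Times star_poly star_poly
  | Star star_poly

primrec poly_vars :: "star_poly \<Rightarrow> nat set" where
  "poly_vars (Var i) = {i}"
| "poly_vars (Scalar c) = {}"
| "poly_vars (Plus p q) = poly_vars p \<union> poly_vars q"
| "poly_vars (Times p q) = poly_vars p \<union> poly_vars q"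
| "poly_vars (Star p) = poly_vars p"

primrec poly_eval :: "('a::complex_hilbert \<Rightarrow>\<^sub>L 'a) list \<Rightarrow> star_poly \<Rightarrow> ('a \<Rightarrow>\<^sub>L 'a)" where
  "poly_eval xs (Var i) = xs ! i"
| "poly_eval xs (Scalar c) = scalar_op c"
| "poly_eval xs (Plus p q) = poly_eval xs p + poly_eval xs q"
| "poly_eval xs (Times p q) = poly_eval xs p o\<^sub>L poly_eval xs q"
| "poly_eval xs (Star p) = cadjoint (poly_eval xs p)"

text \<open>In \<open>Conn u \<phi>s\<close> the connective \<open>u\<close> is applied to the values of the formulas \<open>\<phi>s\<close>. A connective of
  arity \<open>n\<close> is a continuous function on the product of \<open>n\<close> copies of the reals, indexed by \<open>{..<n}\<close>.\<close>

datatype qf_formula =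
    ReTr star_poly
  | ImTr star_poly
  | Conn "(nat \<Rightarrow> real) \<Rightarrow> real" "qf_formula list"

primrec qf_wf :: "qf_formula \<Rightarrow> bool" where
  "qf_wf (ReTr p) \<longleftrightarrow> True"
| "qf_wf (ImTr p) \<longleftrightarrow> True"
| "qf_wf (Conn u \<phi>s) \<longleftrightarrow>
     continuous_map (powertop_real {..<length \<phi>s}) euclideanreal u \<and> list_all id (map qf_wf \<phi>s)"

primrec qf_vars :: "qf_formula \<Rightarrow> nat set" where
  "qf_vars (ReTr p) = poly_vars p"
| "qf_vars (ImTr p) = poly_vars p"
| "qf_vars (Conn u \<phi>s) = \<Union> (set (map qf_vars \<phi>s))"

text \<open>The value of a formula depends only on the assignment of traces to $*$-polynomials.\<close>

primrec qf_eval :: "(star_poly \<Rightarrow> complex) \<Rightarrow> qf_formula \<Rightarrow> real" where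
  "qf_eval m (ReTr p) = Re (m p)"
| "qf_eval m (ImTr p) = Im (m p)"
| "qf_eval m (Conn u \<phi>s) = u (\<lambda>i\<in>{..<length \<phi>s}. map (qf_eval m) \<phi>s ! i)"

definition qf_interp ::
    "(('a::complex_hilbert \<Rightarrow>\<^sub>L 'a) \<Rightarrow> complex) \<Rightarrow> qf_formula \<Rightarrow> ('a \<Rightarrow>\<^sub>L 'a) list \<Rightarrow> real" where
  "qf_interp \<tau> \<phi> xs = qf_eval (\<lambda>p. \<tau> (poly_eval xs p)) \<phi>"

text \<open>Nonnegativity is required for every assignment of complex numbers to the atoms. A formula that
  is nonnegative merely in all tracial von Neumann algebras has the same values there as its
  maximum with 0, which is nonnegative in this sense.\<close>

definition qf_nonneg :: "qf_formula \<Rightarrow> bool" where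
  "qf_nonneg \<psi> \<longleftrightarrow> (\<forall>m. 0 \<le> qf_eval m \<psi>)"

text \<open>The sort of each variable is the operator-norm ball whose radius is the entry of \<open>rs\<close>.\<close>

definition ball_tuples ::
    "('a::complex_hilbert \<Rightarrow>\<^sub>L 'a) set \<Rightarrow> real list \<Rightarrow> ('a \<Rightarrow>\<^sub>L 'a) list set" where
  "ball_tuples M rs = {xs. list_all2 (\<lambda>x r. x \<in> M \<and> norm x \<le> r) xs rs}"

section \<open>The universal theory and its models\<close>

text \<open>The pair \<open>(rs, \<psi>)\<close> stands for the condition that the supremum of \<open>\<psi>\<close> over tuples from the balls of
  radii \<open>rs\<close> is 0.\<close>

definition universal_conditions :: "(real list \<times> qf_formula) set" where
  "universal_conditions =
     {(rs, \<psi>). (\<forall>r\<in>set rs. 0 < r) \<and> qf_wf \<psi> \<and> qf_vars \<psi> \<subseteq> {..<length rs} \<and> qf_nonneg \<psi>}"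

definition condition_true ::
    "('a::complex_hilbert \<Rightarrow>\<^sub>L 'a) set \<Rightarrow> (('a \<Rightarrow>\<^sub>L 'a) \<Rightarrow> complex) \<Rightarrow> real list \<times> qf_formula \<Rightarrow> bool" where
  "condition_true M \<tau> = (\<lambda>(rs, \<psi>). (SUP xs\<in>ball_tuples M rs. qf_interp \<tau> \<psi> xs) = 0)"

definition universal_theory ::
    "('a::complex_hilbert \<Rightarrow>\<^sub>L 'a) set \<Rightarrow> (('a \<Rightarrow>\<^sub>L 'a) \<Rightarrow> complex) \<Rightarrow> (real list \<times> qf_formula) set" where
  "universal_theory M \<tau> = {\<kappa> \<in> universal_conditions. condition_true M \<tau> \<kappa>}"

definition is_model ::
    "('a::complex_hilbert \<Rightarrow>\<^sub>L 'a) set \<Rightarrow> (('a \<Rightarrow>\<^sub>L 'a) \<Rightarrow> complex) \<Rightarrow>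
     (real list \<times> qf_formula) set \<Rightarrow> bool" where
  "is_model M \<tau> \<Theta> \<longleftrightarrow> tracial_von_neumann_algebra M \<tau> \<and> (\<forall>\<kappa>\<in>\<Theta>. condition_true M \<tau> \<kappa>)"

end

theory Submission
  imports Defs
begin

text \<open>Approximating the moments of \<open>(b, a)\<close> inside \<open>R\<close> is possible because \<open>M\<close> satisfies the universal
  theory; the point is to keep the given tuple \<open>a\<close> fixed. Up to a small error \<open>a\<close> lies in a
  finite-dimensional subalgebra \<open>B\<close> of \<open>R\<close>, so microstates of \<open>(b, a, e)\<close>, with \<open>e\<close> a self-adjoint
  orthonormal basis of \<open>B\<close>, contain an approximate copy \<open>f\<close> of \<open>e\<close>, and it suffices to find a contraction
  \<open>V \<in> R\<close> that is almost unitary with \<open>e k \<cdot> V \<approx> V \<cdot> f k\<close>: then \<open>c = V \<cdot> b' \<cdot> V\<^sup>*\<close> works.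

  This avoids matrix units and comparison of projections. Let \<open>D = 1 - V \<cdot> V\<^sup>*\<close> and
  \<open>D' = 1 - V\<^sup>* \<cdot> V\<close> be the defects of a contraction that intertwines approximately. For unitary \<open>U\<close>
  the operator \<open>T = (\<Sum>i. e i \<cdot> U \<cdot> f i)\<close> intertwines as well, small multiples of \<open>D \<cdot> T \<cdot> D'\<close> can be added to
  or subtracted from \<open>V\<close> without leaving the unit ball, and by the parallelogram law one of the two signs increases the
  2-norm of \<open>V\<close>. Averaging over \<open>U\<close>, which in a factor replaces an operator by its trace, shows that the
  increase is bounded below in terms of \<open>\<tau> D\<close>. Finitely many such steps, starting from \<open>V = 0\<close>, make
  \<open>\<tau> D\<close> small.\<close>

section \<open>Real Hilbert spaces and generalized limits\<close>

text \<open>The order of choices shapes the argument. The algebra \<open>B\<close>, its dimension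
  and the norms of its basis are fixed before the microstates are taken, so the gain of one
  enlargement step is a constant independent of the copy \<open>f\<close>. As the squared 2-norm of
  a contraction is at most 1, the number of steps is bounded in advance; each step multiplies the
  intertwining error by a fixed factor, so the accuracy demanded of the copy can be chosen last. An
  orthonormal basis is used because its structure constants
  \<open>\<tau> (e i \<cdot> (e j \<cdot> e k))\<close> are invariant under cyclic shifts, which is
  what makes \<open>T\<close> intertwine. The average over \<open>U\<close> of the trace pairing of
  \<open>D \<cdot> T \<cdot> D'\<close> with \<open>U\<close> is
  \<open>\<Sum>i. \<tau> (D \<cdot> e i) * \<tau> (f i \<cdot> D')\<close>; up to the error it is a
  sum of squares, and that sum is at least \<open>(\<tau> D)\<^sup>2\<close>. Since \<open>V\<close>
  is a genuine contraction and only approximately unitary, the tuple \<open>c\<close> stays in the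
  prescribed operator-norm balls.\<close>

lemma riesz_representation:
  fixes f :: "'a::{real_inner,complete_space} \<Rightarrow> real"
  assumes "bounded_linear f"
  shows "\<exists>y. \<forall>x. f x = inner x y"
proof -
  interpret f: bounded_linear f by fact
  obtain K where K: "\<And>x. norm (f x) \<le> norm x * K"
    using f.bounded by blast
  \<comment> \<open>If \<open>f\<close> is the inner product with \<open>y\<close>, then
    \<open>J x\<close> is the squared distance of \<open>x\<close> and \<open>y\<close> minus the
    squared norm of \<open>y\<close>, so the representing vector is the minimizer of
    \<open>J\<close>.\<close>
  define J where "J x = (norm x)\<^sup>2 - 2 * f x" for x
  have J_ge: "- K\<^sup>2 \<le> J x" for x
  proof -
    have "2 * f x \<le> 2 * (norm x * K)"
      using K[of x] by simp
    also have "\<dots> \<le> (norm x)\<^sup>2 + K\<^sup>2"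
      using sum_squares_bound[of "norm x" K] by (simp add: mult.assoc)
    finally show ?thesis by (simp add: J_def)
  qed
  define m where "m = (INF x. J x)"
  have bdd: "bdd_below (range J)"
    using J_ge by (intro bdd_belowI[where m = "- K\<^sup>2"]) auto
  have m_le: "m \<le> J x" for x
    unfolding m_def by (rule cINF_lower[OF bdd]) simp
  have "\<exists>x. J x < m + 1 / real (Suc n)" for n
  proof -
    have "m < m + 1 / real (Suc n)" by simp
    then show ?thesis
      using cINF_less_iff[OF _ bdd, of "m + 1 / real (Suc n)"] by (simp add: m_def)
  qed
  then obtain x where x: "\<And>n. J (x n) < m + 1 / real (Suc n)"
    by metis
  \<comment> \<open>The linear part of \<open>J\<close> cancels, which leaves the parallelogram law;
    it forces a minimizing sequence to be Cauchy.\<close>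
  have par: "(norm (u - v))\<^sup>2 = 2 * (J u + J v - 2 * J ((1/2) *\<^sub>R (u + v)))" for u v
    by (simp add: J_def f.scaleR f.add f.diff power_mult_distrib power2_norm_eq_inner inner_simps
        power_divide inner_commute algebra_simps)
  have dist2: "(norm (x i - x j))\<^sup>2 \<le> 2 * (1 / real (Suc i) + 1 / real (Suc j))" for i j
    unfolding par using x[of i] x[of j] m_le[of "(1/2) *\<^sub>R (x i + x j)"] by argo
  have "Cauchy x"
  proof (rule metric_CauchyI)
    fix e :: real assume "0 < e"
    then obtain N where N: "1 / real (Suc N) < e\<^sup>2 / 4"
      using nat_approx_posE[of "e\<^sup>2 / 4"] by auto
    have "dist (x i) (x j) < e" if "i \<ge> N" "j \<ge> N" for i j
    proof -
      have "1 / real (Suc i) \<le> 1 / real (Suc N)" "1 / real (Suc j) \<le> 1 / real (Suc N)"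
        using that by (auto simp: field_simps)
      then have "(norm (x i - x j))\<^sup>2 < e\<^sup>2"
        using dist2[of i j] N by argo
      then show ?thesis
        using \<open>0 < e\<close> by (simp add: dist_norm power2_less_imp_less)
    qed
    then show "\<exists>M. \<forall>i\<ge>M. \<forall>j\<ge>M. dist (x i) (x j) < e" by blast
  qed
  then obtain y where y: "x \<longlonglongrightarrow> y"
    using Cauchy_convergent convergent_def by blast
  have "(\<lambda>n. J (x n)) \<longlonglongrightarrow> J y"
    unfolding J_def by (intro tendsto_intros f.tendsto y)
  moreover have "(\<lambda>n. m + 1 / real (Suc n)) \<longlonglongrightarrow> m + 0"
    by (intro tendsto_intros LIMSEQ_Suc lim_1_over_n)
  ultimately have "J y \<le> m + 0"
    by (rule LIMSEQ_le) (use x less_imp_le in blast)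
  then have min: "J y \<le> J z" for z
    using m_le[of z] by simp
  have "f h = inner h y" for h
  proof (cases "h = 0")
    case True then show ?thesis by (simp add: f.zero)
  next
    case False
    define c where "c = inner y h - f h"
    \<comment> \<open>The minimizer of the quadratic polynomial \<open>J (y + t *\<^sub>R h)\<close>
      in \<open>t\<close>; it would lower \<open>J\<close> below its minimum unless
      \<open>c = 0\<close>.\<close>
    define t where "t = - c / (norm h)\<^sup>2"
    have "J (y + t *\<^sub>R h) = J y + 2 * t * c + t\<^sup>2 * (norm h)\<^sup>2"
      unfolding J_def c_def power2_norm_eq_inner
      unfolding power2_eq_square
      by (simp add: f.scaleR f.add inner_simps inner_commute algebra_simps)
    also have "\<dots> = J y - c\<^sup>2 / (norm h)\<^sup>2"
      using False by (simp add: t_def field_simps power2_eq_square)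
    finally have "c\<^sup>2 / (norm h)\<^sup>2 \<le> 0"
      using min[of "y + t *\<^sub>R h"] by simp
    then have "c = 0"
      using False by (simp add: divide_le_0_iff)
    then show ?thesis by (simp add: c_def inner_commute)
  qed
  then show ?thesis by blast
qed

text \<open>Instead of a free ultrafilter on the naturals, a cluster point in the compact product of
  intervals provides a filter along which every bounded sequence converges.\<close>

lemma generalized_limit_filter:
  "\<exists>G :: nat filter. G \<le> sequentially \<and> G \<noteq> bot \<and>
     (\<forall>b :: nat \<Rightarrow> real. Bseq b \<longrightarrow> (\<exists>l. (b \<longlongrightarrow> l) G))"
proof -
  have "\<exists>K. \<forall>b. Bseq b \<longrightarrow> (\<forall>n. \<bar>b n :: real\<bar> \<le> K b)"
    by (rule choice) (auto simp: Bseq_def)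
  then obtain K where K: "\<And>b n. Bseq b \<Longrightarrow> \<bar>b n :: real\<bar> \<le> K b" by blast
  \<comment> \<open>The point \<open>e n\<close> evaluates all bounded sequences at
    \<open>n\<close>; the value 0 at unbounded ones keeps it in the compact product
    \<open>S\<close>. The coordinates of a cluster point are the generalized limits.\<close>
  define e :: "nat \<Rightarrow> (nat \<Rightarrow> real) \<Rightarrow> real" where "e n b = (if Bseq b then b n else 0)" for n b
  define S where "S = PiE UNIV (\<lambda>b. {- \<bar>K b\<bar> .. \<bar>K b\<bar>})"
  have eS: "e n \<in> S" for n
    using K by (auto simp: S_def e_def abs_le_iff)
       (metis K abs_le_D1 abs_le_D2 abs_ge_self neg_le_iff_le order_trans minus_le_iff)+
  have "compactin (product_topology (\<lambda>_. euclidean) UNIV) S"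
    unfolding S_def by (subst compactin_PiE) simp
  then have "compact S"
    by (simp add: euclidean_product_topology compactin_euclidean_iff)
  moreover have "filtermap e sequentially \<noteq> bot"
    by (simp add: filtermap_bot_iff)
  moreover have "eventually (\<lambda>x. x \<in> S) (filtermap e sequentially)"
    by (simp add: eventually_filtermap eS)
  ultimately obtain x where x: "inf (nhds x) (filtermap e sequentially) \<noteq> bot"
    unfolding compact_filter by blast
  \<comment> \<open>Pulling the neighbourhoods of \<open>x\<close> back along \<open>e\<close> makes
    each coordinate converge; the infimum with \<open>sequentially\<close> keeps ordinary
    limits.\<close>
  define G where "G = inf (filtercomap e (nhds x)) sequentially"
  have "G \<noteq> bot"
  proof
    assume "G = bot"
    then obtain P Q where P: "eventually P (filtercomap e (nhds x))"
      and Q: "eventually Q sequentially" and PQ: "\<And>n. P n \<Longrightarrow> Q n \<Longrightarrow> False"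
      unfolding G_def trivial_limit_def eventually_inf by blast
    from P obtain P' where P': "eventually P' (nhds x)" "\<And>n. P' (e n) \<Longrightarrow> P n"
      by (auto simp: eventually_filtercomap)
    have "eventually (\<lambda>z. \<exists>n. z = e n \<and> Q n) (filtermap e sequentially)"
      unfolding eventually_filtermap using Q by (rule eventually_mono) auto
    then have "eventually (\<lambda>z. P' z \<and> (\<exists>n. z = e n \<and> Q n)) (inf (nhds x) (filtermap e sequentially))"
      unfolding eventually_inf using P'(1) by blast
    then have "eventually (\<lambda>_. False) (inf (nhds x) (filtermap e sequentially))"
      by (rule eventually_mono) (use P' PQ in blast)
    with x show False by (simp add: trivial_limit_def)
  qed
  moreover have "G \<le> sequentially"
    by (simp add: G_def)
  moreover have "\<exists>l. (b \<longlongrightarrow> l) G" if "Bseq b" for b :: "nat \<Rightarrow> real"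
  proof -
    have "filterlim e (nhds x) G"
      unfolding filterlim_iff_le_filtercomap by (simp add: G_def)
    moreover have "continuous_on UNIV (\<lambda>z::(nat \<Rightarrow> real) \<Rightarrow> real. z b)"
      by (rule continuous_on_product_coordinates)
    then have "((\<lambda>z. z b) \<longlongrightarrow> x b) (nhds x)"
      using continuous_on_def tendsto_at_iff_tendsto_nhds by (metis UNIV_I)
    ultimately have "((\<lambda>n. e n b) \<longlongrightarrow> x b) G"
      using filterlim_compose by blast
    then show ?thesis
      using that by (auto simp: e_def)
  qed
  ultimately show ?thesis by blast
qed

section \<open>Bounded operators\<close>

abbreviation op_times :: "('a::real_normed_vector \<Rightarrow>\<^sub>L 'a) \<Rightarrow> ('a \<Rightarrow>\<^sub>L 'a) \<Rightarrow> ('a \<Rightarrow>\<^sub>L 'a)"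
  (infixl "\<cdot>" 70) where
  "S \<cdot> T \<equiv> S o\<^sub>L T"

abbreviation op_one :: "'a::real_normed_vector \<Rightarrow>\<^sub>L 'a" ("\<one>") where
  "\<one> \<equiv> id_blinfun"

abbreviation op_adj :: "('a::complex_hilbert \<Rightarrow>\<^sub>L 'a) \<Rightarrow> ('a \<Rightarrow>\<^sub>L 'a)" ("_\<^sup>\<dagger>" [1000] 1000) where
  "T\<^sup>\<dagger> \<equiv> cadjoint T"

lemma op_times_assoc: "(S \<cdot> T) \<cdot> U = S \<cdot> (T \<cdot> U)"
  by (rule blinfun_eqI) simp

lemma op_times_one [simp]: "\<one> \<cdot> T = T" "T \<cdot> \<one> = T"
  by (rule blinfun_eqI, simp)+

lemmas op_distrib =
  bounded_bilinear.add_left[OF bounded_bilinear_blinfun_compose]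
  bounded_bilinear.add_right[OF bounded_bilinear_blinfun_compose]
  bounded_bilinear.diff_left[OF bounded_bilinear_blinfun_compose]
  bounded_bilinear.diff_right[OF bounded_bilinear_blinfun_compose]
  bounded_bilinear.minus_left[OF bounded_bilinear_blinfun_compose]
  bounded_bilinear.minus_right[OF bounded_bilinear_blinfun_compose]
  bounded_bilinear.scaleR_left[OF bounded_bilinear_blinfun_compose]
  bounded_bilinear.scaleR_right[OF bounded_bilinear_blinfun_compose]
  bounded_bilinear.zero_left[OF bounded_bilinear_blinfun_compose]
  bounded_bilinear.zero_right[OF bounded_bilinear_blinfun_compose]

lemmas op_simps = op_distrib op_times_assoc

lemmas op_sum =
  bounded_bilinear.sum_left[OF bounded_bilinear_blinfun_compose]
  bounded_bilinear.sum_right[OF bounded_bilinear_blinfun_compose]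

lemma scaleR_op_eq: "r *\<^sub>R (T :: 'a::complex_hilbert \<Rightarrow>\<^sub>L 'a) = scalar_op (complex_of_real r) \<cdot> T"
  by (rule blinfun_eqI) (simp add: scalar_op.rep_eq scaleC_of_real blinfun.scaleR_left)

lemma scalar_op_of_real: "scalar_op (complex_of_real r) = r *\<^sub>R \<one>"
  by (simp add: scaleR_op_eq)

lemma scalar_op_1 [simp]: "scalar_op 1 = \<one>"
  using scalar_op_of_real[of 1] by simp

lemma scalar_op_times: "scalar_op c \<cdot> scalar_op d = scalar_op (c * d)"
  by (rule blinfun_eqI) (simp add: scalar_op.rep_eq scaleC_scaleC)

lemma scalar_op_add: "scalar_op (c + d) = scalar_op c + scalar_op d"
  by (rule blinfun_eqI) (simp add: scalar_op.rep_eq scaleC_add_left blinfun.add_left)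

lemma scalar_op_0 [simp]: "scalar_op 0 = 0"
  using scalar_op_of_real[of 0] by simp

lemma scalar_op_minus: "scalar_op (- c) = - scalar_op c"
  using scalar_op_add[of c "- c"] by (simp add: eq_neg_iff_add_eq_0 add.commute)

lemma scalar_op_commute: "T \<in> bounded_ops \<Longrightarrow> scalar_op c \<cdot> T = T \<cdot> scalar_op c"
  by (rule blinfun_eqI) (simp add: scalar_op.rep_eq bounded_ops_def)

lemma norm_scalar_op: "norm (scalar_op c :: 'a::complex_hilbert \<Rightarrow>\<^sub>L 'a) \<le> cmod c"
  by (rule norm_blinfun_bound) (simp_all add: scalar_op.rep_eq norm_scaleC)

section \<open>Complex and real inner products, adjoints and bounded forms\<close>

lemma cinner_scaleC_right: "cinner x (c *\<^sub>C y) = cnj c * cinner x y"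
  by (metis cinner_commute cinner_scaleC_left complex_cnj_mult)

lemma Im_cinner: "Im (cinner x y) = - inner (\<i> *\<^sub>C x) (y :: 'a::complex_hilbert)"
  by (simp flip: Re_cinner add: cinner_scaleC_left)

lemma inner_scaleC_left: "inner (c *\<^sub>C x) (y :: 'a::complex_hilbert) = inner x (cnj c *\<^sub>C y)"
  by (simp flip: Re_cinner add: cinner_scaleC_left cinner_scaleC_right)

lemma cinner_eq_iff: "cinner x y = cinner z w \<longleftrightarrow>
    inner x y = inner z w \<and> inner (\<i> *\<^sub>C x) y = inner (\<i> *\<^sub>C z) (w :: 'a::complex_hilbert)"
  by (simp add: complex_eq_iff Re_cinner Im_cinner)

text \<open>Real and imaginary part are bounded separately, hence the factor 2; any constant serves
  to dominate the series that represents a normal functional.\<close>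

lemma norm_cinner_le: "cmod (cinner x y) \<le> 2 * (norm x * norm (y :: 'a::complex_hilbert))"
proof -
  have "cmod (cinner x y) \<le> \<bar>inner x y\<bar> + \<bar>inner (\<i> *\<^sub>C x) y\<bar>"
    using cmod_le[of "cinner x y"] by (simp add: Re_cinner Im_cinner)
  also have "\<dots> \<le> norm x * norm y + norm (\<i> *\<^sub>C x) * norm y"
    by (intro add_mono Cauchy_Schwarz_ineq2)
  finally show ?thesis by (simp add: norm_scaleC)
qed

text \<open>The imaginary part of \<open>cinner x y\<close> is a real inner product involving
  \<open>\<i> *\<^sub>C x\<close>, and \<open>T\<close> commutes with \<open>\<i>\<close>. Adjoints
  can therefore be handled with the real inner product throughout.\<close>

lemma is_cadjoint_iff_inner:
  assumes "T \<in> bounded_ops"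
  shows "is_cadjoint T S \<longleftrightarrow> (\<forall>x y. inner (blinfun_apply T x) y = inner x (blinfun_apply S y))"
    (is "?L \<longleftrightarrow> ?R")
proof
  assume ?L then show ?R
    unfolding is_cadjoint_def by (metis Re_cinner)
next
  assume ?R
  moreover have "\<i> *\<^sub>C blinfun_apply T x = blinfun_apply T (\<i> *\<^sub>C x)" for x
    using assms by (simp add: bounded_ops_def)
  ultimately show ?L
    unfolding is_cadjoint_def cinner_eq_iff by metis
qed

text \<open>Serves elements of a commutant, for which no adjoint is at hand: to move one across an
  inner product, a vector for each \<open>y\<close> is enough.\<close>

lemma real_adjoint_exists:
  fixes T :: "'a::{real_inner,complete_space} \<Rightarrow>\<^sub>L 'a"
  shows "\<exists>y'. \<forall>x. inner (blinfun_apply T x) y = inner x y'"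
  by (intro riesz_representation bounded_linear_intros)

text \<open>Riesz representation for each fixed \<open>x\<close> gives \<open>t x\<close>.
  Uniqueness makes \<open>t\<close> linear, and the choice \<open>y = t x\<close> makes it bounded.
  Weak limits of operators are obtained from the limits of their forms in this way.\<close>

lemma op_of_form:
  fixes B :: "'a::{real_inner,complete_space} \<Rightarrow> 'a \<Rightarrow> real"
  assumes "bounded_bilinear B"
  shows "\<exists>T. \<forall>x y. inner (blinfun_apply T x) y = B x y"
proof -
  interpret B: bounded_bilinear B by fact
  have "\<exists>z. \<forall>y. B x y = inner y z" for x
    by (intro riesz_representation B.bounded_linear_right)
  then obtain t where t: "\<And>x y. B x y = inner (t x) y"
    by (metis inner_commute)
  obtain K where K: "\<And>x y. norm (B x y) \<le> norm x * norm y * K" "K \<ge> 0"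
    using B.nonneg_bounded by blast
  have "bounded_linear t"
  proof (rule bounded_linear_intro)
    show "t (x + y) = t x + t y" for x y
      by (rule vector_eq_rdot[THEN iffD1]) (metis t B.add_left inner_add_left inner_commute)
    show "t (r *\<^sub>R x) = r *\<^sub>R t x" for r x
      by (rule vector_eq_rdot[THEN iffD1])
        (metis t B.scaleR_left inner_scaleR_left inner_commute real_scaleR_def)
    show "norm (t x) \<le> norm x * K" for x
    proof -
      have "norm (t x) * norm (t x) \<le> norm (t x) * (norm x * K)"
        using K(1)[of x "t x"] by (simp add: t power2_norm_eq_inner[symmetric] power2_eq_square
            dot_square_norm mult_ac)
      then show ?thesis
        by (metis K(2) linorder_not_less mult_le_cancel_left_pos norm_ge_zero order_antisym_conv
            mult_nonneg_nonneg)
    qed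
  qed
  then show ?thesis
    by (intro exI[of _ "Blinfun t"]) (simp add: bounded_linear_Blinfun_apply t)
qed

instance complex_hilbert \<subseteq> banach ..

lemma rotate_to_norm: "\<exists>c. cmod c = 1 \<and> c * z = complex_of_real (cmod z)"
proof (cases "z = 0")
  case True
  then show ?thesis by (intro exI[of _ 1]) simp
next
  case False
  have "cnj z * z = complex_of_real (cmod z) * complex_of_real (cmod z)"
    by (metis complex_norm_square mult.commute of_real_power power2_eq_square)
  then have "cnj z / complex_of_real (cmod z) * z = complex_of_real (cmod z)"
    using False by (simp only: times_divide_eq_left) simp
  moreover have "cmod (cnj z / complex_of_real (cmod z)) = 1"
    using False by (simp add: norm_divide)
  ultimately show ?thesis by blast
qed

section \<open>The algebra operations and the adjoint\<close>

locale tracial_vna =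
  fixes M :: "('a::complex_hilbert \<Rightarrow>\<^sub>L 'a) set"
    and \<tau> :: "('a \<Rightarrow>\<^sub>L 'a) \<Rightarrow> complex"
  assumes tracial: "tracial_von_neumann_algebra M \<tau>"
begin

lemma star_subalgebra: "unital_star_subalgebra M"
  using tracial by (simp add: tracial_von_neumann_algebra_def von_neumann_algebra_def)

lemma bicommutant: "commutant (commutant M) = M"
  using tracial by (simp add: tracial_von_neumann_algebra_def von_neumann_algebra_def)

lemma state: "faithful_normal_tracial_state M \<tau>"
  using tracial by (simp add: tracial_von_neumann_algebra_def)

lemma bounded_opsI: "T \<in> M \<Longrightarrow> T \<in> bounded_ops"
  using star_subalgebra by (auto simp: unital_star_subalgebra_def)

lemma add_mem [intro, simp]: "S \<in> M \<Longrightarrow> T \<in> M \<Longrightarrow> S + T \<in> M"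
  using star_subalgebra by (auto simp: unital_star_subalgebra_def)

lemma times_mem [intro, simp]: "S \<in> M \<Longrightarrow> T \<in> M \<Longrightarrow> S \<cdot> T \<in> M"
  using star_subalgebra by (auto simp: unital_star_subalgebra_def)

lemma scalar_op_mem [intro, simp]: "scalar_op c \<in> M"
  using star_subalgebra by (auto simp: unital_star_subalgebra_def)

lemma one_mem [intro, simp]: "\<one> \<in> M"
  using scalar_op_mem[of 1] by simp

lemma scaleR_mem [intro, simp]: "T \<in> M \<Longrightarrow> r *\<^sub>R T \<in> M"
  by (simp add: scaleR_op_eq)

lemma zero_mem [intro, simp]: "0 \<in> M"
  using scaleR_mem[OF one_mem, of 0] by simp

lemma minus_mem [intro, simp]: "T \<in> M \<Longrightarrow> - T \<in> M"
  using scaleR_mem[of T "-1"] by simp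

lemma diff_mem [intro, simp]: "S \<in> M \<Longrightarrow> T \<in> M \<Longrightarrow> S - T \<in> M"
  using add_mem[of S "- T"] by simp

lemma sum_mem [intro]: "(\<And>i. i \<in> I \<Longrightarrow> f i \<in> M) \<Longrightarrow> sum f I \<in> M"
  by (induction I rule: infinite_finite_induct) auto

lemma scalar_op_right: "T \<in> M \<Longrightarrow> T \<cdot> scalar_op c = scalar_op c \<cdot> T"
  by (simp add: bounded_opsI scalar_op_commute)

lemma scalar_op_left: "T \<in> M \<Longrightarrow> T \<cdot> (scalar_op c \<cdot> S) = scalar_op c \<cdot> (T \<cdot> S)"
  by (metis op_times_assoc scalar_op_right)

lemma scalar_op_scalar_op: "scalar_op c \<cdot> (scalar_op d \<cdot> T) = scalar_op (c * d) \<cdot> T"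
  by (metis op_times_assoc scalar_op_times)

lemma adj_ex:
  assumes "T \<in> M" shows "T\<^sup>\<dagger> \<in> M \<and> is_cadjoint T (T\<^sup>\<dagger>)"
proof -
  obtain S where "S \<in> M" "is_cadjoint T S"
    using star_subalgebra assms by (auto simp: unital_star_subalgebra_def)
  then show ?thesis using cadjoint_eqI by blast
qed

lemma adj_mem [intro, simp]: "T \<in> M \<Longrightarrow> T\<^sup>\<dagger> \<in> M"
  using adj_ex by blast

lemma inner_adj:
  assumes "T \<in> M"
  shows "inner (blinfun_apply T x) y = inner x (blinfun_apply (T\<^sup>\<dagger>) y)"
    "inner x (blinfun_apply T y) = inner (blinfun_apply (T\<^sup>\<dagger>) x) y"
  using adj_ex[OF assms] is_cadjoint_iff_inner[OF bounded_opsI[OF assms]] inner_commute by metis+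

lemma adj_eqI:
  assumes "T \<in> M" "\<And>x y. inner (blinfun_apply T x) y = inner x (blinfun_apply S y)"
  shows "T\<^sup>\<dagger> = S"
  using assms by (intro cadjoint_eqI) (simp add: is_cadjoint_iff_inner[OF bounded_opsI])

lemma adj_adj [simp]: "T \<in> M \<Longrightarrow> T\<^sup>\<dagger>\<^sup>\<dagger> = T"
  by (rule adj_eqI) (auto simp: inner_adj(2))

lemma adj_times: "S \<in> M \<Longrightarrow> T \<in> M \<Longrightarrow> (S \<cdot> T)\<^sup>\<dagger> = T\<^sup>\<dagger> \<cdot> S\<^sup>\<dagger>"
  by (rule adj_eqI) (auto simp: inner_adj(1))

lemma adj_add: "S \<in> M \<Longrightarrow> T \<in> M \<Longrightarrow> (S + T)\<^sup>\<dagger> = S\<^sup>\<dagger> + T\<^sup>\<dagger>"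
  by (rule adj_eqI) (auto simp: inner_adj(1) blinfun.add_left inner_add_left inner_add_right)

lemma adj_scaleR: "T \<in> M \<Longrightarrow> (r *\<^sub>R T)\<^sup>\<dagger> = r *\<^sub>R T\<^sup>\<dagger>"
  by (rule adj_eqI) (auto simp: inner_adj(1) blinfun.scaleR_left)

lemma adj_minus: "T \<in> M \<Longrightarrow> (- T)\<^sup>\<dagger> = - T\<^sup>\<dagger>"
  by (rule adj_eqI) (auto simp: inner_adj(1) blinfun.minus_left)

lemma adj_diff: "S \<in> M \<Longrightarrow> T \<in> M \<Longrightarrow> (S - T)\<^sup>\<dagger> = S\<^sup>\<dagger> - T\<^sup>\<dagger>"
  by (rule adj_eqI) (auto simp: inner_adj(1) blinfun.diff_left inner_diff_left inner_diff_right)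

lemma adj_scalar_op [simp]: "(scalar_op c :: 'a \<Rightarrow>\<^sub>L 'a)\<^sup>\<dagger> = scalar_op (cnj c)"
  by (rule adj_eqI) (auto simp: scalar_op.rep_eq inner_scaleC_left)

lemma adj_one [simp]: "(\<one> :: 'a \<Rightarrow>\<^sub>L 'a)\<^sup>\<dagger> = \<one>"
  using adj_scalar_op[of 1] by (simp del: adj_scalar_op)

lemma adj_zero [simp]: "(0 :: 'a \<Rightarrow>\<^sub>L 'a)\<^sup>\<dagger> = 0"
  by (rule adj_eqI) auto

lemma adj_sum: "(\<And>i. i \<in> I \<Longrightarrow> f i \<in> M) \<Longrightarrow> (sum f I)\<^sup>\<dagger> = (\<Sum>i\<in>I. (f i)\<^sup>\<dagger>)"
  by (induction I rule: infinite_finite_induct) (simp_all add: adj_add sum_mem)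

lemmas adj_simps = adj_times adj_add adj_scaleR adj_minus adj_diff

lemma norm_adj_le:
  assumes "T \<in> M" shows "norm (T\<^sup>\<dagger>) \<le> norm T"
proof (rule norm_blinfun_bound)
  fix x
  have "(norm (blinfun_apply (T\<^sup>\<dagger>) x))\<^sup>2 = inner (blinfun_apply T (blinfun_apply (T\<^sup>\<dagger>) x)) x"
    using assms by (simp add: inner_adj(1) power2_norm_eq_inner)
  also have "\<dots> \<le> norm (blinfun_apply T (blinfun_apply (T\<^sup>\<dagger>) x)) * norm x"
    by (rule norm_cauchy_schwarz)
  also have "\<dots> \<le> norm T * norm (blinfun_apply (T\<^sup>\<dagger>) x) * norm x"
    by (intro mult_right_mono norm_blinfun) simp
  finally have "norm (blinfun_apply (T\<^sup>\<dagger>) x) * norm (blinfun_apply (T\<^sup>\<dagger>) x)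
      \<le> norm (blinfun_apply (T\<^sup>\<dagger>) x) * (norm T * norm x)"
    by (simp add: power2_eq_square mult_ac)
  then show "norm (blinfun_apply (T\<^sup>\<dagger>) x) \<le> norm T * norm x"
    by (metis linorder_not_less mult_le_cancel_left_pos norm_ge_zero order_antisym_conv
            mult_nonneg_nonneg)
qed simp

lemma norm_adj [simp]: "T \<in> M \<Longrightarrow> norm (T\<^sup>\<dagger>) = norm T"
  using norm_adj_le[of T] norm_adj_le[of "T\<^sup>\<dagger>"] by simp

section \<open>Membership through the bicommutant\<close>

lemma real_commutant_apply:
  assumes "T \<in> commutant M" "S \<in> M"
  shows "blinfun_apply T (blinfun_apply S x) = blinfun_apply S (blinfun_apply T x)"
proof -
  have "T \<cdot> S = S \<cdot> T"
    using assms by (simp add: commutant_def)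
  from arg_cong[OF this, of "\<lambda>U. blinfun_apply U x"] show ?thesis by simp
qed

text \<open>The bicommutant condition enters here: a limit of elements of \<open>M\<close> is
  recognized by equations with each element of the commutant, and these survive even weak
  limits.\<close>

lemma memI:
  assumes "T \<in> bounded_ops"
    "\<And>S x. S \<in> commutant M \<Longrightarrow>
      blinfun_apply T (blinfun_apply S x) = blinfun_apply S (blinfun_apply T x)"
  shows "T \<in> M"
proof -
  have "T \<in> commutant (commutant M)"
    unfolding commutant_def[of "commutant M"]
  proof (intro CollectI conjI ballI)
    show "T \<cdot> S = S \<cdot> T" if "S \<in> commutant M" for S
      by (rule blinfun_eqI) (simp add: assms(2)[OF that])
  qed (rule assms)
  then show ?thesis by (simp add: bicommutant)
qed

lemma mem_iff: "T \<in> M \<longleftrightarrow>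
    (\<forall>c x. blinfun_apply T (c *\<^sub>C x) = c *\<^sub>C blinfun_apply T x) \<and>
    (\<forall>S x. S \<in> commutant M \<longrightarrow>
      blinfun_apply T (blinfun_apply S x) = blinfun_apply S (blinfun_apply T x))"
  using memI[of T] bounded_opsI[of T] real_commutant_apply[of _ T]
  by (auto simp: bounded_ops_def)

text \<open>Membership is a family of pointwise equations, each of them closed in operator norm.
  This gives the completeness needed for the fixed point that produces square roots.\<close>

lemma closed: "closed M"
proof -
  have "M = (\<Inter>c x. {T. blinfun_apply T (c *\<^sub>C x) = c *\<^sub>C blinfun_apply T x}) \<inter>
      (\<Inter>S\<in>commutant M. \<Inter>x. {T. blinfun_apply T (blinfun_apply S x) = blinfun_apply S (blinfun_apply T x)})"
    by (rule set_eqI, subst mem_iff) auto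
  also have "closed \<dots>"
    by (intro closed_Int closed_INT ballI closed_Collect_eq continuous_intros
        bounded_linear.continuous_on[OF bounded_linear_scaleC])
  finally show ?thesis .
qed

section \<open>The trace\<close>

lemmas state_facts = state[unfolded faithful_normal_tracial_state_def]

lemma tr_add: "S \<in> M \<Longrightarrow> T \<in> M \<Longrightarrow> \<tau> (S + T) = \<tau> S + \<tau> T"
  using state_facts[THEN conjunct1] by blast

lemma tr_scalar: "T \<in> M \<Longrightarrow> \<tau> (scalar_op c \<cdot> T) = c * \<tau> T"
  using state_facts[THEN conjunct2, THEN conjunct1] by blast

lemma tr_one [simp]: "\<tau> \<one> = 1"
  using state_facts[THEN conjunct2, THEN conjunct2, THEN conjunct1] .

lemma tr_commute: "S \<in> M \<Longrightarrow> T \<in> M \<Longrightarrow> \<tau> (S \<cdot> T) = \<tau> (T \<cdot> S)"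
  using state_facts[THEN conjunct2, THEN conjunct2, THEN conjunct2, THEN conjunct2, THEN conjunct2, THEN conjunct1]
  by blast

lemma tr_scaleR: "T \<in> M \<Longrightarrow> \<tau> (r *\<^sub>R T) = complex_of_real r * \<tau> T"
  by (simp add: scaleR_op_eq tr_scalar)

lemma tr_scalar_op [simp]: "\<tau> (scalar_op c) = c"
  using tr_scalar[OF one_mem, of c] by simp

lemma tr_zero [simp]: "\<tau> 0 = 0"
  using tr_scaleR[OF one_mem, of 0] by simp

lemma tr_minus: "T \<in> M \<Longrightarrow> \<tau> (- T) = - \<tau> T"
  using tr_scaleR[of T "-1"] by simp

lemma tr_diff: "S \<in> M \<Longrightarrow> T \<in> M \<Longrightarrow> \<tau> (S - T) = \<tau> S - \<tau> T"
  using tr_add[of S "- T"] by (simp add: tr_minus)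

lemma tr_sum: "(\<And>i. i \<in> I \<Longrightarrow> f i \<in> M) \<Longrightarrow> \<tau> (sum f I) = (\<Sum>i\<in>I. \<tau> (f i))"
  by (induction I rule: infinite_finite_induct) (simp_all add: tr_add sum_mem)

lemmas tr_simps = tr_add tr_diff tr_minus tr_scaleR tr_scalar

section \<open>The 2-norm and its Cauchy-Schwarz inequality\<close>

abbreviation tn :: "('a \<Rightarrow>\<^sub>L 'a) \<Rightarrow> real" where
  "tn \<equiv> two_norm \<tau>"

lemma tr_square_nonneg: "T \<in> M \<Longrightarrow> Im (\<tau> (T\<^sup>\<dagger> \<cdot> T)) = 0 \<and> 0 \<le> Re (\<tau> (T\<^sup>\<dagger> \<cdot> T))"
  using state_facts[THEN conjunct2, THEN conjunct2, THEN conjunct2, THEN conjunct1] by blast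

lemma tr_square: "T \<in> M \<Longrightarrow> \<tau> (T\<^sup>\<dagger> \<cdot> T) = complex_of_real ((tn T)\<^sup>2)"
  using tr_square_nonneg[of T] by (simp add: two_norm_def complex_eq_iff)

lemma tn_power2: "T \<in> M \<Longrightarrow> (tn T)\<^sup>2 = Re (\<tau> (T\<^sup>\<dagger> \<cdot> T))"
  by (simp add: tr_square)

lemma tn_nonneg [simp]: "T \<in> M \<Longrightarrow> 0 \<le> tn T"
  using tr_square_nonneg[of T] by (simp add: two_norm_def)

lemma tn_eq_0D: "T \<in> M \<Longrightarrow> tn T = 0 \<Longrightarrow> T = 0"
  using state_facts[THEN conjunct2, THEN conjunct2, THEN conjunct2, THEN conjunct2, THEN conjunct1]
    tr_square[of T] by simp

lemma tn_zero [simp]: "tn 0 = 0"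
  by (simp add: two_norm_def)

lemma tn_one [simp]: "tn \<one> = 1"
  by (simp add: two_norm_def)

text \<open>By polarization: the trace of
  \<open>(\<one> + S)\<^sup>\<dagger> \<cdot> (\<one> + S)\<close> is real, which relates the
  imaginary parts; applied to \<open>\<i>\<close> times \<open>T\<close>, the same relation yields
  the real parts.\<close>

lemma tr_adj:
  assumes "T \<in> M" shows "\<tau> (T\<^sup>\<dagger>) = cnj (\<tau> T)"
proof -
  have im: "Im (\<tau> (S\<^sup>\<dagger>)) = - Im (\<tau> S)" if "S \<in> M" for S
  proof -
    have "Im (\<tau> ((\<one> + S)\<^sup>\<dagger> \<cdot> (\<one> + S))) = 0"
      using that by (simp add: tr_square)
    also have "(\<one> + S)\<^sup>\<dagger> \<cdot> (\<one> + S) = \<one> + S + (S\<^sup>\<dagger> + S\<^sup>\<dagger> \<cdot> S)"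
      using that by (simp add: adj_add op_distrib)
    finally show ?thesis
      using that by (simp add: tr_add tr_square)
  qed
  have "\<tau> ((scalar_op \<i> \<cdot> T)\<^sup>\<dagger>) = \<tau> (T\<^sup>\<dagger> \<cdot> scalar_op (cnj \<i>))"
    using assms by (simp add: adj_times)
  also have "\<dots> = - \<i> * \<tau> (T\<^sup>\<dagger>)"
    using assms by (subst tr_commute) (auto simp: tr_scalar)
  finally show ?thesis
    using im[of T] im[of "scalar_op \<i> \<cdot> T"] assms by (simp add: complex_eq_iff tr_scalar)
qed

lemma tn_adj [simp]: "T \<in> M \<Longrightarrow> tn (T\<^sup>\<dagger>) = tn T"
  by (simp add: two_norm_def tr_commute)

lemma tn_scalar: 
  assumes "T \<in> M" shows "tn (scalar_op c \<cdot> T) = cmod c * tn T"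
proof -
  have "(tn (scalar_op c \<cdot> T))\<^sup>2 = Re (\<tau> ((scalar_op c \<cdot> T)\<^sup>\<dagger> \<cdot> (scalar_op c \<cdot> T)))"
    using assms by (simp add: tn_power2)
  also have "(scalar_op c \<cdot> T)\<^sup>\<dagger> \<cdot> (scalar_op c \<cdot> T) = T\<^sup>\<dagger> \<cdot> (scalar_op (cnj c * c) \<cdot> T)"
    using assms by (simp add: adj_times op_times_assoc scalar_op_scalar_op)
  also have "\<dots> = scalar_op (cnj c * c) \<cdot> (T\<^sup>\<dagger> \<cdot> T)"
    using assms by (simp add: scalar_op_left)
  also have "Re (\<tau> \<dots>) = (cmod c * tn T)\<^sup>2"
    using assms by (simp add: tr_scalar tr_square power_mult_distrib cmod_power2)
      (simp add: power2_eq_square)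
  finally show ?thesis
    using assms by (simp add: power2_eq_iff_nonneg)
qed

lemma tn_scaleR: "T \<in> M \<Longrightarrow> tn (r *\<^sub>R T) = \<bar>r\<bar> * tn T"
  by (simp add: scaleR_op_eq tn_scalar)

lemma tn_minus [simp]: "T \<in> M \<Longrightarrow> tn (- T) = tn T"
  using tn_scaleR[of T "-1"] by simp

lemma tn_add_power2:
  assumes "S \<in> M" "T \<in> M"
  shows "(tn (S + T))\<^sup>2 = (tn S)\<^sup>2 + (tn T)\<^sup>2 + 2 * Re (\<tau> (S\<^sup>\<dagger> \<cdot> T))"
proof -
  have "\<tau> (T\<^sup>\<dagger> \<cdot> S) = cnj (\<tau> (S\<^sup>\<dagger> \<cdot> T))"
    using assms tr_adj[of "S\<^sup>\<dagger> \<cdot> T"] by (simp add: adj_times)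
  then show ?thesis
    using assms by (simp add: tn_power2 adj_add op_distrib tr_add)
qed

lemma tn_diff_power2:
  assumes "S \<in> M" "T \<in> M"
  shows "(tn (S - T))\<^sup>2 = (tn S)\<^sup>2 + (tn T)\<^sup>2 - 2 * Re (\<tau> (S\<^sup>\<dagger> \<cdot> T))"
  using tn_add_power2[of S "- T"] assms by (simp add: op_distrib tr_simps)

lemma tn_parallelogram:
  assumes "S \<in> M" "T \<in> M"
  shows "(tn (S + T))\<^sup>2 + (tn (S - T))\<^sup>2 = 2 * (tn S)\<^sup>2 + 2 * (tn T)\<^sup>2"
  using assms by (simp add: tn_add_power2 tn_diff_power2)

lemma Re_tr_le:
  assumes "S \<in> M" "T \<in> M"
  shows "Re (\<tau> (S\<^sup>\<dagger> \<cdot> T)) \<le> tn S * tn T"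
proof (cases "tn S = 0 \<or> tn T = 0")
  case True
  then have "S = 0 \<or> T = 0" using assms tn_eq_0D by blast
  then show ?thesis using assms by (auto simp: op_distrib)
next
  case False
  then have pos: "tn S > 0" "tn T > 0"
    using assms tn_nonneg by (metis order_le_less)+
  \<comment> \<open>This combination vanishes in the case of equality; the crossed weights make its
    square factor.\<close>
  have "0 \<le> (tn (tn T *\<^sub>R S - tn S *\<^sub>R T))\<^sup>2"
    by simp
  also have "\<dots> = 2 * (tn S * tn T) * (tn S * tn T - Re (\<tau> (S\<^sup>\<dagger> \<cdot> T)))"
    using assms by (subst tn_diff_power2)
      (auto simp: tn_scaleR adj_scaleR op_distrib tr_scaleR power_mult_distrib power2_eq_square algebra_simps)
  finally show ?thesis
    using pos by (simp add: zero_le_mult_iff not_le mult_less_0_iff)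
      (metis mult_pos_pos not_le)
qed

lemma cmod_tr_le:
  assumes "S \<in> M" "T \<in> M"
  shows "cmod (\<tau> (S\<^sup>\<dagger> \<cdot> T)) \<le> tn S * tn T"
proof -
  define z where "z = \<tau> (S\<^sup>\<dagger> \<cdot> T)"
  obtain c where c: "cmod c = 1" "c * z = cmod z"
    using rotate_to_norm by blast
  have "cmod z = Re (\<tau> (S\<^sup>\<dagger> \<cdot> (scalar_op c \<cdot> T)))"
    using assms c(2) tr_scalar[of "S\<^sup>\<dagger> \<cdot> T" c]
    by (simp add: z_def scalar_op_left)
  also have "\<dots> \<le> tn S * tn (scalar_op c \<cdot> T)"
    using assms by (intro Re_tr_le) auto
  finally show ?thesis
    using assms c by (simp add: tn_scalar z_def)
qed

lemma cmod_tr_le_tn: "T \<in> M \<Longrightarrow> cmod (\<tau> T) \<le> tn T"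
  using cmod_tr_le[of \<one> T] by simp

lemma tn_triangle:
  assumes "S \<in> M" "T \<in> M" shows "tn (S + T) \<le> tn S + tn T"
proof (rule power2_le_imp_le)
  show "(tn (S + T))\<^sup>2 \<le> (tn S + tn T)\<^sup>2"
    using assms Re_tr_le[of S T] by (simp add: tn_add_power2 power2_sum)
qed (use assms in auto)

lemma tn_triangle_diff:
  assumes "S \<in> M" "T \<in> M" shows "tn (S - T) \<le> tn S + tn T"
  using tn_triangle[of S "- T"] assms by simp

lemma tn_sum: "(\<And>i. i \<in> I \<Longrightarrow> f i \<in> M) \<Longrightarrow> tn (sum f I) \<le> (\<Sum>i\<in>I. tn (f i))"
proof (induction I rule: infinite_finite_induct)
  case (insert x F)
  then have "tn (f x + sum f F) \<le> tn (f x) + tn (sum f F)"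
    by (intro tn_triangle sum_mem) auto
  with insert show ?case by force
qed auto

section \<open>Square roots and mixed estimates of operator norm and 2-norm\<close>

lemma norm_times_le: "norm S \<le> a \<Longrightarrow> norm T \<le> b \<Longrightarrow> norm (S \<cdot> T) \<le> a * b"
  by (rule order_trans[OF norm_blinfun_compose]) (meson mult_mono norm_ge_zero order_trans)

text \<open>The square root is \<open>\<one> - U\<close> for the fixed point \<open>U\<close> of the contraction
  \<open>U \<mapsto> (T + U\<^sup>2) / 2\<close>.\<close>

lemma sqrt_one_minus:
  assumes "T \<in> M" "T\<^sup>\<dagger> = T" "norm T < 1"
  obtains S where "S \<in> M" "S\<^sup>\<dagger> = S" "S \<cdot> S = \<one> - T"
    "\<And>Z. T \<cdot> Z = Z \<cdot> T \<Longrightarrow> S \<cdot> Z = Z \<cdot> S"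
proof -
  \<comment> \<open>The smaller root of \<open>\<rho>\<^sup>2 - 2 * \<rho> + norm T = 0\<close>. The
    ball of radius \<open>\<rho>\<close> is then mapped into itself, and \<open>\<rho> < 1\<close>
    is the contraction constant there.\<close>
  define \<rho> where "\<rho> = 1 - sqrt (1 - norm T)"
  have \<rho>: "0 \<le> \<rho>" "\<rho> < 1" "norm T + \<rho>\<^sup>2 = 2 * \<rho>"
    using assms(3) by (simp_all add: \<rho>_def power2_diff)
  \<comment> \<open>Self-adjointness and commutation are built into the domain, so that the fixed
    point inherits them.\<close>
  define X where "X = {U \<in> M. U\<^sup>\<dagger> = U \<and> norm U \<le> \<rho> \<and> (\<forall>Z. T \<cdot> Z = Z \<cdot> T \<longrightarrow> U \<cdot> Z = Z \<cdot> U)}"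
  have XD: "U \<in> M" "U\<^sup>\<dagger> = U" "norm U \<le> \<rho>" if "U \<in> X" for U
    using that unfolding X_def by blast+
  have Xcomm: "U \<cdot> Z = Z \<cdot> U" if "U \<in> X" "T \<cdot> Z = Z \<cdot> T" for U Z
    using that unfolding X_def by blast
  define F where "F U = (1/2) *\<^sub>R (T + U \<cdot> U)" for U
  have "X = M \<inter> (\<Inter>x y. {U. inner (blinfun_apply U x) y = inner x (blinfun_apply U y)}) \<inter>
      {U. norm U \<le> \<rho>} \<inter> (\<Inter>Z\<in>{Z. T \<cdot> Z = Z \<cdot> T}. {U. U \<cdot> Z = Z \<cdot> U})"
    unfolding X_def using adj_eqI inner_adj(1) by fastforce
  also have "closed \<dots>"
    by (intro closed_Int closed closed_INT ballI closed_Collect_eq closed_Collect_le continuous_intros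
        bounded_bilinear.continuous_on[OF bounded_bilinear_blinfun_compose])
  finally have "complete X"
    by (simp add: complete_eq_closed)
  moreover have "0 \<in> X"
    using \<rho> by (simp add: X_def)
  moreover have "F U \<in> X" if "U \<in> X" for U
  proof -
    have "norm (F U) \<le> (norm T + norm (U \<cdot> U)) / 2"
      using norm_triangle_ineq[of T "U \<cdot> U"] by (simp add: F_def)
    also have "\<dots> \<le> (norm T + \<rho> * \<rho>) / 2"
      using norm_times_le[of U \<rho> U \<rho>] XD[OF that] by simp
    also have "\<dots> = \<rho>"
      using \<rho>(3) by (simp add: power2_eq_square)
    finally have "norm (F U) \<le> \<rho>" .
    moreover have "F U \<cdot> Z = Z \<cdot> F U" if "T \<cdot> Z = Z \<cdot> T" for Z
    proof -
      have "U \<cdot> Z = Z \<cdot> U"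
        using Xcomm[OF \<open>U \<in> X\<close> that] .
      then have "U \<cdot> (U \<cdot> Z) = Z \<cdot> (U \<cdot> U)"
        by (metis op_times_assoc)
      then show ?thesis
        using that by (simp add: F_def op_distrib op_times_assoc)
    qed
    moreover have "F U \<in> M" "(F U)\<^sup>\<dagger> = F U"
      using XD[OF that] assms by (simp_all add: F_def adj_simps)
    ultimately show ?thesis
      unfolding X_def by blast
  qed
  moreover have "dist (F U) (F V) \<le> \<rho> * dist U V" if "U \<in> X" "V \<in> X" for U V
  proof -
    have "F U - F V = (1/2) *\<^sub>R (U \<cdot> (U - V) + (U - V) \<cdot> V)"
      by (simp add: F_def op_distrib flip: scaleR_diff_right)
    then have "norm (F U - F V) \<le> (norm (U \<cdot> (U - V)) + norm ((U - V) \<cdot> V)) / 2"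
      using norm_triangle_ineq[of "U \<cdot> (U - V)" "(U - V) \<cdot> V"] by simp
    also have "\<dots> \<le> (\<rho> * norm (U - V) + norm (U - V) * \<rho>) / 2"
      using that by (intro divide_right_mono add_mono norm_times_le) (auto simp: XD)
    finally show ?thesis
      by (simp add: dist_norm)
  qed
  ultimately have "\<exists>!U\<in>X. F U = U"
    by (intro Banach_fix[OF _ _ \<rho>(1,2)]) auto
  then obtain U where U: "U \<in> X" "F U = U" by blast
  have "U + U = 2 *\<^sub>R F U"
    by (simp add: U(2) scaleR_2)
  also have "\<dots> = T + U \<cdot> U"
    by (simp add: F_def)
  finally have "(\<one> - U) \<cdot> (\<one> - U) = \<one> - T"
    by (simp add: op_distrib algebra_simps)
  moreover have "(\<one> - U) \<cdot> Z = Z \<cdot> (\<one> - U)" if "T \<cdot> Z = Z \<cdot> T" for Z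
    using Xcomm[OF U(1) that] by (simp add: op_distrib)
  moreover have "\<one> - U \<in> M" "(\<one> - U)\<^sup>\<dagger> = \<one> - U"
    using XD[OF U(1)] by (simp_all add: adj_diff)
  ultimately show ?thesis
    using that[of "\<one> - U"] by blast
qed

text \<open>For \<open>c > norm S\<close> the operator \<open>\<one> - (1 / c\<^sup>2) *\<^sub>R
  (S\<^sup>\<dagger> \<cdot> S)\<close> is the square of a self-adjoint \<open>Q\<close>, and
  positivity of the trace on \<open>(Q \<cdot> T)\<^sup>\<dagger> \<cdot> (Q \<cdot> T)\<close> is
  the estimate with \<open>c\<close> in place of \<open>norm S\<close>.\<close>

lemma tn_times_left:
  assumes "S \<in> M" "T \<in> M" shows "tn (S \<cdot> T) \<le> norm S * tn T"
proof (rule field_le_epsilon)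
  fix e :: real assume "0 < e"
  \<comment> \<open>The excess over \<open>norm S\<close> makes \<open>norm A < 1\<close> strict
    and, multiplied by \<open>tn T\<close>, costs at most \<open>e\<close>.\<close>
  define c where "c = norm S + e / (tn T + 1)"
  have tn0: "0 < tn T + 1"
    using tn_nonneg[OF assms(2)] by linarith
  have c: "norm S < c" "0 < c"
    using \<open>0 < e\<close> tn0 norm_ge_zero[of S] by (simp_all add: c_def add_nonneg_pos)
  define A where "A = (1 / c\<^sup>2) *\<^sub>R (S\<^sup>\<dagger> \<cdot> S)"
  have "norm (S\<^sup>\<dagger> \<cdot> S) \<le> norm S * norm S"
    using assms by (intro norm_times_le) auto
  also have "\<dots> < c\<^sup>2"
    using c by (simp add: power2_eq_square mult_strict_mono')
  finally have "norm A < 1"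
    using c by (simp add: A_def)
  moreover have "A \<in> M" "A\<^sup>\<dagger> = A"
    using assms by (simp_all add: A_def adj_simps)
  ultimately obtain Q where Q: "Q \<in> M" "Q\<^sup>\<dagger> = Q" "Q \<cdot> Q = \<one> - A"
    using sqrt_one_minus by metis
  have "0 \<le> Re (\<tau> ((Q \<cdot> T)\<^sup>\<dagger> \<cdot> (Q \<cdot> T)))"
    using Q(1) assms by (intro tr_square_nonneg[THEN conjunct2]) auto
  also have "(Q \<cdot> T)\<^sup>\<dagger> \<cdot> (Q \<cdot> T) = T\<^sup>\<dagger> \<cdot> (Q \<cdot> Q) \<cdot> T"
    using Q(1,2) assms by (simp add: adj_times op_times_assoc)
  also have "\<dots> = T\<^sup>\<dagger> \<cdot> T - (1 / c\<^sup>2) *\<^sub>R ((S \<cdot> T)\<^sup>\<dagger> \<cdot> (S \<cdot> T))"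
    using assms unfolding Q(3) A_def by (simp add: adj_times op_simps)
  also have "Re (\<tau> \<dots>) = (tn T)\<^sup>2 - (tn (S \<cdot> T))\<^sup>2 / c\<^sup>2"
    using assms by (simp add: tr_simps tr_square del: tn_power2)
  finally have "(tn (S \<cdot> T))\<^sup>2 \<le> (c * tn T)\<^sup>2"
    using c by (simp add: field_simps power_mult_distrib)
  then have "tn (S \<cdot> T) \<le> c * tn T"
    using c assms by (simp add: power2_le_iff_abs_le)
  also have "\<dots> = norm S * tn T + e * (tn T / (tn T + 1))"
    by (simp add: c_def algebra_simps)
  also have "\<dots> \<le> norm S * tn T + e"
    using \<open>0 < e\<close> tn0 by (simp add: field_simps)
  finally show "tn (S \<cdot> T) \<le> norm S * tn T + e" .
qed

lemma tn_times_right: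
  assumes "S \<in> M" "T \<in> M" shows "tn (S \<cdot> T) \<le> tn S * norm T"
proof -
  have "tn (S \<cdot> T) = tn (T\<^sup>\<dagger> \<cdot> S\<^sup>\<dagger>)"
    using assms by (metis adj_times tn_adj times_mem)
  also have "\<dots> \<le> norm T * tn S"
    using assms tn_times_left[of "T\<^sup>\<dagger>" "S\<^sup>\<dagger>"] by simp
  finally show ?thesis by (simp add: mult.commute)
qed

lemma tn_times_left_le: "S \<in> M \<Longrightarrow> T \<in> M \<Longrightarrow> norm S \<le> a \<Longrightarrow> tn T \<le> b \<Longrightarrow> tn (S \<cdot> T) \<le> a * b"
  by (rule order_trans[OF tn_times_left]) (simp_all add: mult_mono')

lemma tn_times_right_le: "S \<in> M \<Longrightarrow> T \<in> M \<Longrightarrow> tn S \<le> a \<Longrightarrow> norm T \<le> b \<Longrightarrow> tn (S \<cdot> T) \<le> a * b"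
  by (rule order_trans[OF tn_times_right]) (simp_all add: mult_mono')

lemma tn_le_norm: "T \<in> M \<Longrightarrow> tn T \<le> norm T"
  using tn_times_left[of T \<one>] by simp

lemma cmod_tr_le_norm: "T \<in> M \<Longrightarrow> cmod (\<tau> T) \<le> norm T"
  using cmod_tr_le_tn tn_le_norm order_trans by blast

section \<open>Contractions and unitaries\<close>

lemma inner_square_adj: "T \<in> M \<Longrightarrow> inner x (blinfun_apply (T\<^sup>\<dagger> \<cdot> T) x) = (norm (blinfun_apply T x))\<^sup>2"
  by (simp add: power2_norm_eq_inner inner_adj(1))

lemma norm_apply_le: "norm V \<le> 1 \<Longrightarrow> norm (blinfun_apply V x) \<le> norm x"
  using norm_blinfun[of V x] mult_right_mono[of "norm V" 1 "norm x"] by simp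

text \<open>Tested on a vector, this says that the square of the defect of a contraction is at most
  the defect.\<close>

lemma norm_defect_le:
  assumes "V \<in> M" "norm V \<le> 1"
  shows "(norm (blinfun_apply (\<one> - V\<^sup>\<dagger> \<cdot> V) x))\<^sup>2 \<le> (norm x)\<^sup>2 - (norm (blinfun_apply V x))\<^sup>2"
proof -
  define y where "y = blinfun_apply V x"
  have "norm (blinfun_apply (V\<^sup>\<dagger>) y) \<le> norm y"
    using assms by (intro norm_apply_le) simp
  then have "inner (blinfun_apply (V\<^sup>\<dagger>) y) (blinfun_apply (V\<^sup>\<dagger>) y) \<le> inner y y"
    by (simp add: power_mono flip: power2_norm_eq_inner)
  moreover have "inner x (blinfun_apply (V\<^sup>\<dagger>) y) = inner y y"
    using assms by (simp add: y_def inner_adj(1))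
  ultimately show ?thesis
    unfolding power2_norm_eq_inner
    by (simp add: blinfun.diff_left inner_diff_left inner_diff_right inner_commute flip: y_def)
qed

text \<open>A contraction \<open>V\<close> can be enlarged between its defect operators: this is a Schur complement
  argument, averaged over the two ways of splitting the identity.\<close>

lemma contraction_perturb:
  assumes "V \<in> M" "norm V \<le> 1" "Z \<in> M" "norm Z \<le> 1"
  shows "norm (V + (1/2) *\<^sub>R ((\<one> - V \<cdot> V\<^sup>\<dagger>) \<cdot> Z \<cdot> (\<one> - V\<^sup>\<dagger> \<cdot> V))) \<le> 1"
proof (rule norm_blinfun_bound)
  fix x
  define D where "D = \<one> - V \<cdot> V\<^sup>\<dagger>"
  define D' where "D' = \<one> - V\<^sup>\<dagger> \<cdot> V"
  define W where "W = V + (1/2) *\<^sub>R (D \<cdot> Z \<cdot> D')"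
  define y where "y = blinfun_apply W x"
  have D_M: "D \<in> M" "D\<^sup>\<dagger> = D"
    using assms by (simp_all add: D_def adj_simps)
  have D'x: "(norm (blinfun_apply D' x))\<^sup>2 \<le> (norm x)\<^sup>2 - (norm (blinfun_apply V x))\<^sup>2"
    unfolding D'_def using assms by (intro norm_defect_le)
  have Dy: "(norm (blinfun_apply D y))\<^sup>2 \<le> (norm y)\<^sup>2 - (norm (blinfun_apply (V\<^sup>\<dagger>) y))\<^sup>2"
    using norm_defect_le[of "V\<^sup>\<dagger>" y] assms by (simp add: D_def)
  have "(norm y)\<^sup>2 = inner (blinfun_apply W x) y"
    by (simp add: y_def power2_norm_eq_inner)
  also have "\<dots> = inner (blinfun_apply V x) y
      + inner (blinfun_apply D (blinfun_apply Z (blinfun_apply D' x))) y / 2"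
    by (simp add: W_def blinfun.add_left blinfun.scaleR_left inner_add_left)
  also have "inner (blinfun_apply D (blinfun_apply Z (blinfun_apply D' x))) y
      = inner (blinfun_apply Z (blinfun_apply D' x)) (blinfun_apply D y)"
    using D_M by (simp add: inner_adj(1))
  also have "\<dots> \<le> norm (blinfun_apply D' x) * norm (blinfun_apply D y)"
    using norm_apply_le[OF assms(4)]
    by (intro order_trans[OF norm_cauchy_schwarz] mult_right_mono) auto
  also have "\<dots> \<le> ((norm (blinfun_apply D' x))\<^sup>2 + (norm (blinfun_apply D y))\<^sup>2) / 2"
    using sum_squares_bound[of "norm (blinfun_apply D' x)" "norm (blinfun_apply D y)"] by simp
  also have "\<dots> \<le> ((norm x)\<^sup>2 - (norm (blinfun_apply V x))\<^sup>2 + ((norm y)\<^sup>2 - (norm (blinfun_apply (V\<^sup>\<dagger>) y))\<^sup>2)) / 2"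
    using D'x Dy by simp
  finally have 1: "(norm y)\<^sup>2 \<le> inner (blinfun_apply V x) y + ((norm x)\<^sup>2 - (norm (blinfun_apply V x))\<^sup>2
      + ((norm y)\<^sup>2 - (norm (blinfun_apply (V\<^sup>\<dagger>) y))\<^sup>2)) / 2 / 2"
    by simp
  have am: "inner u v \<le> ((norm u)\<^sup>2 + (norm v)\<^sup>2) / 2" for u v :: 'a
    using norm_cauchy_schwarz[of u v] sum_squares_bound[of "norm u" "norm v"] by simp
  have "inner (blinfun_apply V x) y = inner x (blinfun_apply (V\<^sup>\<dagger>) y)"
    using assms by (simp add: inner_adj(1))
  \<comment> \<open>The inner product is written half as \<open>V x\<close> against \<open>y\<close>
    and half as \<open>x\<close> against \<open>V\<^sup>\<dagger>\<close> applied to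
    \<open>y\<close>. All terms then carry the weight 1/4, as in fact 1 because of the factor 1/2
    before the perturbation, and the norms of the images under \<open>V\<close> and
    \<open>V\<^sup>\<dagger>\<close> cancel.\<close>
  then have "2 * inner (blinfun_apply V x) y \<le> ((norm (blinfun_apply V x))\<^sup>2 + (norm y)\<^sup>2) / 2
      + ((norm x)\<^sup>2 + (norm (blinfun_apply (V\<^sup>\<dagger>) y))\<^sup>2) / 2"
    using am[of "blinfun_apply V x" y] am[of x "blinfun_apply (V\<^sup>\<dagger>) y"] by argo
  with 1 have "(norm y)\<^sup>2 \<le> (norm x)\<^sup>2"
    by argo
  then show "norm (blinfun_apply (V + (1/2) *\<^sub>R ((\<one> - V \<cdot> V\<^sup>\<dagger>) \<cdot> Z \<cdot> (\<one> - V\<^sup>\<dagger> \<cdot> V))) x) \<le> 1 * norm x"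
    using power2_le_imp_le by (simp add: y_def W_def D_def D'_def)
qed simp

section \<open>Unitaries and their linear span\<close>

definition unitaries :: "('a \<Rightarrow>\<^sub>L 'a) set" where
  "unitaries = {U \<in> M. U\<^sup>\<dagger> \<cdot> U = \<one> \<and> U \<cdot> U\<^sup>\<dagger> = \<one>}"

lemma unitary_mem: "U \<in> unitaries \<Longrightarrow> U \<in> M"
  by (simp add: unitaries_def)

lemma unitary_cancel:
  assumes "U \<in> unitaries"
  shows "U\<^sup>\<dagger> \<cdot> U = \<one>" "U \<cdot> U\<^sup>\<dagger> = \<one>" "U\<^sup>\<dagger> \<cdot> (U \<cdot> T) = T" "U \<cdot> (U\<^sup>\<dagger> \<cdot> T) = T"
  using assms by (simp_all add: unitaries_def flip: op_times_assoc)

lemma one_unitary: "\<one> \<in> unitaries"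
  by (simp add: unitaries_def)

lemma unitary_times: "U \<in> unitaries \<Longrightarrow> V \<in> unitaries \<Longrightarrow> U \<cdot> V \<in> unitaries"
  unfolding unitaries_def[THEN eqset_imp_iff, of "U \<cdot> V"]
  by (simp add: unitary_mem adj_times op_times_assoc unitary_cancel)

lemma norm_unitary_le:
  assumes "U \<in> unitaries" shows "norm U \<le> 1"
proof (rule norm_blinfun_bound)
  fix x
  have "(norm (blinfun_apply U x))\<^sup>2 = (norm x)\<^sup>2"
    using inner_square_adj[of U x] unitary_mem[OF assms] unitary_cancel(1)[OF assms]
    by (simp add: power2_norm_eq_inner)
  then show "norm (blinfun_apply U x) \<le> 1 * norm x" by simp
qed simp

lemma tn_unitary_conj:
  assumes "U \<in> unitaries" "T \<in> M" shows "tn (U \<cdot> T \<cdot> U\<^sup>\<dagger>) = tn T"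
proof -
  have "\<tau> ((U \<cdot> T \<cdot> U\<^sup>\<dagger>)\<^sup>\<dagger> \<cdot> (U \<cdot> T \<cdot> U\<^sup>\<dagger>)) = \<tau> (U \<cdot> (T\<^sup>\<dagger> \<cdot> T \<cdot> U\<^sup>\<dagger>))"
    using assms unitary_mem[OF assms(1)] unitary_cancel[OF assms(1)]
    by (simp add: adj_times op_times_assoc)
  also have "\<dots> = \<tau> (T\<^sup>\<dagger> \<cdot> T)"
    using assms unitary_mem[OF assms(1)] unitary_cancel[OF assms(1)]
    by (subst tr_commute) (auto simp: op_times_assoc)
  finally show ?thesis by (simp add: two_norm_def)
qed

text \<open>\<open>U\<close> is \<open>H\<close> plus \<open>\<i>\<close> times the root of
  \<open>\<one> - H \<cdot> H\<close>. It is unitary because that root commutes with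
  \<open>H\<close>, by the commutation clause of \<open>sqrt_one_minus\<close>.\<close>

lemma self_adjoint_unitary_average:
  assumes "H \<in> M" "H\<^sup>\<dagger> = H" "norm H < 1"
  obtains U where "U \<in> unitaries" "H = (1/2) *\<^sub>R (U + U\<^sup>\<dagger>)"
proof -
  have "norm (H \<cdot> H) \<le> norm H * norm H"
    by (rule norm_blinfun_compose)
  also have "\<dots> < 1 * 1"
    using assms(3) by (intro mult_strict_mono') auto
  finally have "norm (H \<cdot> H) < 1" by simp
  then obtain S where S: "S \<in> M" "S\<^sup>\<dagger> = S" "S \<cdot> S = \<one> - H \<cdot> H"
    "\<And>Z. H \<cdot> H \<cdot> Z = Z \<cdot> (H \<cdot> H) \<Longrightarrow> S \<cdot> Z = Z \<cdot> S"
    using sqrt_one_minus[of "H \<cdot> H"] assms by (metis adj_times times_mem)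
  have comm: "S \<cdot> H = H \<cdot> S"
    by (rule S(4)) (simp add: op_times_assoc)
  define J where "J = (scalar_op \<i> :: 'a \<Rightarrow>\<^sub>L 'a)"
  have J: "J \<in> M" "J\<^sup>\<dagger> = - J" "J \<cdot> J = - \<one>"
    by (simp_all add: J_def scalar_op_times scalar_op_minus)
  have JT: "T \<cdot> J = J \<cdot> T" "T \<cdot> (J \<cdot> V) = J \<cdot> (T \<cdot> V)" if "T \<in> M" for T V
    using that by (simp_all add: J_def scalar_op_right scalar_op_left)
  have JJ: "J \<cdot> (J \<cdot> V) = - V" for V
    by (simp add: J_def scalar_op_scalar_op scalar_op_minus op_distrib)
  note JSH = JT[OF S(1)] JT[OF assms(1)] JJ
  define U where "U = H + J \<cdot> S"
  have adj: "U\<^sup>\<dagger> = H - J \<cdot> S"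
    using assms S(1,2) J by (simp add: U_def adj_simps op_distrib JSH)
  have "U \<in> unitaries"
    unfolding unitaries_def mem_Collect_eq adj using assms S(1) J(1)
    by (simp add: U_def op_distrib op_times_assoc JSH S(3) comm J(3))
  moreover have "H = (1/2) *\<^sub>R (U + U\<^sup>\<dagger>)"
    unfolding adj by (simp add: U_def flip: scaleR_2)
  ultimately show ?thesis using that by blast
qed

text \<open>Unitaries span \<open>M\<close>: after scaling, a self-adjoint element is an average of
  two unitaries, and every element splits into self-adjoint real and imaginary parts.\<close>

lemma commute_unitaries_commutant:
  assumes "K \<in> M" "\<And>U. U \<in> unitaries \<Longrightarrow> K \<cdot> U = U \<cdot> K"
  shows "K \<in> commutant M"
proof -
  have sa: "K \<cdot> H = H \<cdot> K" if "H \<in> M" "H\<^sup>\<dagger> = H" for H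
  proof -
    define c where "c = 1 / (norm H + 1)"
    have "0 < norm H + 1"
      using norm_ge_zero[of H] by linarith
    then have c: "0 < c" "norm (c *\<^sub>R H) < 1"
      by (simp_all add: c_def field_simps)
    have "c *\<^sub>R H \<in> M" "(c *\<^sub>R H)\<^sup>\<dagger> = c *\<^sub>R H"
      using that by (simp_all add: adj_scaleR)
    then obtain U where U: "U \<in> unitaries" "c *\<^sub>R H = (1/2) *\<^sub>R (U + U\<^sup>\<dagger>)"
      using self_adjoint_unitary_average c(2) by blast
    have "U\<^sup>\<dagger> \<in> unitaries"
      using U(1) by (simp add: unitaries_def)
    then have "K \<cdot> (c *\<^sub>R H) = (c *\<^sub>R H) \<cdot> K"
      unfolding U(2) using assms(2) U(1) by (simp add: op_distrib)
    then show ?thesis using c by (simp add: op_distrib)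
  qed
  have "K \<cdot> T = T \<cdot> K" if "T \<in> M" for T
  proof -
    define J where "J = (scalar_op \<i> :: 'a \<Rightarrow>\<^sub>L 'a)"
    have J: "J \<in> M" "J\<^sup>\<dagger> = scalar_op (-\<i>)" by (simp_all add: J_def)
    have JJ: "J \<cdot> (scalar_op (-\<i>) \<cdot> V) = V" "scalar_op (-\<i>) \<cdot> (J \<cdot> V) = V" for V
      by (simp_all add: J_def scalar_op_scalar_op)
    define A where "A = T + T\<^sup>\<dagger>"
    define B where "B = J \<cdot> (T - T\<^sup>\<dagger>)"
    have m: "scalar_op (-\<i>) \<cdot> V = - (J \<cdot> V)" for V
      by (simp add: J_def scalar_op_minus op_distrib)
    have "B\<^sup>\<dagger> = (T\<^sup>\<dagger> - T) \<cdot> scalar_op (-\<i>)"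
      using that J by (simp add: B_def adj_times adj_diff)
    also have "\<dots> = B"
      using that J by (simp add: scalar_op_right m B_def op_distrib)
    finally have B: "B \<in> M" "B\<^sup>\<dagger> = B"
      using that J by (simp_all add: B_def)
    have A: "A \<in> M" "A\<^sup>\<dagger> = A"
      using that by (simp_all add: A_def adj_simps add.commute)
    have "A + scalar_op (-\<i>) \<cdot> B = 2 *\<^sub>R T"
      by (simp add: A_def B_def JJ scaleR_2)
    moreover have "K \<cdot> (A + scalar_op (-\<i>) \<cdot> B) = (A + scalar_op (-\<i>) \<cdot> B) \<cdot> K"
      using sa[OF A] sa[OF B] assms(1) by (simp add: op_distrib scalar_op_left op_times_assoc)
    ultimately show ?thesis by (simp add: op_distrib)
  qed
  then show ?thesis
    using bounded_opsI[OF assms(1)] by (simp add: commutant_def)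
qed

section \<open>Weak limits of bounded sequences\<close>

lemma normal: "normal_functional M \<tau>"
  using state_facts[THEN conjunct2, THEN conjunct2, THEN conjunct2, THEN conjunct2, THEN conjunct2,
      THEN conjunct2] .

text \<open>The matrix coefficients converge along \<open>G\<close> and their limits form a bounded
  bilinear form, hence an operator \<open>K\<close>. Normality writes the trace as a series of
  matrix coefficients; the uniform norm bound dominates it, so the limit may be taken
  termwise.\<close>

lemma weak_limit:
  assumes G: "G \<le> sequentially" "G \<noteq> bot" "\<And>b :: nat \<Rightarrow> real. Bseq b \<Longrightarrow> \<exists>l. (b \<longlongrightarrow> l) G"
    and k: "\<And>n. k n \<in> M" "\<And>n. norm (k n) \<le> C"
  shows "\<exists>K\<in>M. \<forall>W\<in>M. ((\<lambda>n. \<tau> (k n \<cdot> W)) \<longlongrightarrow> \<tau> (K \<cdot> W)) G"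
proof -
  have bound: "\<bar>inner (blinfun_apply (k n) x) y\<bar> \<le> norm x * norm y * C" for n x y
  proof -
    have "\<bar>inner (blinfun_apply (k n) x) y\<bar> \<le> norm (k n) * norm x * norm y"
      by (intro order_trans[OF Cauchy_Schwarz_ineq2] mult_right_mono norm_blinfun) simp
    also have "\<dots> \<le> C * norm x * norm y"
      using k(2) by (intro mult_right_mono) auto
    finally show ?thesis by (simp add: mult_ac)
  qed
  have "\<exists>l. ((\<lambda>n. inner (blinfun_apply (k n) x) y) \<longlongrightarrow> l) G" for x y
    using bound by (intro G(3) BseqI'[where K = "norm x * norm y * C"]) simp
  then obtain B where B: "\<And>x y. ((\<lambda>n. inner (blinfun_apply (k n) x) y) \<longlongrightarrow> B x y) G"
    by metis
  have "bounded_bilinear B"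
  proof
    fix x x' y y' and r :: real
    show "B (x + x') y = B x y + B x' y"
      using tendsto_unique[OF G(2) B[of "x + x'" y], of "B x y + B x' y"] tendsto_add[OF B[of x y] B[of x' y]]
      by (simp add: blinfun.add_right inner_add_left)
    show "B x (y + y') = B x y + B x y'"
      using tendsto_unique[OF G(2) B[of x "y + y'"], of "B x y + B x y'"] tendsto_add[OF B[of x y] B[of x y']]
      by (simp add: inner_add_right)
    show "B (r *\<^sub>R x) y = r *\<^sub>R B x y"
      using tendsto_unique[OF G(2) B[of "r *\<^sub>R x" y], of "r * B x y"] tendsto_mult_left[OF B[of x y], of r]
      by (simp add: blinfun.scaleR_right)
    show "B x (r *\<^sub>R y) = r *\<^sub>R B x y"
      using tendsto_unique[OF G(2) B[of x "r *\<^sub>R y"], of "r * B x y"] tendsto_mult_left[OF B[of x y], of r]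
      by simp
    have "\<bar>B x y\<bar> \<le> norm x * norm y * C" for x y
      using bound by (intro tendsto_upperbound[OF tendsto_rabs[OF B] _ G(2)]) simp
    then show "\<exists>C. \<forall>x y. norm (B x y) \<le> norm x * norm y * C" by auto
  qed
  then obtain K where K: "\<And>x y. inner (blinfun_apply K x) y = B x y"
    using op_of_form by blast
  have lim: "((\<lambda>n. inner (blinfun_apply (k n) x) y) \<longlongrightarrow> inner (blinfun_apply K x) y) G" for x y
    using B K by simp
  have eqI: "blinfun_apply K x = z"
    if "\<And>y. ((\<lambda>n. inner (blinfun_apply (k n) x) y) \<longlongrightarrow> inner z y) G" for x z
  proof -
    have "inner y (blinfun_apply K x) = inner y z" for y
      using tendsto_unique[OF G(2) lim that] by (simp add: inner_commute)
    then show ?thesis by (metis vector_eq_rdot inner_commute)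
  qed
  have "K \<in> M"
  proof (rule memI)
    show "K \<in> bounded_ops"
      unfolding bounded_ops_def
    proof (intro CollectI allI eqI)
      fix c x y
      show "((\<lambda>n. inner (blinfun_apply (k n) (c *\<^sub>C x)) y) \<longlongrightarrow> inner (c *\<^sub>C blinfun_apply K x) y) G"
        using lim[of x "cnj c *\<^sub>C y"] bounded_opsI[OF k(1)]
        by (simp add: bounded_ops_def inner_scaleC_left)
    qed
    fix S x assume S: "S \<in> commutant M"
    show "blinfun_apply K (blinfun_apply S x) = blinfun_apply S (blinfun_apply K x)"
    proof (rule eqI)
      fix y
      \<comment> \<open>Moving \<open>S\<close> to the right-hand vector turns the claim into
        convergence of one further matrix coefficient.\<close>
      obtain y' where y': "\<And>x. inner (blinfun_apply S x) y = inner x y'"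
        using real_adjoint_exists by blast
      show "((\<lambda>n. inner (blinfun_apply (k n) (blinfun_apply S x)) y) \<longlongrightarrow>
          inner (blinfun_apply S (blinfun_apply K x)) y) G"
        using lim[of x y'] real_commutant_apply[OF S k(1)] by (simp add: y' flip: real_commutant_apply[OF S k(1)])
    qed
  qed
  moreover have "((\<lambda>n. \<tau> (k n \<cdot> W)) \<longlongrightarrow> \<tau> (K \<cdot> W)) G" if "W \<in> M" for W
  proof -
    obtain \<xi> \<eta> where \<xi>: "summable (\<lambda>n::nat. (norm (\<xi> n))\<^sup>2)" and \<eta>: "summable (\<lambda>n. (norm (\<eta> n))\<^sup>2)"
      and sums: "\<And>T. T \<in> M \<Longrightarrow> (\<lambda>n. cinner (blinfun_apply T (\<xi> n)) (\<eta> n)) sums \<tau> T"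
      using normal unfolding normal_functional_def by auto
    define a where "a j n = cinner (blinfun_apply (k n \<cdot> W) (\<xi> j)) (\<eta> j)" for j n
    define b where "b j = cinner (blinfun_apply (K \<cdot> W) (\<xi> j)) (\<eta> j)" for j
    \<comment> \<open>Dominates the series independently of \<open>n\<close>: the product of the
      norms of \<open>\<xi> j\<close> and \<open>\<eta> j\<close> is split by the inequality between
      geometric and arithmetic mean.\<close>
    define m where "m j = \<bar>C\<bar> * norm W * ((norm (\<xi> j))\<^sup>2 + (norm (\<eta> j))\<^sup>2)" for j
    have "(a j \<longlongrightarrow> b j) G" for j
    proof -
      have i: "\<i> *\<^sub>C blinfun_apply T x = blinfun_apply T (\<i> *\<^sub>C x)" if "T \<in> M" for T x
        using bounded_opsI[OF that] by (simp add: bounded_ops_def)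
      show ?thesis
        unfolding a_def b_def tendsto_complex_iff Re_cinner Im_cinner
        using \<open>K \<in> M\<close> k(1) by (auto simp: i intro!: lim tendsto_minus)
    qed
    moreover have "norm (a j n) \<le> m j" for j n
    proof -
      have "norm (blinfun_apply (k n \<cdot> W) (\<xi> j)) \<le> \<bar>C\<bar> * norm W * norm (\<xi> j)"
        using k(2)[of n]
        by (intro order_trans[OF norm_blinfun] mult_right_mono norm_times_le) auto
      then have "norm (a j n) \<le> 2 * (\<bar>C\<bar> * norm W * norm (\<xi> j) * norm (\<eta> j))"
        unfolding a_def by (intro order_trans[OF norm_cinner_le] mult_left_mono mult_right_mono) auto
      also have "\<dots> = \<bar>C\<bar> * norm W * (2 * norm (\<xi> j) * norm (\<eta> j))"
        by simp
      also have "\<dots> \<le> m j"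
        unfolding m_def by (intro mult_left_mono sum_squares_bound) auto
      finally show ?thesis .
    qed
    moreover have "summable m"
      unfolding m_def by (intro summable_mult summable_add \<xi> \<eta>)
    moreover have "eventually (\<lambda>(j, n). norm (a j n) \<le> m j) (at_top \<times>\<^sub>F G)"
      using calculation(2) by (intro always_eventually) auto
    ultimately have "((\<lambda>n. suminf (\<lambda>j. a j n)) \<longlongrightarrow> suminf b) G"
      using tannerys_theorem[of a b G m] G(2) by blast
    moreover have "suminf (\<lambda>j. a j n) = \<tau> (k n \<cdot> W)" for n
      unfolding a_def by (rule sums_unique[symmetric], rule sums) (use k that in auto)
    moreover have "suminf b = \<tau> (K \<cdot> W)"
      unfolding b_def by (rule sums_unique[symmetric], rule sums) (use \<open>K \<in> M\<close> that in auto)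
    ultimately show ?thesis by simp
  qed
  ultimately show ?thesis by blast
qed

section \<open>Averaging over the unitary group\<close>

text \<open>Averages are encoded as maps, not as values, so that one and the same average acts on
  all operators \<open>y i\<close> at once. Midpoints are the only convex combinations that the
  minimization below compares.\<close>

inductive_set mixing :: "(('a \<Rightarrow>\<^sub>L 'a) \<Rightarrow> ('a \<Rightarrow>\<^sub>L 'a)) set" where
  conj: "U \<in> unitaries \<Longrightarrow> (\<lambda>T. U \<cdot> T \<cdot> U\<^sup>\<dagger>) \<in> mixing"
| mid: "\<Phi> \<in> mixing \<Longrightarrow> \<Psi> \<in> mixing \<Longrightarrow> (\<lambda>T. (1/2) *\<^sub>R (\<Phi> T + \<Psi> T)) \<in> mixing"

lemma mixing_mem: "\<Phi> \<in> mixing \<Longrightarrow> T \<in> M \<Longrightarrow> \<Phi> T \<in> M"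
  by (induction rule: mixing.induct) (auto simp: unitary_mem)

lemma mixing_norm: "\<Phi> \<in> mixing \<Longrightarrow> norm (\<Phi> T) \<le> norm T"
proof (induction rule: mixing.induct)
  case (conj U)
  then have "norm (U \<cdot> T \<cdot> U\<^sup>\<dagger>) \<le> 1 * norm T * 1"
    by (intro norm_times_le) (auto simp: norm_unitary_le unitary_mem)
  then show ?case by simp
next
  case (mid \<Phi> \<Psi>)
  then show ?case
    using norm_triangle_ineq[of "\<Phi> T" "\<Psi> T"] by simp
qed

lemma mixing_tr: "\<Phi> \<in> mixing \<Longrightarrow> T \<in> M \<Longrightarrow> \<tau> (\<Phi> T) = \<tau> T"
proof (induction rule: mixing.induct)
  case (conj U)
  then have "\<tau> (U \<cdot> T \<cdot> U\<^sup>\<dagger>) = \<tau> (U\<^sup>\<dagger> \<cdot> (U \<cdot> T))"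
    using unitary_mem by (intro tr_commute) auto
  then show ?case using conj by (simp add: unitary_cancel)
qed (simp add: tr_scaleR tr_add mixing_mem)

lemma mixing_conj:
  "\<Phi> \<in> mixing \<Longrightarrow> U \<in> unitaries \<Longrightarrow> (\<lambda>T. U \<cdot> \<Phi> T \<cdot> U\<^sup>\<dagger>) \<in> mixing"
proof (induction rule: mixing.induct)
  case (conj V)
  have "(\<lambda>T. U \<cdot> (V \<cdot> T \<cdot> V\<^sup>\<dagger>) \<cdot> U\<^sup>\<dagger>) = (\<lambda>T. (U \<cdot> V) \<cdot> T \<cdot> (U \<cdot> V)\<^sup>\<dagger>)"
    using conj by (simp add: adj_times unitary_mem op_times_assoc)
  then show ?case
    using conj unitary_times mixing.conj by metis
next
  case (mid \<Phi> \<Psi>)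
  have "(\<lambda>T. U \<cdot> ((1/2) *\<^sub>R (\<Phi> T + \<Psi> T)) \<cdot> U\<^sup>\<dagger>)
      = (\<lambda>T. (1/2) *\<^sub>R (U \<cdot> \<Phi> T \<cdot> U\<^sup>\<dagger> + U \<cdot> \<Psi> T \<cdot> U\<^sup>\<dagger>))"
    by (simp add: op_distrib)
  then show ?case
    using mid mixing.mid by simp
qed

text \<open>The left-hand side is affine in the averaging map, so a bound on all unitary
  conjugations passes to their averages.\<close>

lemma mixing_bound:
  assumes "\<And>i. i \<in> I \<Longrightarrow> x i \<in> M" "\<And>i. i \<in> I \<Longrightarrow> y i \<in> M"
    and "\<And>U. U \<in> unitaries \<Longrightarrow> Re (\<Sum>i\<in>I. \<tau> (x i \<cdot> (U \<cdot> y i \<cdot> U\<^sup>\<dagger>))) \<le> s"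
    and "\<Phi> \<in> mixing"
  shows "Re (\<Sum>i\<in>I. \<tau> (x i \<cdot> \<Phi> (y i))) \<le> s"
  using assms(4)
proof (induction rule: mixing.induct)
  case (conj U)
  then show ?case by (rule assms(3))
next
  case (mid \<Phi> \<Psi>)
  have "(\<Sum>i\<in>I. \<tau> (x i \<cdot> ((1/2) *\<^sub>R (\<Phi> (y i) + \<Psi> (y i)))))
      = (\<Sum>i\<in>I. (1/2) * (\<tau> (x i \<cdot> \<Phi> (y i)) + \<tau> (x i \<cdot> \<Psi> (y i))))"
    using assms(1,2) mid(1,2) by (intro sum.cong) (auto simp: op_distrib tr_add tr_scaleR mixing_mem)
  also have "\<dots> = (1/2) * ((\<Sum>i\<in>I. \<tau> (x i \<cdot> \<Phi> (y i))) + (\<Sum>i\<in>I. \<tau> (x i \<cdot> \<Psi> (y i))))"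
    by (simp only: sum_distrib_left[symmetric] sum.distrib)
  finally have eq: "(\<Sum>i\<in>I. \<tau> (x i \<cdot> ((1/2) *\<^sub>R (\<Phi> (y i) + \<Psi> (y i)))))
      = (1/2) * ((\<Sum>i\<in>I. \<tau> (x i \<cdot> \<Phi> (y i))) + (\<Sum>i\<in>I. \<tau> (x i \<cdot> \<Psi> (y i))))" .
  show ?case unfolding eq using mid(3,4) by simp
qed

text \<open>Take \<open>\<Phi>\<close> nearly minimizing the energy \<open>E\<close>. A further
  conjugation by \<open>U\<close> keeps the energy and the midpoint of both maps cannot be much
  better, so by the parallelogram law the conjugation moves each \<open>\<Phi> (y i)\<close> only
  slightly, uniformly in \<open>U\<close>.\<close>

lemma approx_central_mixing:
  assumes "finite I" "\<And>i. i \<in> I \<Longrightarrow> y i \<in> M" "0 < \<epsilon>"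
  obtains \<Phi> where "\<Phi> \<in> mixing"
    "\<And>U i. U \<in> unitaries \<Longrightarrow> i \<in> I \<Longrightarrow> tn (\<Phi> (y i) \<cdot> U - U \<cdot> \<Phi> (y i)) \<le> \<epsilon>"
proof -
  define E where "E \<Phi> = (\<Sum>i\<in>I. (tn (\<Phi> (y i)))\<^sup>2)" for \<Phi>
  define m where "m = (INF \<Phi>\<in>mixing. E \<Phi>)"
  have bdd: "bdd_below (E ` mixing)"
    by (rule bdd_belowI[where m = 0]) (auto simp: E_def sum_nonneg)
  have ne: "mixing \<noteq> {}"
    using mixing.conj[OF one_unitary] by blast
  have m_le: "m \<le> E \<Phi>" if "\<Phi> \<in> mixing" for \<Phi>
    unfolding m_def using bdd that by (rule cINF_lower)
  \<comment> \<open>The squared distances between \<open>\<Phi>\<close> and its conjugate add up to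
    at most \<open>4 * (E \<Phi> - m)\<close>.\<close>
  have "m < m + \<epsilon>\<^sup>2 / 4"
    using assms(3) by simp
  then obtain \<Phi> where \<Phi>: "\<Phi> \<in> mixing" "E \<Phi> < m + \<epsilon>\<^sup>2 / 4"
    unfolding m_def cINF_less_iff[OF ne bdd] by blast
  have "tn (\<Phi> (y i) \<cdot> U - U \<cdot> \<Phi> (y i)) \<le> \<epsilon>" if U: "U \<in> unitaries" and i: "i \<in> I" for U i
  proof -
    define \<Psi> where "\<Psi> T = U \<cdot> \<Phi> T \<cdot> U\<^sup>\<dagger>" for T
    have \<Psi>: "\<Psi> \<in> mixing"
      unfolding \<Psi>_def by (rule mixing_conj[OF \<Phi>(1) U])
    have mem: "\<Phi> (y i) \<in> M" "\<Psi> (y i) \<in> M" if "i \<in> I" for i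
      using mixing_mem \<Phi>(1) \<Psi> assms(2) that by auto
    have "E \<Psi> = E \<Phi>"
      unfolding E_def \<Psi>_def using mem by (intro sum.cong) (simp_all add: tn_unitary_conj[OF U])
    have "E (\<lambda>T. (1/2) *\<^sub>R (\<Phi> T + \<Psi> T)) = (\<Sum>i\<in>I. (tn (\<Phi> (y i) + \<Psi> (y i)))\<^sup>2) / 4"
      unfolding E_def sum_divide_distrib
      using mem by (intro sum.cong) (simp_all add: tn_scaleR power_divide)
    moreover have "m \<le> E (\<lambda>T. (1/2) *\<^sub>R (\<Phi> T + \<Psi> T))"
      using mixing.mid[OF \<Phi>(1) \<Psi>] by (rule m_le)
    moreover have "(\<Sum>i\<in>I. (tn (\<Phi> (y i) + \<Psi> (y i)))\<^sup>2) + (\<Sum>i\<in>I. (tn (\<Phi> (y i) - \<Psi> (y i)))\<^sup>2)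
        = 2 * E \<Phi> + 2 * E \<Psi>"
      unfolding E_def sum_distrib_left sum.distrib[symmetric]
      using mem by (intro sum.cong tn_parallelogram) auto
    ultimately have "(\<Sum>i\<in>I. (tn (\<Phi> (y i) - \<Psi> (y i)))\<^sup>2) \<le> \<epsilon>\<^sup>2"
      using \<Phi>(2) \<open>E \<Psi> = E \<Phi>\<close> by argo
    moreover have "(tn (\<Phi> (y i) - \<Psi> (y i)))\<^sup>2 \<le> (\<Sum>i\<in>I. (tn (\<Phi> (y i) - \<Psi> (y i)))\<^sup>2)"
      using assms(1) i by (intro member_le_sum) auto
    ultimately have "(tn (\<Phi> (y i) - \<Psi> (y i)))\<^sup>2 \<le> \<epsilon>\<^sup>2"
      by linarith
    then have le: "tn (\<Phi> (y i) - \<Psi> (y i)) \<le> \<epsilon>"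
      by (rule power2_le_imp_le) (use assms(3) in simp)
    have "\<Phi> (y i) \<cdot> U - U \<cdot> \<Phi> (y i) = (\<Phi> (y i) - \<Psi> (y i)) \<cdot> U"
      using unitary_cancel(1)[OF U] by (simp add: \<Psi>_def op_distrib op_times_assoc)
    then show ?thesis
      using tn_times_right_le[of "\<Phi> (y i) - \<Psi> (y i)" U \<epsilon> 1] mem[OF i] le norm_unitary_le[OF U]
        unitary_mem[OF U] by simp
  qed
  with \<Phi>(1) show ?thesis using that by blast
qed

text \<open>In a factor, the weak limit of asymptotically central averages of \<open>y i\<close> is the scalar
  \<open>\<tau> (y i)\<close>.\<close>

lemma unitary_average_bound:
  assumes "factor M" "finite I" and x: "\<And>i. i \<in> I \<Longrightarrow> x i \<in> M" and y: "\<And>i. i \<in> I \<Longrightarrow> y i \<in> M"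
    and s: "\<And>U. U \<in> unitaries \<Longrightarrow> Re (\<Sum>i\<in>I. \<tau> (x i \<cdot> (U \<cdot> y i \<cdot> U\<^sup>\<dagger>))) \<le> s"
  shows "Re (\<Sum>i\<in>I. \<tau> (x i) * \<tau> (y i)) \<le> s"
proof -
  obtain G :: "nat filter" where G: "G \<le> sequentially" "G \<noteq> bot"
    "\<And>b :: nat \<Rightarrow> real. Bseq b \<Longrightarrow> \<exists>l. (b \<longlongrightarrow> l) G"
    using generalized_limit_filter by blast
  have "\<exists>\<Phi>. \<Phi> \<in> mixing \<and> (\<forall>U\<in>unitaries. \<forall>i\<in>I. tn (\<Phi> (y i) \<cdot> U - U \<cdot> \<Phi> (y i)) \<le> 1 / real (Suc n))" for n
    by (rule approx_central_mixing[of I y "1 / real (Suc n)"]) (use assms(2) y in auto)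
  then obtain \<Phi> where \<Phi>: "\<And>n. \<Phi> n \<in> mixing"
    "\<And>n U i. U \<in> unitaries \<Longrightarrow> i \<in> I \<Longrightarrow> tn (\<Phi> n (y i) \<cdot> U - U \<cdot> \<Phi> n (y i)) \<le> 1 / real (Suc n)"
    by metis
  have lim: "((\<lambda>n. \<tau> (x i \<cdot> \<Phi> n (y i))) \<longlongrightarrow> \<tau> (x i) * \<tau> (y i)) G" if i: "i \<in> I" for i
  proof -
    have k: "\<Phi> n (y i) \<in> M" "norm (\<Phi> n (y i)) \<le> norm (y i)" for n
      using mixing_mem[OF \<Phi>(1) y[OF i]] mixing_norm[OF \<Phi>(1)] by blast+
    obtain K where K: "K \<in> M" "\<And>W. W \<in> M \<Longrightarrow> ((\<lambda>n. \<tau> (\<Phi> n (y i) \<cdot> W)) \<longlongrightarrow> \<tau> (K \<cdot> W)) G"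
      using weak_limit[where k = "\<lambda>n. \<Phi> n (y i)" and C = "norm (y i)", OF G k] by blast
    have "K \<cdot> U = U \<cdot> K" if U: "U \<in> unitaries" for U
    proof -
      note U_M = unitary_mem[OF U]
      have tr0: "\<tau> ((K \<cdot> U - U \<cdot> K) \<cdot> W) = 0" if W: "W \<in> M" for W
      proof -
        \<comment> \<open>Traciality brings \<open>T\<close> to the front of both terms, the
          position in which its weak limit is controlled.\<close>
        have eq: "\<tau> ((T \<cdot> U - U \<cdot> T) \<cdot> W) = \<tau> (T \<cdot> (U \<cdot> W)) - \<tau> (T \<cdot> (W \<cdot> U))" if "T \<in> M" for T
        proof -
          have "\<tau> (U \<cdot> (T \<cdot> W)) = \<tau> (T \<cdot> W \<cdot> U)"
            using that W U_M by (intro tr_commute) auto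
          then show ?thesis
            using that W U_M by (simp add: op_distrib tr_diff op_times_assoc)
        qed
        have "((\<lambda>n. \<tau> ((\<Phi> n (y i) \<cdot> U - U \<cdot> \<Phi> n (y i)) \<cdot> W)) \<longlongrightarrow> \<tau> ((K \<cdot> U - U \<cdot> K) \<cdot> W)) G"
          unfolding eq[OF K(1)] eq[OF k(1)] using W U_M by (intro tendsto_diff K(2)) auto
        moreover have "((\<lambda>n. \<tau> ((\<Phi> n (y i) \<cdot> U - U \<cdot> \<Phi> n (y i)) \<cdot> W)) \<longlongrightarrow> 0) G"
        proof (rule Lim_null_comparison)
          have "norm (\<tau> ((\<Phi> n (y i) \<cdot> U - U \<cdot> \<Phi> n (y i)) \<cdot> W)) \<le> 1 / real (Suc n) * norm W" for n
            using k(1) W U_M \<Phi>(2)[OF U i]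
            by (intro order_trans[OF cmod_tr_le_tn] tn_times_right_le) auto
          then show "eventually (\<lambda>n. norm (\<tau> ((\<Phi> n (y i) \<cdot> U - U \<cdot> \<Phi> n (y i)) \<cdot> W))
              \<le> 1 / real (Suc n) * norm W) G" by simp
          have "(\<lambda>n. 1 / real (Suc n) * norm W) \<longlonglongrightarrow> 0 * norm W"
            by (intro tendsto_intros LIMSEQ_Suc lim_1_over_n)
          then show "((\<lambda>n. 1 / real (Suc n) * norm W) \<longlongrightarrow> 0) G"
            using G(1) by (simp add: tendsto_mono)
        qed
        ultimately show ?thesis using tendsto_unique[OF G(2)] by blast
      qed
      define Z where "Z = K \<cdot> U - U \<cdot> K"
      have Z: "Z \<in> M" using K(1) U_M by (simp add: Z_def)
      \<comment> \<open>Testing with \<open>W = Z\<^sup>\<dagger>\<close> turns vanishing traces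
        into a vanishing 2-norm, so faithfulness gives \<open>Z = 0\<close>.\<close>
      then have "\<tau> (Z\<^sup>\<dagger>\<^sup>\<dagger> \<cdot> Z\<^sup>\<dagger>) = 0"
        using tr0[of "Z\<^sup>\<dagger>"] by (simp flip: Z_def)
      then have "tn Z = 0"
        using Z tr_square[of "Z\<^sup>\<dagger>"] by simp
      then have "Z = 0" using Z tn_eq_0D by blast
      then show ?thesis by (simp add: Z_def)
    qed
    then have "K \<in> M \<inter> commutant M"
      using commute_unitaries_commutant K(1) by blast
    then obtain c where c: "K = scalar_op c"
      using assms(1) unfolding factor_def by blast
    have "((\<lambda>n. \<tau> (y i)) \<longlongrightarrow> \<tau> K) G"
      using K(2)[OF one_mem] mixing_tr[OF \<Phi>(1) y[OF i]] by simp
    then have "c = \<tau> (y i)"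
      using tendsto_unique[OF G(2) tendsto_const] c by fastforce
    then have "\<tau> (K \<cdot> x i) = \<tau> (x i) * \<tau> (y i)"
      using x[OF i] by (simp add: c tr_scalar)
    moreover have "\<tau> (\<Phi> n (y i) \<cdot> x i) = \<tau> (x i \<cdot> \<Phi> n (y i))" for n
      using k(1) x[OF i] by (rule tr_commute)
    ultimately show ?thesis
      using K(2)[OF x[OF i]] by simp
  qed
  have "((\<lambda>n. Re (\<Sum>i\<in>I. \<tau> (x i \<cdot> \<Phi> n (y i)))) \<longlongrightarrow> Re (\<Sum>i\<in>I. \<tau> (x i) * \<tau> (y i))) G"
    by (intro tendsto_Re tendsto_sum lim)
  then show ?thesis
    by (rule tendsto_upperbound) (use mixing_bound[of I x y s] x y s \<Phi>(1) G(2) in auto)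
qed

section \<open>Orthonormal bases of finite-dimensional subalgebras\<close>

lemma tr_self_adjoint_real:
  assumes "S \<in> M" "T \<in> M" "S\<^sup>\<dagger> = S" "T\<^sup>\<dagger> = T"
  shows "\<tau> (S \<cdot> T) = complex_of_real (Re (\<tau> (S \<cdot> T)))"
proof -
  have "cnj (\<tau> (S \<cdot> T)) = \<tau> (S \<cdot> T)"
    using assms tr_adj[of "S \<cdot> T"] tr_commute[of S T] by (simp add: adj_times)
  then show ?thesis by (simp add: complex_eq_iff)
qed

text \<open>On self-adjoint elements \<open>\<tau> (S \<cdot> T)\<close> is the real inner product
  of the 2-norm, so the family is orthonormal in the real space of self-adjoint elements of
  \<open>B\<close>.\<close>

definition orthonormal_family :: "('a \<Rightarrow>\<^sub>L 'a) set \<Rightarrow> nat \<Rightarrow> (nat \<Rightarrow> ('a \<Rightarrow>\<^sub>L 'a)) \<Rightarrow> bool" where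
  "orthonormal_family B d e \<longleftrightarrow>
     (\<forall>i<d. e i \<in> B \<and> (e i)\<^sup>\<dagger> = e i) \<and> (\<forall>i<d. \<forall>j<d. \<tau> (e i \<cdot> e j) = (if i = j then 1 else 0))"

text \<open>Orthonormality implies real linear independence. The bound guarantees that a family of
  maximal length exists.\<close>

lemma orthonormal_family_card:
  assumes "B \<subseteq> M" "orthonormal_family B d e" "finite F" "B \<subseteq> span F"
  shows "d \<le> card F"
proof -
  have e: "e i \<in> M" "e i \<in> B" if "i < d" for i
    using assms(1,2) that by (auto simp: orthonormal_family_def)
  have on: "\<tau> (e i \<cdot> e j) = (if i = j then 1 else 0)" if "i < d" "j < d" for i j
    using assms(2) that by (simp add: orthonormal_family_def)
  have inj: "inj_on e {..<d}"
  proof (rule inj_onI)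
    fix i j assume "i \<in> {..<d}" "j \<in> {..<d}" "e i = e j"
    then show "i = j"
      using on[of i j] on[of i i] by (auto split: if_splits)
  qed
  have "independent (e ` {..<d})"
  proof
    assume "dependent (e ` {..<d})"
    then obtain u j where u: "(\<Sum>v\<in>e ` {..<d}. u v *\<^sub>R v) = 0" "j < d" "u (e j) \<noteq> 0"
      by (auto simp: dependent_finite)
    have "0 = \<tau> (e j \<cdot> (\<Sum>i<d. u (e i) *\<^sub>R e i))"
      using u(1) by (simp add: sum.reindex[OF inj] op_distrib)
    also have "\<dots> = (\<Sum>i<d. u (e i) * \<tau> (e j \<cdot> e i))"
      using e u(2) unfolding op_sum op_distrib
      by (subst tr_sum) (auto simp: tr_scaleR)
    also have "\<dots> = (\<Sum>i<d. if i = j then complex_of_real (u (e i)) else 0)"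
      using u(2) on by (intro sum.cong) auto
    also have "\<dots> = u (e j)"
      using u(2) by simp
    finally show False using u(3) by simp
  qed
  then have "card (e ` {..<d}) \<le> card F"
    using independent_span_bound[OF assms(3)] assms(4) e(2) by blast
  then show ?thesis by (simp add: card_image[OF inj])
qed

text \<open>A family of maximal length is taken: if the expansion of a self-adjoint element left a
  residue, the normalized residue could be appended. General elements follow by complex linearity
  from their real and imaginary parts.\<close>

lemma finite_dim_basis:
  assumes B: "unital_star_subalgebra B" "B \<subseteq> M" "finite_dim B"
  shows "\<exists>d. \<exists>e :: nat \<Rightarrow> ('a \<Rightarrow>\<^sub>L 'a). (\<forall>i<d. e i \<in> B \<and> (e i)\<^sup>\<dagger> = e i) \<and>
    (\<forall>b\<in>B. b = (\<Sum>i<d. scalar_op (\<tau> (e i \<cdot> b)) \<cdot> e i))"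
proof -
  obtain F where F: "finite F" "B \<subseteq> span F"
    using B(3) by (auto simp: finite_dim_def)
  have closed: "S + T \<in> B" "S \<cdot> T \<in> B" if "S \<in> B" "T \<in> B" for S T
    using B(1) that by (auto simp: unital_star_subalgebra_def)
  have scalar_B: "scalar_op c \<in> B" for c
    using B(1) by (auto simp: unital_star_subalgebra_def)
  have B_adj: "T\<^sup>\<dagger> \<in> B" if "T \<in> B" for T
    using B(1) that unfolding unital_star_subalgebra_def by (metis cadjoint_eqI)
  have B_M: "T \<in> M" if "T \<in> B" for T
    using B(2) that by blast
  have scaleR_B: "r *\<^sub>R T \<in> B" if "T \<in> B" for r T
    unfolding scaleR_op_eq by (intro closed scalar_B that)
  have diff_B: "S - T \<in> B" if "S \<in> B" "T \<in> B" for S T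
    using closed(1)[OF that(1) scaleR_B[OF that(2), of "-1"]] by simp
  have zero_B: "0 \<in> B"
    using B(1) scalar_op_0 unfolding unital_star_subalgebra_def by (metis rangeI subsetD)
  have sum_B: "sum f I \<in> B" if "\<And>i. i \<in> I \<Longrightarrow> f i \<in> B" for f and I :: "nat set"
    using that by (induction I rule: infinite_finite_induct) (auto intro: closed zero_B)
  have ex: "\<exists>e. orthonormal_family B 0 e"
    by (simp add: orthonormal_family_def)
  have "\<forall>d. (\<exists>e. orthonormal_family B d e) \<longrightarrow> d \<le> card F"
    using orthonormal_family_card[OF B(2) _ F] by blast
  with ex obtain d where d: "\<exists>e. orthonormal_family B d e"
    "\<And>d'. \<exists>e. orthonormal_family B d' e \<Longrightarrow> d' \<le> d"
    using GreatestI_ex_nat[of "\<lambda>d. \<exists>e. orthonormal_family B d e" "card F"]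
      Greatest_le_nat[of "\<lambda>d. \<exists>e. orthonormal_family B d e" _ "card F"] by blast
  then obtain e where e: "orthonormal_family B d e" by blast
  have eB: "e i \<in> B" "(e i)\<^sup>\<dagger> = e i" if "i < d" for i
    using e that by (auto simp: orthonormal_family_def)
  note eM = B_M[OF eB(1)]
  have on: "\<tau> (e i \<cdot> e j) = (if i = j then 1 else 0)" if "i < d" "j < d" for i j
    using e that by (simp add: orthonormal_family_def)
  have sa: "b = (\<Sum>i<d. scalar_op (\<tau> (e i \<cdot> b)) \<cdot> e i)" if b: "b \<in> B" "b\<^sup>\<dagger> = b" for b
  proof (rule ccontr)
    \<comment> \<open>The coefficients are real because \<open>e i\<close> and \<open>b\<close> are
      self-adjoint; writing them as real scalars makes the residue self-adjoint.\<close>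
    define r where "r = b - (\<Sum>i<d. Re (\<tau> (e i \<cdot> b)) *\<^sub>R e i)"
    have real: "\<tau> (e i \<cdot> b) = complex_of_real (Re (\<tau> (e i \<cdot> b)))" if "i < d" for i
      using that b eB eM B_M by (intro tr_self_adjoint_real) auto
    assume "b \<noteq> (\<Sum>i<d. scalar_op (\<tau> (e i \<cdot> b)) \<cdot> e i)"
    also have "(\<Sum>i<d. scalar_op (\<tau> (e i \<cdot> b)) \<cdot> e i) = (\<Sum>i<d. Re (\<tau> (e i \<cdot> b)) *\<^sub>R e i)"
      using real by (intro sum.cong) (auto simp: scaleR_op_eq)
    finally have "r \<noteq> 0" by (simp add: r_def)
    have rB: "r \<in> B"
      unfolding r_def by (intro diff_B b sum_B scaleR_B eB) auto
    note rM = B_M[OF rB]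
    have sum_M: "(\<Sum>i<d. c i *\<^sub>R T i) \<in> M" if "\<And>i. i < d \<Longrightarrow> T i \<in> M" for c T
      using that by (intro sum_mem) simp
    have "(\<Sum>i<d. Re (\<tau> (e i \<cdot> b)) *\<^sub>R e i)\<^sup>\<dagger> = (\<Sum>i<d. Re (\<tau> (e i \<cdot> b)) *\<^sub>R e i)"
      using eM eB by (subst adj_sum) (auto simp: adj_scaleR)
    then have r_adj: "r\<^sup>\<dagger> = r"
      using b B_M sum_M[OF eM] by (simp add: r_def adj_diff)
    have r_orth: "\<tau> (e j \<cdot> r) = 0" if "j < d" for j
    proof -
      have "\<tau> (e j \<cdot> r) = \<tau> (e j \<cdot> b) - (\<Sum>i<d. Re (\<tau> (e i \<cdot> b)) * \<tau> (e j \<cdot> e i))"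
        using that b B_M eM sum_M[of "\<lambda>i. e j \<cdot> e i"] unfolding r_def op_distrib op_sum
        by (subst tr_diff, simp, simp, subst tr_sum) (auto simp: tr_scaleR)
      also have "(\<Sum>i<d. Re (\<tau> (e i \<cdot> b)) * \<tau> (e j \<cdot> e i)) = (\<Sum>i<d. if i = j then \<tau> (e i \<cdot> b) else 0)"
        using that on real by (intro sum.cong) auto
      finally show ?thesis using that by simp
    qed
    have tn_pos: "tn r > 0"
      using \<open>r \<noteq> 0\<close> tn_eq_0D[OF rM] tn_nonneg[OF rM] by linarith
    define q where "q = (1 / tn r) *\<^sub>R r"
    have q: "q \<in> B" "q\<^sup>\<dagger> = q" "q \<in> M"
      using rB r_adj rM by (simp_all add: q_def scaleR_B adj_scaleR)
    have q1: "\<tau> (e j \<cdot> q) = 0" "\<tau> (q \<cdot> e j) = 0" if "j < d" for j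
      using that r_orth[OF that] rM eM tr_commute[of "e j" r]
      by (simp_all add: q_def op_distrib tr_scaleR)
    have "\<tau> (r \<cdot> r) = complex_of_real ((tn r)\<^sup>2)"
      using tr_square[OF rM] r_adj by simp
    then have q2: "\<tau> (q \<cdot> q) = 1"
      using rM tn_pos by (simp add: q_def op_distrib tr_scaleR power2_eq_square)
    have "orthonormal_family B (Suc d) (e(d := q))"
      using e q q1 q2 by (auto simp: orthonormal_family_def less_Suc_eq)
    then have "Suc d \<le> d" using d(2) by blast
    then show False by simp
  qed
  have "b = (\<Sum>i<d. scalar_op (\<tau> (e i \<cdot> b)) \<cdot> e i)" if b: "b \<in> B" for b
  proof -
    obtain A C where AC: "A \<in> B" "A\<^sup>\<dagger> = A" "C \<in> B" "C\<^sup>\<dagger> = C" "b = A + scalar_op \<i> \<cdot> C"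
    proof (rule that[of "(1/2) *\<^sub>R (b + b\<^sup>\<dagger>)" "scalar_op (-\<i>/2) \<cdot> (b - b\<^sup>\<dagger>)"])
      show "(1/2) *\<^sub>R (b + b\<^sup>\<dagger>) \<in> B" "scalar_op (-\<i>/2) \<cdot> (b - b\<^sup>\<dagger>) \<in> B"
        by (intro scaleR_B closed scalar_B diff_B B_adj b)+
      show "((1/2) *\<^sub>R (b + b\<^sup>\<dagger>))\<^sup>\<dagger> = (1/2) *\<^sub>R (b + b\<^sup>\<dagger>)"
        using B_M[OF b] by (simp add: adj_simps add.commute)
      have "(scalar_op (-\<i>/2) \<cdot> (b - b\<^sup>\<dagger>))\<^sup>\<dagger> = scalar_op (- (-\<i>/2)) \<cdot> (b\<^sup>\<dagger> - b)"
        using B_M[OF b] by (simp add: adj_times adj_diff scalar_op_right del: minus_divide_left)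
      also have "\<dots> = scalar_op (-\<i>/2) \<cdot> (b - b\<^sup>\<dagger>)"
        unfolding scalar_op_minus by (simp add: op_distrib)
      finally show "(scalar_op (-\<i>/2) \<cdot> (b - b\<^sup>\<dagger>))\<^sup>\<dagger> = scalar_op (-\<i>/2) \<cdot> (b - b\<^sup>\<dagger>)" .
      have "scalar_op \<i> \<cdot> (scalar_op (-\<i>/2) \<cdot> (b - b\<^sup>\<dagger>)) = (1/2) *\<^sub>R (b - b\<^sup>\<dagger>)"
        by (simp add: scalar_op_scalar_op scaleR_op_eq)
      then show "b = (1/2) *\<^sub>R (b + b\<^sup>\<dagger>) + scalar_op \<i> \<cdot> (scalar_op (-\<i>/2) \<cdot> (b - b\<^sup>\<dagger>))"
        by (simp flip: scaleR_add_right)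
    qed
    have "b = (\<Sum>i<d. scalar_op (\<tau> (e i \<cdot> A)) \<cdot> e i) + scalar_op \<i> \<cdot> (\<Sum>i<d. scalar_op (\<tau> (e i \<cdot> C)) \<cdot> e i)"
      using sa[OF AC(1,2)] sa[OF AC(3,4)] AC(5) by simp
    also have "\<dots> = (\<Sum>i<d. scalar_op (\<tau> (e i \<cdot> A)) \<cdot> e i + scalar_op (\<i> * \<tau> (e i \<cdot> C)) \<cdot> e i)"
      by (simp add: op_sum scalar_op_scalar_op sum.distrib)
    also have "\<dots> = (\<Sum>i<d. scalar_op (\<tau> (e i \<cdot> b)) \<cdot> e i)"
    proof (rule sum.cong)
      fix i assume "i \<in> {..<d}"
      then have "\<tau> (e i \<cdot> b) = \<tau> (e i \<cdot> A) + \<i> * \<tau> (e i \<cdot> C)"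
        using eM B_M AC(1,3) by (simp add: AC(5) op_distrib scalar_op_left tr_add tr_scalar)
      then show "scalar_op (\<tau> (e i \<cdot> A)) \<cdot> e i + scalar_op (\<i> * \<tau> (e i \<cdot> C)) \<cdot> e i
          = scalar_op (\<tau> (e i \<cdot> b)) \<cdot> e i"
        by (simp add: scalar_op_add op_distrib)
    qed simp
    finally show ?thesis .
  qed
  with eB show ?thesis by blast
qed

section \<open>Approximate intertwiners\<close>

text \<open>The coefficients are the structure constants of \<open>e\<close>, imposed on
  \<open>f\<close>: the linear map sending \<open>e i\<close> to \<open>f i\<close> nearly preserves
  the trace and products of basis elements.\<close>

definition approx_copy :: "nat \<Rightarrow> (nat \<Rightarrow> ('a \<Rightarrow>\<^sub>L 'a)) \<Rightarrow> (nat \<Rightarrow> ('a \<Rightarrow>\<^sub>L 'a)) \<Rightarrow> real \<Rightarrow> bool" where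
  "approx_copy d e f \<eta> \<longleftrightarrow>
     (\<forall>i<d. cmod (\<tau> (e i) - \<tau> (f i)) \<le> \<eta>) \<and>
     (\<forall>j<d. \<forall>k<d. tn ((\<Sum>i<d. scalar_op (\<tau> (e i \<cdot> (e j \<cdot> e k))) \<cdot> f i) - f j \<cdot> f k) \<le> \<eta>)"

lemma approx_copy_mono: "approx_copy d e f \<eta> \<Longrightarrow> \<eta> \<le> \<eta>' \<Longrightarrow> approx_copy d e f \<eta>'"
  unfolding approx_copy_def by (meson order_trans)

definition frame :: "nat \<Rightarrow> real \<Rightarrow> (nat \<Rightarrow> ('a \<Rightarrow>\<^sub>L 'a)) \<Rightarrow> bool" where
  "frame d N e \<longleftrightarrow> (\<forall>i<d. e i \<in> M \<and> (e i)\<^sup>\<dagger> = e i \<and> norm (e i) \<le> N)"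

text \<open>The traits of an orthonormal basis of a unital subalgebra that the estimates rest on:
  the coordinates of the unit and of products are traces.\<close>

definition closed_frame :: "nat \<Rightarrow> real \<Rightarrow> (nat \<Rightarrow> ('a \<Rightarrow>\<^sub>L 'a)) \<Rightarrow> bool" where
  "closed_frame d N e \<longleftrightarrow> frame d N e \<and>
     \<one> = (\<Sum>i<d. scalar_op (\<tau> (e i)) \<cdot> e i) \<and>
     (\<forall>j<d. \<forall>k<d. e j \<cdot> e k = (\<Sum>i<d. scalar_op (\<tau> (e i \<cdot> (e j \<cdot> e k))) \<cdot> e i))"

lemma frameD:
  assumes "frame d N e" "i < d"
  shows "e i \<in> M" "(e i)\<^sup>\<dagger> = e i" "norm (e i) \<le> N"
  using assms by (auto simp: frame_def)

lemma closed_frame_product: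
  assumes "closed_frame d r e" "j < d" "k < d"
  shows "e j \<cdot> e k = (\<Sum>i<d. scalar_op (\<tau> (e i \<cdot> (e j \<cdot> e k))) \<cdot> e i)"
proof -
  have "\<forall>j<d. \<forall>k<d. e j \<cdot> e k = (\<Sum>i<d. scalar_op (\<tau> (e i \<cdot> (e j \<cdot> e k))) \<cdot> e i)"
    using assms(1) unfolding closed_frame_def by (elim conjE)
  from this[rule_format, OF assms(2,3)] show ?thesis .
qed

text \<open>For a self-adjoint orthonormal basis \<open>e\<close> of a finite-dimensional subalgebra and an approximate
  copy \<open>f\<close> of it, \<open>X \<mapsto> \<Sum>i. e i \<cdot> X \<cdot> f i\<close> maps into the operators \<open>T\<close> with
  \<open>e k \<cdot> T \<approx> T \<cdot> f k\<close>.\<close>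

lemma casimir_intertwines:
  assumes e: "closed_frame d N e" and f: "frame d N f" "approx_copy d e f \<eta>"
    and X: "X \<in> M" "norm X \<le> 1" and k: "k < d" and N: "0 \<le> N" "0 \<le> \<eta>"
  shows "tn (e k \<cdot> (\<Sum>i<d. e i \<cdot> X \<cdot> f i) - (\<Sum>i<d. e i \<cdot> X \<cdot> f i) \<cdot> f k) \<le> d * N * \<eta>"
proof -
  have eF: "frame d N e" using e by (simp add: closed_frame_def)
  note eM = frameD(1)[OF eF] and fM = frameD(1)[OF f(1)]
  define c where "c i j k = \<tau> (e i \<cdot> (e j \<cdot> e k))" for i j k
  \<comment> \<open>This cyclic invariance transfers left multiplication by \<open>e k\<close> on
    the first factors to an expansion in the second factors, where the multiplication table of
    \<open>f\<close> applies.\<close>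
  have rot: "c j k i = c i j k" if "i < d" "j < d" "k < d" for i j k
    using tr_commute[of "e j \<cdot> e k" "e i"] eM that by (simp add: c_def op_times_assoc)
  have "e k \<cdot> (\<Sum>i<d. e i \<cdot> X \<cdot> f i) = (\<Sum>i<d. (e k \<cdot> e i) \<cdot> X \<cdot> f i)"
    by (simp add: op_sum op_times_assoc)
  also have "\<dots> = (\<Sum>i<d. (\<Sum>j<d. scalar_op (c j k i) \<cdot> e j) \<cdot> X \<cdot> f i)"
  proof (rule sum.cong)
    fix i assume "i \<in> {..<d}"
    then have "e k \<cdot> e i = (\<Sum>j<d. scalar_op (c j k i) \<cdot> e j)"
      using closed_frame_product[OF e k] by (simp only: c_def lessThan_iff)
    then show "(e k \<cdot> e i) \<cdot> X \<cdot> f i = (\<Sum>j<d. scalar_op (c j k i) \<cdot> e j) \<cdot> X \<cdot> f i"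
      by simp
  qed simp
  also have "\<dots> = (\<Sum>i<d. \<Sum>j<d. e j \<cdot> X \<cdot> (scalar_op (c i j k) \<cdot> f i))"
    unfolding op_sum
    using eM X(1) k by (intro sum.cong) (simp_all add: scalar_op_left op_times_assoc rot)
  also have "\<dots> = (\<Sum>j<d. e j \<cdot> X \<cdot> (\<Sum>i<d. scalar_op (c i j k) \<cdot> f i))"
    unfolding op_sum by (rule sum.swap)
  finally have "e k \<cdot> (\<Sum>i<d. e i \<cdot> X \<cdot> f i) - (\<Sum>i<d. e i \<cdot> X \<cdot> f i) \<cdot> f k
      = (\<Sum>j<d. e j \<cdot> X \<cdot> ((\<Sum>i<d. scalar_op (c i j k) \<cdot> f i) - f j \<cdot> f k))"
    by (simp add: op_sum op_distrib op_times_assoc sum_subtractf)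
  also have "tn \<dots> \<le> (\<Sum>j<d. tn (e j \<cdot> X \<cdot> ((\<Sum>i<d. scalar_op (c i j k) \<cdot> f i) - f j \<cdot> f k)))"
    using eM fM X k by (intro tn_sum times_mem diff_mem sum_mem) auto
  also have "\<dots> \<le> (\<Sum>j<d. N * 1 * \<eta>)"
  proof (rule sum_mono)
    fix j assume j: "j \<in> {..<d}"
    then have "tn ((\<Sum>i<d. scalar_op (c i j k) \<cdot> f i) - f j \<cdot> f k) \<le> \<eta>"
      using f(2) k by (simp add: approx_copy_def c_def)
    moreover have "norm (e j \<cdot> X) \<le> N * 1"
      using frameD(3)[OF eF] j X by (intro norm_times_le) auto
    moreover have "e j \<cdot> X \<in> M" "(\<Sum>i<d. scalar_op (c i j k) \<cdot> f i) - f j \<cdot> f k \<in> M"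
      using eM fM X j k by (auto intro!: diff_mem sum_mem times_mem)
    ultimately show "tn (e j \<cdot> X \<cdot> ((\<Sum>i<d. scalar_op (c i j k) \<cdot> f i) - f j \<cdot> f k)) \<le> N * 1 * \<eta>"
      by (intro tn_times_left_le)
  qed
  finally show ?thesis by simp
qed

section \<open>Defects of approximate intertwiners and their enlargement\<close>

lemma defect_mem:
  assumes "V \<in> M" "norm V \<le> 1"
  shows "\<one> - V\<^sup>\<dagger> \<cdot> V \<in> M" "(\<one> - V\<^sup>\<dagger> \<cdot> V)\<^sup>\<dagger> = \<one> - V\<^sup>\<dagger> \<cdot> V" "norm (\<one> - V\<^sup>\<dagger> \<cdot> V) \<le> 1"
proof -
  show "\<one> - V\<^sup>\<dagger> \<cdot> V \<in> M" "(\<one> - V\<^sup>\<dagger> \<cdot> V)\<^sup>\<dagger> = \<one> - V\<^sup>\<dagger> \<cdot> V"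
    using assms by (simp_all add: adj_simps)
  show "norm (\<one> - V\<^sup>\<dagger> \<cdot> V) \<le> 1"
  proof (rule norm_blinfun_bound)
    fix x
    have "(norm (blinfun_apply (\<one> - V\<^sup>\<dagger> \<cdot> V) x))\<^sup>2 \<le> (norm x)\<^sup>2"
      using norm_defect_le[OF assms, of x] zero_le_power2[of "norm (blinfun_apply V x)"] by linarith
    then show "norm (blinfun_apply (\<one> - V\<^sup>\<dagger> \<cdot> V) x) \<le> 1 * norm x"
      unfolding mult_1 by (rule power2_le_imp_le) simp
  qed simp
qed

lemma defect_mem':
  assumes "V \<in> M" "norm V \<le> 1"
  shows "\<one> - V \<cdot> V\<^sup>\<dagger> \<in> M" "(\<one> - V \<cdot> V\<^sup>\<dagger>)\<^sup>\<dagger> = \<one> - V \<cdot> V\<^sup>\<dagger>" "norm (\<one> - V \<cdot> V\<^sup>\<dagger>) \<le> 1"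
  using defect_mem[of "V\<^sup>\<dagger>"] assms by simp_all

text \<open>Exact intertwining and its adjoint would make \<open>E\<close> commute with
  \<open>V \<cdot> V\<^sup>\<dagger>\<close> and \<open>F\<close> with
  \<open>V\<^sup>\<dagger> \<cdot> V\<close>. Each of the two relations is used once, at cost
  \<open>\<eta>\<close>.\<close>

lemma defect_commutes:
  assumes "V \<in> M" "norm V \<le> 1" "E \<in> M" "E\<^sup>\<dagger> = E" "F \<in> M" "F\<^sup>\<dagger> = F"
    and "tn (E \<cdot> V - V \<cdot> F) \<le> \<eta>"
  shows "tn (E \<cdot> (\<one> - V \<cdot> V\<^sup>\<dagger>) - (\<one> - V \<cdot> V\<^sup>\<dagger>) \<cdot> E) \<le> 2 * \<eta>"
    and "tn (F \<cdot> (\<one> - V\<^sup>\<dagger> \<cdot> V) - (\<one> - V\<^sup>\<dagger> \<cdot> V) \<cdot> F) \<le> 2 * \<eta>"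
proof -
  define A where "A = E \<cdot> V - V \<cdot> F"
  have A: "A \<in> M" "A\<^sup>\<dagger> = V\<^sup>\<dagger> \<cdot> E - F \<cdot> V\<^sup>\<dagger>" "tn A \<le> \<eta>"
    using assms by (simp_all add: A_def adj_simps)
  have n: "norm (V\<^sup>\<dagger>) \<le> 1" using assms by simp
  have "E \<cdot> (\<one> - V \<cdot> V\<^sup>\<dagger>) - (\<one> - V \<cdot> V\<^sup>\<dagger>) \<cdot> E = V \<cdot> A\<^sup>\<dagger> - A \<cdot> V\<^sup>\<dagger>"
    unfolding A(2) by (simp add: A_def op_distrib op_times_assoc)
  moreover have "tn (V \<cdot> A\<^sup>\<dagger> - A \<cdot> V\<^sup>\<dagger>) \<le> 1 * \<eta> + \<eta> * 1"
    using A(1,3) assms n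
    by (intro order_trans[OF tn_triangle_diff] add_mono tn_times_left_le tn_times_right_le) auto
  ultimately show "tn (E \<cdot> (\<one> - V \<cdot> V\<^sup>\<dagger>) - (\<one> - V \<cdot> V\<^sup>\<dagger>) \<cdot> E) \<le> 2 * \<eta>" by simp
  have "F \<cdot> (\<one> - V\<^sup>\<dagger> \<cdot> V) - (\<one> - V\<^sup>\<dagger> \<cdot> V) \<cdot> F = A\<^sup>\<dagger> \<cdot> V - V\<^sup>\<dagger> \<cdot> A"
    unfolding A(2) by (simp add: A_def op_distrib op_times_assoc)
  moreover have "tn (A\<^sup>\<dagger> \<cdot> V - V\<^sup>\<dagger> \<cdot> A) \<le> \<eta> * 1 + 1 * \<eta>"
    using A(1,3) assms n
    by (intro order_trans[OF tn_triangle_diff] add_mono tn_times_left_le tn_times_right_le) auto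
  ultimately show "tn (F \<cdot> (\<one> - V\<^sup>\<dagger> \<cdot> V) - (\<one> - V\<^sup>\<dagger> \<cdot> V) \<cdot> F) \<le> 2 * \<eta>" by simp
qed

text \<open>Pairing the operator with \<open>U\<close> costs no 2-norm, and the average of this
  pairing is \<open>\<Sum>i. \<tau> (D \<cdot> e i) * \<tau> (f i \<cdot> D')\<close>. The two
  factors nearly agree, and the expansion of the unit bounds the sum of squares from below by
  \<open>(\<tau> D)\<^sup>2\<close>. Some unitary does at least as well as any value below the
  average.\<close>

lemma casimir_lower_bound:
  assumes "factor M" and e: "closed_frame d N e" and f: "frame d N f" "approx_copy d e f \<eta>"
    and V: "V \<in> M" "norm V \<le> 1" "\<And>k. k < d \<Longrightarrow> tn (e k \<cdot> V - V \<cdot> f k) \<le> \<eta>"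
    and N: "0 \<le> N"
    and s: "s < (Re (\<tau> (\<one> - V \<cdot> V\<^sup>\<dagger>)))\<^sup>2 - 2 * real d * N * \<eta>"
  obtains U where "U \<in> unitaries"
    "s \<le> tn ((\<one> - V \<cdot> V\<^sup>\<dagger>) \<cdot> (\<Sum>i<d. e i \<cdot> U \<cdot> f i) \<cdot> (\<one> - V\<^sup>\<dagger> \<cdot> V))"
proof -
  have eF: "frame d N e" using e by (simp add: closed_frame_def)
  note eM = frameD[OF eF] and fM = frameD[OF f(1)]
  define D where "D = \<one> - V \<cdot> V\<^sup>\<dagger>"
  define D' where "D' = \<one> - V\<^sup>\<dagger> \<cdot> V"
  have D: "D \<in> M" "D\<^sup>\<dagger> = D" "norm D \<le> 1"
    unfolding D_def using defect_mem'[OF V(1,2)] by auto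
  have D': "D' \<in> M" "D'\<^sup>\<dagger> = D'"
    unfolding D'_def using defect_mem[OF V(1,2)] by auto
  define p where "p i = Re (\<tau> (D \<cdot> e i))" for i
  define q where "q i = Re (\<tau> (f i \<cdot> D'))" for i
  have p: "\<tau> (D \<cdot> e i) = complex_of_real (p i)" if "i < d" for i
    unfolding p_def using that D eM by (intro tr_self_adjoint_real) auto
  have q: "\<tau> (f i \<cdot> D') = complex_of_real (q i)" if "i < d" for i
    unfolding q_def using that D' fM by (intro tr_self_adjoint_real) auto
  have pq: "\<bar>p i - q i\<bar> \<le> 2 * \<eta>" if i: "i < d" for i
  proof -
    \<comment> \<open>By traciality the two traces differ only by the difference of the traces of
      \<open>e i\<close> and \<open>f i\<close> and by the intertwining error, each at most
      \<open>\<eta>\<close>.\<close>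
    have "\<tau> (V \<cdot> (V\<^sup>\<dagger> \<cdot> e i)) = \<tau> (V\<^sup>\<dagger> \<cdot> e i \<cdot> V)"
      using i V eM by (intro tr_commute) auto
    moreover have "\<tau> (f i \<cdot> (V\<^sup>\<dagger> \<cdot> V)) = \<tau> ((V\<^sup>\<dagger> \<cdot> V) \<cdot> f i)"
      using i V fM by (intro tr_commute) auto
    ultimately have "\<tau> (D \<cdot> e i) - \<tau> (f i \<cdot> D')
        = (\<tau> (e i) - \<tau> (f i)) - \<tau> (V\<^sup>\<dagger> \<cdot> (e i \<cdot> V - V \<cdot> f i))"
      using i V eM fM by (simp add: D_def D'_def op_distrib tr_diff op_times_assoc)
    also have "cmod \<dots> \<le> \<eta> + \<eta>"
    proof (rule order_trans[OF norm_triangle_ineq4 add_mono])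
      show "cmod (\<tau> (e i) - \<tau> (f i)) \<le> \<eta>"
        using f(2) i by (simp add: approx_copy_def)
      have "tn (V\<^sup>\<dagger> \<cdot> (e i \<cdot> V - V \<cdot> f i)) \<le> 1 * \<eta>"
        using i V eM fM by (intro tn_times_left_le) auto
      then show "cmod (\<tau> (V\<^sup>\<dagger> \<cdot> (e i \<cdot> V - V \<cdot> f i))) \<le> \<eta>"
        using cmod_tr_le_tn[of "V\<^sup>\<dagger> \<cdot> (e i \<cdot> V - V \<cdot> f i)"] i V eM fM by simp
    qed
    also have "\<tau> (D \<cdot> e i) - \<tau> (f i \<cdot> D') = complex_of_real (p i - q i)"
      using p q i by simp
    finally show ?thesis by (simp del: of_real_diff)
  qed
  have p_le: "\<bar>p i\<bar> \<le> N" if i: "i < d" for i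
  proof -
    have "\<bar>p i\<bar> \<le> norm (D \<cdot> e i)"
      using cmod_tr_le_norm[of "D \<cdot> e i"] abs_Re_le_cmod[of "\<tau> (D \<cdot> e i)"] D eM i by (simp add: p_def)
    also have "\<dots> \<le> 1 * N"
      using D eM i by (intro norm_times_le) auto
    finally show ?thesis by simp
  qed
  have "(Re (\<tau> D))\<^sup>2 \<le> (\<Sum>i<d. (p i)\<^sup>2)"
  proof -
    define t where "t i = Re (\<tau> (e i))" for i
    have t: "\<tau> (e i) = complex_of_real (t i)" if "i < d" for i
      using that eM tr_self_adjoint_real[OF one_mem, of "e i"] by (simp add: t_def)
    \<comment> \<open>The unit has coordinates \<open>t i\<close> and 2-norm 1, so their squares add
      up to 1. Cauchy-Schwarz for \<open>\<tau> D = \<Sum>i. t i * p i\<close> then gives the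
      bound.\<close>
    have one: "\<one> = (\<Sum>i<d. scalar_op (\<tau> (e i)) \<cdot> e i)"
      using e by (simp add: closed_frame_def)
    have "\<tau> \<one> = (\<Sum>i<d. \<tau> (e i) * \<tau> (e i))"
      using eM by (subst one, subst tr_sum) (auto simp: tr_scalar)
    also have "\<dots> = complex_of_real (\<Sum>i<d. (t i)\<^sup>2)"
      using t by (simp add: power2_eq_square)
    finally have t1: "(\<Sum>i<d. (t i)\<^sup>2) = 1"
      by (metis of_real_1 of_real_eq_iff tr_one)
    have "\<tau> D = \<tau> (D \<cdot> (\<Sum>i<d. scalar_op (\<tau> (e i)) \<cdot> e i))"
      by (simp flip: one)
    also have "\<dots> = (\<Sum>i<d. \<tau> (e i) * \<tau> (D \<cdot> e i))"
      unfolding op_sum using eM D by (subst tr_sum) (auto simp: scalar_op_left tr_scalar)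
    also have "\<dots> = complex_of_real (\<Sum>i<d. t i * p i)"
      using t p by simp
    finally have "Re (\<tau> D) = (\<Sum>i<d. t i * p i)" by simp
    then have "(Re (\<tau> D))\<^sup>2 \<le> (\<Sum>i<d. (t i)\<^sup>2) * (\<Sum>i<d. (p i)\<^sup>2)"
      using Cauchy_Schwarz_ineq_sum[of t p "{..<d}"] by simp
    then show ?thesis using t1 by simp
  qed
  also have "(\<Sum>i<d. (p i)\<^sup>2) \<le> (\<Sum>i<d. p i * q i + 2 * N * \<eta>)"
  proof (rule sum_mono)
    \<comment> \<open>Here the square of \<open>p i\<close> is
      \<open>p i * q i + p i * (p i - q i)\<close>.\<close>
    fix i assume "i \<in> {..<d}"
    then have "\<bar>p i * (p i - q i)\<bar> \<le> N * (2 * \<eta>)"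
      unfolding abs_mult using p_le pq by (intro mult_mono N) auto
    then show "(p i)\<^sup>2 \<le> p i * q i + 2 * N * \<eta>"
      by (simp add: power2_eq_square algebra_simps abs_le_iff)
  qed
  also have "\<dots> = (\<Sum>i<d. p i * q i) + 2 * real d * N * \<eta>"
    by (simp add: sum.distrib)
  finally have "s < (\<Sum>i<d. p i * q i)"
    using s by (simp add: D_def)
  also have "(\<Sum>i<d. p i * q i) = Re (\<Sum>i<d. \<tau> (D \<cdot> e i) * \<tau> (f i \<cdot> D'))"
    using p q by simp
  finally have s_less: "s < Re (\<Sum>i<d. \<tau> (D \<cdot> e i) * \<tau> (f i \<cdot> D'))" .
  obtain U where U: "U \<in> unitaries"
    "s < Re (\<Sum>i<d. \<tau> (D \<cdot> e i \<cdot> (U \<cdot> (f i \<cdot> D') \<cdot> U\<^sup>\<dagger>)))"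
  proof (rule ccontr)
    assume "\<not> thesis"
    then have le: "Re (\<Sum>i<d. \<tau> (D \<cdot> e i \<cdot> (U \<cdot> (f i \<cdot> D') \<cdot> U\<^sup>\<dagger>))) \<le> s" if "U \<in> unitaries" for U
      using that \<open>\<not> thesis\<close> not_le \<open>\<And>U. U \<in> unitaries \<Longrightarrow> s < Re (\<Sum>i<d. \<tau> (D \<cdot> e i \<cdot> (U \<cdot> (f i \<cdot> D') \<cdot> U\<^sup>\<dagger>))) \<Longrightarrow> thesis\<close>
      by blast
    have "Re (\<Sum>i<d. \<tau> (D \<cdot> e i) * \<tau> (f i \<cdot> D')) \<le> s"
      using eM fM D D' by (intro unitary_average_bound[OF assms(1)] le) auto
    with s_less show False by linarith
  qed
  define X where "X = D \<cdot> (\<Sum>i<d. e i \<cdot> U \<cdot> f i) \<cdot> D'"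
  have XM: "X \<in> M"
    using D D' eM fM unitary_mem[OF U(1)] by (auto simp: X_def intro!: times_mem sum_mem)
  have "(\<Sum>i<d. \<tau> (D \<cdot> e i \<cdot> (U \<cdot> (f i \<cdot> D') \<cdot> U\<^sup>\<dagger>))) = \<tau> (X \<cdot> U\<^sup>\<dagger>)"
    unfolding X_def op_sum op_times_assoc
    using eM fM D D' unitary_mem[OF U(1)] by (subst tr_sum) auto
  also have "\<dots> = \<tau> (U\<^sup>\<dagger> \<cdot> X)"
    using XM unitary_mem[OF U(1)] by (intro tr_commute) auto
  finally have "s < cmod (\<tau> (U\<^sup>\<dagger> \<cdot> X))"
    using U(2) complex_Re_le_cmod[of "\<tau> (U\<^sup>\<dagger> \<cdot> X)"] by simp
  also have "\<dots> \<le> tn U * tn X"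
    using XM unitary_mem[OF U(1)] by (intro cmod_tr_le)
  also have "tn U = 1"
    using unitary_cancel(1)[OF U(1)] by (simp add: two_norm_def)
  finally have "s \<le> tn X" by simp
  with U(1) show ?thesis
    using that by (simp add: X_def D_def D'_def)
qed

text \<open>\<open>C\<close> bounds the norm of \<open>T\<close>, so \<open>T / C\<close> can be fed
  to \<open>contraction_perturb\<close> with either sign. The trace condition leaves
  \<open>\<epsilon>\<^sup>2 / 2\<close> as lower bound for the 2-norm of
  \<open>D \<cdot> T \<cdot> D'\<close>; the factor \<open>1 / (2 * C)\<close> turns it into
  \<open>\<epsilon>\<^sup>2 / (4 * C)\<close>. In the new error, \<open>V\<close> contributes
  \<open>\<eta>\<close>, each of the two defects \<open>\<eta>\<close>, and \<open>T\<close> at most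
  \<open>d * N * \<eta>\<close>.\<close>

lemma intertwiner_step:
  assumes "factor M" and e: "closed_frame d N e" and f: "frame d N f" "approx_copy d e f \<eta>"
    and V: "V \<in> M" "norm V \<le> 1" "\<And>k. k < d \<Longrightarrow> tn (e k \<cdot> V - V \<cdot> f k) \<le> \<eta>"
    and N: "0 \<le> N" "0 \<le> \<eta>" and C: "C = d * N * N + 1"
    and \<epsilon>: "0 < \<epsilon>" "\<epsilon> \<le> Re (\<tau> (\<one> - V \<cdot> V\<^sup>\<dagger>))" "4 * real d * N * \<eta> < \<epsilon>\<^sup>2"
  obtains W where "W \<in> M" "norm W \<le> 1" "\<And>k. k < d \<Longrightarrow> tn (e k \<cdot> W - W \<cdot> f k) \<le> (3 + d * N) * \<eta>"
    "(tn V)\<^sup>2 + (\<epsilon>\<^sup>2 / (4 * C))\<^sup>2 \<le> (tn W)\<^sup>2"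
proof -
  have eF: "frame d N e" using e by (simp add: closed_frame_def)
  note eM = frameD[OF eF] and fM = frameD[OF f(1)]
  define D where "D = \<one> - V \<cdot> V\<^sup>\<dagger>"
  define D' where "D' = \<one> - V\<^sup>\<dagger> \<cdot> V"
  have D: "D \<in> M" "norm D \<le> 1"
    unfolding D_def using defect_mem'[OF V(1,2)] by auto
  have D': "D' \<in> M" "norm D' \<le> 1"
    unfolding D'_def using defect_mem[OF V(1,2)] by auto
  have C1: "1 \<le> C" using N by (simp add: C)
  have "\<epsilon>\<^sup>2 \<le> (Re (\<tau> D))\<^sup>2"
    using \<epsilon> by (intro power_mono) (auto simp: D_def)
  then have "\<epsilon>\<^sup>2 / 2 < (Re (\<tau> (\<one> - V \<cdot> V\<^sup>\<dagger>)))\<^sup>2 - 2 * real d * N * \<eta>"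
    using \<epsilon>(3) by (simp add: D_def)
  from casimir_lower_bound[OF assms(1) e f V N(1) this] obtain U where U: "U \<in> unitaries"
    "\<epsilon>\<^sup>2 / 2 \<le> tn (D \<cdot> (\<Sum>i<d. e i \<cdot> U \<cdot> f i) \<cdot> D')"
    unfolding D_def D'_def by blast
  note UM = unitary_mem[OF U(1)]
  define T where "T = (\<Sum>i<d. e i \<cdot> U \<cdot> f i)"
  have TM: "T \<in> M"
    unfolding T_def using eM fM UM by (intro sum_mem times_mem) auto
  have "norm T \<le> (\<Sum>i<d. N * 1 * N)"
    unfolding T_def using eM fM norm_unitary_le[OF U(1)]
    by (intro order_trans[OF norm_sum] sum_mono norm_times_le) auto
  then have T_norm: "norm T \<le> C" by (simp add: C)
  define Z where "Z = (1 / C) *\<^sub>R T"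
  have Z: "Z \<in> M" "norm Z \<le> 1"
    using TM T_norm C1 by (simp_all add: Z_def field_simps)
  define Y where "Y = (1/2) *\<^sub>R (D \<cdot> Z \<cdot> D')"
  have YM: "Y \<in> M"
    using D D' Z by (simp add: Y_def)
  have plus: "norm (V + Y) \<le> 1"
    unfolding Y_def D_def D'_def using V Z by (intro contraction_perturb)
  have "norm (V + (1/2) *\<^sub>R (D \<cdot> (- Z) \<cdot> D')) \<le> 1"
    unfolding D_def D'_def using V Z by (intro contraction_perturb) auto
  then have minus: "norm (V - Y) \<le> 1"
    by (simp add: Y_def op_distrib)
  have Y_eq: "Y = (1 / (2 * C)) *\<^sub>R (D \<cdot> T \<cdot> D')"
    by (simp add: Y_def Z_def op_distrib)
  have Y_int: "tn (e k \<cdot> Y - Y \<cdot> f k) \<le> (2 + d * N) * \<eta>" if k: "k < d" for k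
  proof -
    \<comment> \<open>The element \<open>e k\<close> is moved through \<open>D\<close>,
      \<open>T\<close> and \<open>D'\<close> in turn and becomes \<open>f k\<close> while passing
      \<open>T\<close>.\<close>
    define P where "P = (e k \<cdot> D - D \<cdot> e k) \<cdot> (T \<cdot> D')"
    define Q where "Q = D \<cdot> ((e k \<cdot> T - T \<cdot> f k) \<cdot> D')"
    define S where "S = D \<cdot> T \<cdot> (f k \<cdot> D' - D' \<cdot> f k)"
    note kM = eM[OF k] fM[OF k]
    have mem: "P \<in> M" "Q \<in> M" "S \<in> M"
      using kM D D' TM by (simp_all add: P_def Q_def S_def)
    have "e k \<cdot> Y - Y \<cdot> f k = (1 / (2 * C)) *\<^sub>R (P + Q + S)"
      by (simp add: Y_eq P_def Q_def S_def op_distrib op_times_assoc flip: scaleR_diff_right)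
    then have "tn (e k \<cdot> Y - Y \<cdot> f k) = (1 / (2 * C)) * tn (P + Q + S)"
      using mem C1 by (simp add: tn_scaleR)
    also have "tn (P + Q + S) \<le> tn P + tn Q + tn S"
      using mem tn_triangle[of "P + Q" S] tn_triangle[of P Q] by simp
    also have "tn P \<le> 2 * \<eta> * (C * 1)"
      unfolding P_def using defect_commutes(1)[OF V(1,2) kM(1,2,4,5) V(3)[OF k]] kM D D' TM T_norm
      by (intro tn_times_right_le norm_times_le times_mem diff_mem) (auto simp: D_def)
    also have "tn Q \<le> 1 * (d * N * \<eta> * 1)"
      unfolding Q_def using casimir_intertwines[OF e f UM norm_unitary_le[OF U(1)] k N] kM D D' TM
      by (intro tn_times_left_le tn_times_right_le times_mem diff_mem) (auto simp: T_def)
    also have "tn S \<le> 1 * C * (2 * \<eta>)"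
      unfolding S_def using defect_commutes(2)[OF V(1,2) kM(1,2,4,5) V(3)[OF k]] kM D D' TM T_norm
      by (intro tn_times_left_le norm_times_le times_mem diff_mem) (auto simp: D'_def)
    also have "(1 / (2 * C)) * (2 * \<eta> * (C * 1) + 1 * (d * N * \<eta> * 1) + 1 * C * (2 * \<eta>))
        = 2 * \<eta> + (d * N * \<eta>) / (2 * C)"
      using C1 by (simp add: field_simps)
    also have "(d * N * \<eta>) / (2 * C) \<le> (d * N * \<eta>) / 1"
      using C1 N by (intro divide_left_mono) auto
    finally show ?thesis
      using C1 by (simp add: divide_right_mono algebra_simps)
  qed
  have int: "tn (e k \<cdot> (V + Y) - (V + Y) \<cdot> f k) \<le> (3 + d * N) * \<eta>"
    "tn (e k \<cdot> (V - Y) - (V - Y) \<cdot> f k) \<le> (3 + d * N) * \<eta>" if k: "k < d" for k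
  proof -
    have mem: "e k \<cdot> V - V \<cdot> f k \<in> M" "e k \<cdot> Y - Y \<cdot> f k \<in> M"
      using eM[OF k] fM[OF k] V YM by auto
    have sum: "\<eta> + (2 + d * N) * \<eta> = (3 + d * N) * \<eta>"
      by (simp add: algebra_simps)
    have "e k \<cdot> (V + Y) - (V + Y) \<cdot> f k = (e k \<cdot> V - V \<cdot> f k) + (e k \<cdot> Y - Y \<cdot> f k)"
      by (simp add: op_distrib)
    then show "tn (e k \<cdot> (V + Y) - (V + Y) \<cdot> f k) \<le> (3 + d * N) * \<eta>"
      using order_trans[OF tn_triangle[OF mem] add_mono[OF V(3)[OF k] Y_int[OF k]]] sum by simp
    have "e k \<cdot> (V - Y) - (V - Y) \<cdot> f k = (e k \<cdot> V - V \<cdot> f k) - (e k \<cdot> Y - Y \<cdot> f k)"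
      by (simp add: op_distrib)
    then show "tn (e k \<cdot> (V - Y) - (V - Y) \<cdot> f k) \<le> (3 + d * N) * \<eta>"
      using order_trans[OF tn_triangle_diff[OF mem] add_mono[OF V(3)[OF k] Y_int[OF k]]] sum by simp
  qed
  have "\<epsilon>\<^sup>2 / (4 * C) \<le> tn Y"
    using U(2) C1 D D' TM by (simp add: Y_eq tn_scaleR field_simps flip: T_def)
  then have gain: "(\<epsilon>\<^sup>2 / (4 * C))\<^sup>2 \<le> (tn Y)\<^sup>2"
    using C1 by (intro power_mono) auto
  have "(tn (V + Y))\<^sup>2 + (tn (V - Y))\<^sup>2 = 2 * (tn V)\<^sup>2 + 2 * (tn Y)\<^sup>2"
    using V(1) YM by (rule tn_parallelogram)
  then consider "(tn V)\<^sup>2 + (\<epsilon>\<^sup>2 / (4 * C))\<^sup>2 \<le> (tn (V + Y))\<^sup>2"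
    | "(tn V)\<^sup>2 + (\<epsilon>\<^sup>2 / (4 * C))\<^sup>2 \<le> (tn (V - Y))\<^sup>2"
    using gain by argo
  then show ?thesis
  proof cases
    case 1
    then show ?thesis using that[of "V + Y"] plus int V(1) YM by blast
  next
    case 2
    then show ?thesis using that[of "V - Y"] minus int V(1) YM by blast
  qed
qed

text \<open>While the trace of the defect exceeds \<open>\<epsilon>\<close>, every step adds at
  least \<open>g\<close> to the squared 2-norm. As this cannot exceed 1, the defect is small after
  \<open>n\<close> steps with \<open>n * g > 1\<close>. Errors grow by the factor \<open>K\<close>
  per step, whence \<open>\<delta> = \<theta> / K ^ n\<close>.\<close>

lemma approx_intertwiner:
  assumes "factor M" and e: "closed_frame d N e" and pos: "0 \<le> N" "0 < \<epsilon>" "0 < \<eta>"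
  obtains \<delta> where "0 < \<delta>"
    "\<And>f. frame d N f \<Longrightarrow> approx_copy d e f \<delta> \<Longrightarrow>
      \<exists>V\<in>M. norm V \<le> 1 \<and> (\<forall>k<d. tn (e k \<cdot> V - V \<cdot> f k) \<le> \<eta>) \<and> Re (\<tau> (\<one> - V \<cdot> V\<^sup>\<dagger>)) \<le> \<epsilon>"
proof -
  define C where "C = d * N * N + 1"
  define K where "K = 3 + d * N"
  have C1: "1 \<le> C" and K1: "1 \<le> K" using pos by (simp_all add: C_def K_def)
  define g where "g = (\<epsilon>\<^sup>2 / (4 * C))\<^sup>2"
  have "0 < g" using C1 pos by (simp add: g_def)
  then obtain n :: nat where n: "1 < n * g"
    using reals_Archimedean3 by blast
  define \<theta> where "\<theta> = min \<eta> (\<epsilon>\<^sup>2 / (4 * real d * N + 1))"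
  have den: "0 < 4 * real d * N + 1" using pos by (simp add: add_nonneg_pos)
  have \<theta>: "0 < \<theta>" "\<theta> \<le> \<eta>" "4 * real d * N * \<theta> < \<epsilon>\<^sup>2"
  proof -
    show \<theta>0: "0 < \<theta>" "\<theta> \<le> \<eta>" using pos den by (simp_all add: \<theta>_def)
    have "(4 * real d * N + 1) * \<theta> \<le> \<epsilon>\<^sup>2"
      using den mult_left_mono[of \<theta> "\<epsilon>\<^sup>2 / (4 * real d * N + 1)" "4 * real d * N + 1"] by (simp add: \<theta>_def)
    then show "4 * real d * N * \<theta> < \<epsilon>\<^sup>2" using \<theta>0 by (simp add: algebra_simps)
  qed
  define \<delta> where "\<delta> = \<theta> / K ^ n"
  have \<delta>: "0 < \<delta>" using \<theta> K1 by (simp add: \<delta>_def)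
  have K\<delta>: "K ^ m * \<delta> \<le> \<theta>" if "m \<le> n" for m
  proof -
    have "K ^ m \<le> K ^ n" using K1 that by (intro power_increasing)
    then have "K ^ m * \<delta> \<le> K ^ n * \<delta>" using \<delta> by simp
    then show ?thesis using K1 by (simp add: \<delta>_def)
  qed
  have "\<exists>V\<in>M. norm V \<le> 1 \<and> (\<forall>k<d. tn (e k \<cdot> V - V \<cdot> f k) \<le> \<eta>) \<and> Re (\<tau> (\<one> - V \<cdot> V\<^sup>\<dagger>)) \<le> \<epsilon>"
    if f: "frame d N f" "approx_copy d e f \<delta>" for f
  proof -
    \<comment> \<open>The disjunction lets the iteration stand still once the defect is
      small.\<close>
    have "\<exists>V\<in>M. norm V \<le> 1 \<and> (\<forall>k<d. tn (e k \<cdot> V - V \<cdot> f k) \<le> K ^ m * \<delta>) \<and>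
        (Re (\<tau> (\<one> - V \<cdot> V\<^sup>\<dagger>)) \<le> \<epsilon> \<or> m * g \<le> (tn V)\<^sup>2)" if "m \<le> n" for m
      using that
    proof (induction m)
      case 0
      then show ?case using \<delta> by (intro bexI[of _ 0]) (simp_all add: op_distrib)
    next
      case (Suc m)
      then obtain V where V: "V \<in> M" "norm V \<le> 1" "\<And>k. k < d \<Longrightarrow> tn (e k \<cdot> V - V \<cdot> f k) \<le> K ^ m * \<delta>"
        "Re (\<tau> (\<one> - V \<cdot> V\<^sup>\<dagger>)) \<le> \<epsilon> \<or> m * g \<le> (tn V)\<^sup>2"
        by auto
      have le: "K ^ m * \<delta> \<le> K ^ Suc m * \<delta>" and ge: "\<delta> \<le> K ^ m * \<delta>"
        using K1 \<delta> by simp_all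
      show ?case
      proof (cases "Re (\<tau> (\<one> - V \<cdot> V\<^sup>\<dagger>)) \<le> \<epsilon>")
        case True
        then show ?thesis using V order_trans[OF V(3) le] by blast
      next
        case False
        have "4 * real d * N * (K ^ m * \<delta>) \<le> 4 * real d * N * \<theta>"
          using K\<delta>[of m] Suc.prems pos by (intro mult_left_mono) auto
        then have small: "4 * real d * N * (K ^ m * \<delta>) < \<epsilon>\<^sup>2"
          using \<theta>(3) by linarith
        have "0 \<le> K ^ m * \<delta>" using K1 \<delta> by simp
        from intertwiner_step[OF assms(1) e f(1) approx_copy_mono[OF f(2) ge] V(1-3) pos(1) this C_def pos(2) _ small]
        obtain W where W: "W \<in> M" "norm W \<le> 1"
          "\<And>k. k < d \<Longrightarrow> tn (e k \<cdot> W - W \<cdot> f k) \<le> K * (K ^ m * \<delta>)" "(tn V)\<^sup>2 + g \<le> (tn W)\<^sup>2"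
          using False unfolding K_def g_def by (metis less_imp_le not_le)
        have "Suc m * g \<le> (tn W)\<^sup>2"
          using W(4) V(4) False by (simp add: algebra_simps)
        then show ?thesis
          using W by (intro bexI[of _ W]) (simp_all add: mult.assoc)
      qed
    qed
    from this[of n] obtain V where V: "V \<in> M" "norm V \<le> 1"
      "\<And>k. k < d \<Longrightarrow> tn (e k \<cdot> V - V \<cdot> f k) \<le> K ^ n * \<delta>"
      "Re (\<tau> (\<one> - V \<cdot> V\<^sup>\<dagger>)) \<le> \<epsilon> \<or> n * g \<le> (tn V)\<^sup>2"
      by auto
    have "tn V \<le> 1" using tn_le_norm[OF V(1)] V(2) by linarith
    then have "(tn V)\<^sup>2 \<le> 1" using V(1) by (simp add: power_le_one)
    then have "Re (\<tau> (\<one> - V \<cdot> V\<^sup>\<dagger>)) \<le> \<epsilon>" using V(4) n by linarith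
    moreover have "tn (e k \<cdot> V - V \<cdot> f k) \<le> \<eta>" if "k < d" for k
      using V(3)[OF that] K\<delta>[of n] \<theta>(2) by linarith
    ultimately show ?thesis using V by blast
  qed
  with \<delta> show ?thesis using that by blast
qed

end

section \<open>Trace-preserving embeddings\<close>

locale tracial_embedding = N: tracial_vna N \<tau> + M: tracial_vna M \<sigma>
  for N :: "('a::complex_hilbert \<Rightarrow>\<^sub>L 'a) set" and \<tau>
    and M :: "('b::complex_hilbert \<Rightarrow>\<^sub>L 'b) set" and \<sigma> +
  fixes \<iota> :: "('a \<Rightarrow>\<^sub>L 'a) \<Rightarrow> ('b \<Rightarrow>\<^sub>L 'b)"
  assumes embedding: "trace_preserving_embedding N \<tau> M \<sigma> \<iota>"
begin

lemma emb_mem: "T \<in> N \<Longrightarrow> \<iota> T \<in> M"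
  using embedding by (auto simp: trace_preserving_embedding_def)

lemma emb_scalar: "\<iota> (scalar_op c) = scalar_op c"
  using embedding by (simp add: trace_preserving_embedding_def)

lemma emb_add: "S \<in> N \<Longrightarrow> T \<in> N \<Longrightarrow> \<iota> (S + T) = \<iota> S + \<iota> T"
  using embedding by (simp add: trace_preserving_embedding_def)

lemma emb_times: "S \<in> N \<Longrightarrow> T \<in> N \<Longrightarrow> \<iota> (S \<cdot> T) = \<iota> S \<cdot> \<iota> T"
  using embedding by (simp add: trace_preserving_embedding_def)

lemma emb_adj: "T \<in> N \<Longrightarrow> \<iota> (T\<^sup>\<dagger>) = (\<iota> T)\<^sup>\<dagger>"
  using embedding by (simp add: trace_preserving_embedding_def)

lemma emb_tr: "T \<in> N \<Longrightarrow> \<sigma> (\<iota> T) = \<tau> T"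
  using embedding by (simp add: trace_preserving_embedding_def)

lemma emb_zero: "\<iota> 0 = 0"
  using emb_scalar[of 0] by simp

lemma emb_scaleR: "T \<in> N \<Longrightarrow> \<iota> (r *\<^sub>R T) = r *\<^sub>R \<iota> T"
  by (simp add: scaleR_op_eq emb_times emb_scalar)

lemma emb_diff: "S \<in> N \<Longrightarrow> T \<in> N \<Longrightarrow> \<iota> (S - T) = \<iota> S - \<iota> T"
  using emb_add[of S "(-1) *\<^sub>R T"] emb_scaleR[of T "-1"] by simp

lemma emb_sum: "(\<And>i. i \<in> I \<Longrightarrow> f i \<in> N) \<Longrightarrow> \<iota> (sum f I) = (\<Sum>i\<in>I. \<iota> (f i))"
  by (induction I rule: infinite_finite_induct) (simp_all add: emb_zero emb_add N.sum_mem)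

text \<open>Square roots of \<open>\<one> - T\<^sup>\<dagger> \<cdot> T\<close> are preserved, so contractions are mapped to contractions.\<close>

lemma emb_norm:
  assumes T: "T \<in> N" shows "norm (\<iota> T) \<le> norm T"
proof (rule field_le_epsilon)
  fix e :: real assume "0 < e"
  define c where "c = norm T + e"
  have c: "norm T < c" "0 < c"
    using \<open>0 < e\<close> by (simp_all add: c_def add_nonneg_pos)
  define A where "A = (1 / c\<^sup>2) *\<^sub>R (T\<^sup>\<dagger> \<cdot> T)"
  have "norm (T\<^sup>\<dagger> \<cdot> T) \<le> norm T * norm T"
    using T by (intro N.norm_times_le) auto
  also have "\<dots> < c\<^sup>2"
    using c by (simp add: power2_eq_square mult_strict_mono')
  finally have "norm A < 1"
    using c by (simp add: A_def)
  moreover have "A \<in> N" "A\<^sup>\<dagger> = A"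
    using T by (simp_all add: A_def N.adj_simps)
  ultimately obtain Q where Q: "Q \<in> N" "Q\<^sup>\<dagger> = Q" "Q \<cdot> Q = \<one> - A"
    using N.sqrt_one_minus by metis
  have "(\<iota> Q)\<^sup>\<dagger> \<cdot> \<iota> Q = \<iota> (\<one> - A)"
    using Q(1,2) by (simp add: emb_adj[symmetric] emb_times[symmetric] Q(3))
  also have "\<dots> = \<one> - (1 / c\<^sup>2) *\<^sub>R ((\<iota> T)\<^sup>\<dagger> \<cdot> \<iota> T)"
    using T \<open>A \<in> N\<close> emb_scalar[of 1]
    by (simp add: A_def emb_diff emb_scaleR emb_times emb_adj)
  finally have eq: "(\<iota> Q)\<^sup>\<dagger> \<cdot> \<iota> Q = \<one> - (1 / c\<^sup>2) *\<^sub>R ((\<iota> T)\<^sup>\<dagger> \<cdot> \<iota> T)" .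
  have "norm (\<iota> T) \<le> c"
  proof (rule norm_blinfun_bound)
    fix x
    have "0 \<le> (norm (blinfun_apply (\<iota> Q) x))\<^sup>2" by simp
    also have "\<dots> = inner x (blinfun_apply ((\<iota> Q)\<^sup>\<dagger> \<cdot> \<iota> Q) x)"
      using Q(1) by (simp only: M.inner_square_adj emb_mem)
    also have "\<dots> = inner x x - inner x (blinfun_apply ((\<iota> T)\<^sup>\<dagger> \<cdot> \<iota> T) x) / c\<^sup>2"
      unfolding eq by (simp add: blinfun.diff_left blinfun.scaleR_left inner_diff_right)
    also have "\<dots> = (norm x)\<^sup>2 - (norm (blinfun_apply (\<iota> T) x))\<^sup>2 / c\<^sup>2"
      using T by (simp only: M.inner_square_adj emb_mem power2_norm_eq_inner[symmetric])
    finally have "(norm (blinfun_apply (\<iota> T) x))\<^sup>2 \<le> (c * norm x)\<^sup>2"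
      using c by (simp add: field_simps power_mult_distrib)
    then show "norm (blinfun_apply (\<iota> T) x) \<le> c * norm x"
      by (rule power2_le_imp_le) (use c in simp)
  qed (use c in simp)
  then show "norm (\<iota> T) \<le> norm T + e" by (simp add: c_def)
qed

end

section \<open>Evaluation of polynomials\<close>

primrec poly_bound :: "real \<Rightarrow> star_poly \<Rightarrow> real" where
  "poly_bound N (Var i) = N"
| "poly_bound N (Scalar c) = cmod c"
| "poly_bound N (Plus p q) = poly_bound N p + poly_bound N q"
| "poly_bound N (Times p q) = poly_bound N p * poly_bound N q"
| "poly_bound N (Star p) = poly_bound N p"

primrec poly_sum :: "nat \<Rightarrow> (nat \<Rightarrow> star_poly) \<Rightarrow> star_poly" where
  "poly_sum 0 f = Scalar 0"
| "poly_sum (Suc n) f = Plus (poly_sum n f) (f n)"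

lemma poly_eval_sum: "poly_eval xs (poly_sum n f) = (\<Sum>i<n. poly_eval xs (f i))"
  by (induction n) simp_all

lemma poly_vars_sum: "poly_vars (poly_sum n f) = (\<Union>i<n. poly_vars (f i))"
  by (induction n) (auto simp: less_Suc_eq)

section \<open>Polynomials under approximate conjugation\<close>

context tracial_vna
begin

lemma poly_eval_mem:
  "set xs \<subseteq> M \<Longrightarrow> poly_vars p \<subseteq> {..<length xs} \<Longrightarrow> poly_eval xs p \<in> M"
  by (induction p) auto

lemma norm_poly_eval_le:
  assumes "set xs \<subseteq> M" "\<And>x. x \<in> set xs \<Longrightarrow> norm x \<le> N" "poly_vars p \<subseteq> {..<length xs}"
  shows "norm (poly_eval xs p) \<le> poly_bound N p"
  using assms(3)
proof (induction p)
  case (Scalar c)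
  show ?case by (simp add: norm_scalar_op)
next
  case (Plus p q)
  then show ?case using norm_triangle_le[of "poly_eval xs p" "poly_eval xs q"] by simp
next
  case (Times p q)
  then show ?case by (simp add: norm_times_le)
next
  case (Star p)
  then show ?case using poly_eval_mem[OF assms(1)] by simp
qed (use assms in auto)

text \<open>A single \<open>\<theta>\<close> measures both defects of \<open>V\<close> and the
  distance of the tuples, so that all consequences are linear in it.\<close>

definition approx_conjugate ::
    "real \<Rightarrow> real \<Rightarrow> ('a \<Rightarrow>\<^sub>L 'a) \<Rightarrow> ('a \<Rightarrow>\<^sub>L 'a) list \<Rightarrow> ('a \<Rightarrow>\<^sub>L 'a) list \<Rightarrow> bool" where
  "approx_conjugate N \<theta> V xs ys \<longleftrightarrow>
     V \<in> M \<and> norm V \<le> 1 \<and> tn (\<one> - V \<cdot> V\<^sup>\<dagger>) \<le> \<theta> \<and> tn (\<one> - V\<^sup>\<dagger> \<cdot> V) \<le> \<theta> \<and>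
     length xs = length ys \<and> set xs \<subseteq> M \<and> set ys \<subseteq> M \<and> (\<forall>x\<in>set xs \<union> set ys. norm x \<le> N) \<and>
     (\<forall>i<length xs. tn (xs ! i - V \<cdot> ys ! i \<cdot> V\<^sup>\<dagger>) \<le> \<theta>)"

text \<open>\<open>K\<close> depends only on \<open>p\<close> and the norm bound, not on the tuples,
  \<open>V\<close> or \<open>\<theta>\<close>. Conjugation by \<open>V\<close> fails to be unital by
  the defect of \<open>V \<cdot> V\<^sup>\<dagger>\<close> and to be multiplicative by that of
  \<open>V\<^sup>\<dagger> \<cdot> V\<close>.\<close>

lemma poly_eval_approx_conjugate:
  "\<exists>K. \<forall>xs ys V \<theta>. approx_conjugate N \<theta> V xs ys \<and> poly_vars p \<subseteq> {..<length xs} \<longrightarrow>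
     tn (poly_eval xs p - V \<cdot> poly_eval ys p \<cdot> V\<^sup>\<dagger>) \<le> K * \<theta>"
proof (induction p)
  case (Var i)
  show ?case
    by (intro exI[of _ 1]) (auto simp: approx_conjugate_def)
next
  case (Scalar c)
  have "tn (scalar_op c - V \<cdot> scalar_op c \<cdot> V\<^sup>\<dagger>) \<le> cmod c * \<theta>"
    if "V \<in> M" "tn (\<one> - V \<cdot> V\<^sup>\<dagger>) \<le> \<theta>" for V \<theta>
  proof -
    have "scalar_op c - V \<cdot> scalar_op c \<cdot> V\<^sup>\<dagger> = scalar_op c \<cdot> (\<one> - V \<cdot> V\<^sup>\<dagger>)"
      using that by (simp add: op_distrib scalar_op_right op_times_assoc)
    then show ?thesis
      using that by (simp add: tn_scalar mult_left_mono)
  qed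
  then show ?case
    by (intro exI[of _ "cmod c"]) (simp add: approx_conjugate_def)
next
  case (Plus p q)
  then obtain K L where
    K: "\<And>xs ys V \<theta>. approx_conjugate N \<theta> V xs ys \<Longrightarrow> poly_vars p \<subseteq> {..<length xs} \<Longrightarrow>
      tn (poly_eval xs p - V \<cdot> poly_eval ys p \<cdot> V\<^sup>\<dagger>) \<le> K * \<theta>" and
    L: "\<And>xs ys V \<theta>. approx_conjugate N \<theta> V xs ys \<Longrightarrow> poly_vars q \<subseteq> {..<length xs} \<Longrightarrow>
      tn (poly_eval xs q - V \<cdot> poly_eval ys q \<cdot> V\<^sup>\<dagger>) \<le> L * \<theta>"
    by blast
  show ?case
  proof (intro exI allI impI)
    fix xs ys V \<theta> assume a: "approx_conjugate N \<theta> V xs ys \<and> poly_vars (Plus p q) \<subseteq> {..<length xs}"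
    then have m: "V \<in> M" "set xs \<subseteq> M" "set ys \<subseteq> M" "length xs = length ys"
      and v: "poly_vars p \<subseteq> {..<length xs}" "poly_vars q \<subseteq> {..<length xs}"
      by (auto simp: approx_conjugate_def)
    have mem: "poly_eval xs p \<in> M" "poly_eval ys p \<in> M" "poly_eval xs q \<in> M" "poly_eval ys q \<in> M"
      using poly_eval_mem m v by auto
    have "poly_eval xs (Plus p q) - V \<cdot> poly_eval ys (Plus p q) \<cdot> V\<^sup>\<dagger>
        = (poly_eval xs p - V \<cdot> poly_eval ys p \<cdot> V\<^sup>\<dagger>) + (poly_eval xs q - V \<cdot> poly_eval ys q \<cdot> V\<^sup>\<dagger>)"
      by (simp add: op_distrib)
    also have "tn \<dots> \<le> K * \<theta> + L * \<theta>"
      using a v mem m by (intro order_trans[OF tn_triangle] add_mono K L) auto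
    finally show "tn (poly_eval xs (Plus p q) - V \<cdot> poly_eval ys (Plus p q) \<cdot> V\<^sup>\<dagger>) \<le> (K + L) * \<theta>"
      by (simp add: algebra_simps)
  qed
next
  case (Times p q)
  then obtain K L where
    K: "\<And>xs ys V \<theta>. approx_conjugate N \<theta> V xs ys \<Longrightarrow> poly_vars p \<subseteq> {..<length xs} \<Longrightarrow>
      tn (poly_eval xs p - V \<cdot> poly_eval ys p \<cdot> V\<^sup>\<dagger>) \<le> K * \<theta>" and
    L: "\<And>xs ys V \<theta>. approx_conjugate N \<theta> V xs ys \<Longrightarrow> poly_vars q \<subseteq> {..<length xs} \<Longrightarrow>
      tn (poly_eval xs q - V \<cdot> poly_eval ys q \<cdot> V\<^sup>\<dagger>) \<le> L * \<theta>"
    by blast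
  define P where "P = poly_bound N p"
  define Q where "Q = poly_bound N q"
  show ?case
  proof (intro exI allI impI)
    fix xs ys V \<theta> assume a: "approx_conjugate N \<theta> V xs ys \<and> poly_vars (Times p q) \<subseteq> {..<length xs}"
    then have m: "V \<in> M" "set xs \<subseteq> M" "set ys \<subseteq> M" "length xs = length ys" "norm V \<le> 1"
      and v: "poly_vars p \<subseteq> {..<length xs}" "poly_vars q \<subseteq> {..<length xs}"
      and n: "\<And>x. x \<in> set xs \<Longrightarrow> norm x \<le> N" "\<And>x. x \<in> set ys \<Longrightarrow> norm x \<le> N"
      and D: "tn (\<one> - V\<^sup>\<dagger> \<cdot> V) \<le> \<theta>"
      by (auto simp: approx_conjugate_def)
    have n': "norm (V\<^sup>\<dagger>) \<le> 1" using m by simp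
    define p1 p2 q1 q2 where "p1 = poly_eval xs p" and "p2 = poly_eval ys p"
      and "q1 = poly_eval xs q" and "q2 = poly_eval ys q"
    note defs = p1_def p2_def q1_def q2_def
    have mem: "p1 \<in> M" "p2 \<in> M" "q1 \<in> M" "q2 \<in> M"
      unfolding defs using poly_eval_mem m v by auto
    have nm: "norm p1 \<le> P" "norm p2 \<le> P" "norm q2 \<le> Q"
      unfolding defs P_def Q_def using m v n by (intro norm_poly_eval_le; simp)+
    have KL: "tn (p1 - V \<cdot> p2 \<cdot> V\<^sup>\<dagger>) \<le> K * \<theta>" "tn (q1 - V \<cdot> q2 \<cdot> V\<^sup>\<dagger>) \<le> L * \<theta>"
      unfolding defs using a v K L by blast+
    \<comment> \<open>One factor is exchanged at a time; the last term removes the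
      \<open>V\<^sup>\<dagger> \<cdot> V\<close> that arises between the two conjugated
      factors.\<close>
    have "p1 \<cdot> q1 - V \<cdot> (p2 \<cdot> q2) \<cdot> V\<^sup>\<dagger> = p1 \<cdot> (q1 - V \<cdot> q2 \<cdot> V\<^sup>\<dagger>)
        + (p1 - V \<cdot> p2 \<cdot> V\<^sup>\<dagger>) \<cdot> (V \<cdot> q2 \<cdot> V\<^sup>\<dagger>) - V \<cdot> p2 \<cdot> ((\<one> - V\<^sup>\<dagger> \<cdot> V) \<cdot> (q2 \<cdot> V\<^sup>\<dagger>))"
      by (simp add: op_distrib op_times_assoc)
    also have "tn \<dots> \<le> P * (L * \<theta>) + (K * \<theta>) * (1 * Q * 1) + 1 * P * (\<theta> * (Q * 1))"
    proof (rule order_trans[OF tn_triangle_diff add_mono[OF order_trans[OF tn_triangle add_mono]]])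
      show "tn (p1 \<cdot> (q1 - V \<cdot> q2 \<cdot> V\<^sup>\<dagger>)) \<le> P * (L * \<theta>)"
        using mem m nm KL by (intro tn_times_left_le) auto
      have "norm (V \<cdot> q2 \<cdot> V\<^sup>\<dagger>) \<le> 1 * Q * 1"
        using m nm n' by (intro norm_times_le)
      then show "tn ((p1 - V \<cdot> p2 \<cdot> V\<^sup>\<dagger>) \<cdot> (V \<cdot> q2 \<cdot> V\<^sup>\<dagger>)) \<le> (K * \<theta>) * (1 * Q * 1)"
        using mem m KL by (intro tn_times_right_le) auto
      have "tn ((\<one> - V\<^sup>\<dagger> \<cdot> V) \<cdot> (q2 \<cdot> V\<^sup>\<dagger>)) \<le> \<theta> * (Q * 1)"
        using mem m nm n' D by (intro tn_times_right_le norm_times_le) auto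
      then show "tn (V \<cdot> p2 \<cdot> ((\<one> - V\<^sup>\<dagger> \<cdot> V) \<cdot> (q2 \<cdot> V\<^sup>\<dagger>))) \<le> 1 * P * (\<theta> * (Q * 1))"
        using mem m nm norm_times_le[of V 1 p2 P]
          tn_times_left_le[of "V \<cdot> p2" "(\<one> - V\<^sup>\<dagger> \<cdot> V) \<cdot> (q2 \<cdot> V\<^sup>\<dagger>)" "1 * P" "\<theta> * (Q * 1)"] by simp
    qed (use mem m in auto)
    finally show "tn (poly_eval xs (Times p q) - V \<cdot> poly_eval ys (Times p q) \<cdot> V\<^sup>\<dagger>)
        \<le> (P * L + K * Q + P * Q) * \<theta>"
      by (simp add: defs algebra_simps)
  qed
next
  case (Star p)
  then obtain K where
    K: "\<And>xs ys V \<theta>. approx_conjugate N \<theta> V xs ys \<Longrightarrow> poly_vars p \<subseteq> {..<length xs} \<Longrightarrow>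
      tn (poly_eval xs p - V \<cdot> poly_eval ys p \<cdot> V\<^sup>\<dagger>) \<le> K * \<theta>"
    by blast
  show ?case
  proof (intro exI allI impI)
    fix xs ys V \<theta> assume a: "approx_conjugate N \<theta> V xs ys \<and> poly_vars (Star p) \<subseteq> {..<length xs}"
    then have m: "V \<in> M" "set xs \<subseteq> M" "set ys \<subseteq> M" "length xs = length ys"
      and v: "poly_vars p \<subseteq> {..<length xs}"
      by (auto simp: approx_conjugate_def)
    have mem: "poly_eval xs p \<in> M" "poly_eval ys p \<in> M"
      using poly_eval_mem m v by auto
    have "poly_eval xs (Star p) - V \<cdot> poly_eval ys (Star p) \<cdot> V\<^sup>\<dagger>
        = (poly_eval xs p - V \<cdot> poly_eval ys p \<cdot> V\<^sup>\<dagger>)\<^sup>\<dagger>"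
      using mem m by (simp add: adj_simps op_times_assoc)
    then show "tn (poly_eval xs (Star p) - V \<cdot> poly_eval ys (Star p) \<cdot> V\<^sup>\<dagger>) \<le> K * \<theta>"
      using K[of \<theta> V xs ys] a v mem m by simp
  qed
qed

text \<open>By traciality, conjugation by \<open>V\<close> changes a trace only by the trace against
  the defect of \<open>V\<^sup>\<dagger> \<cdot> V\<close>.\<close>

lemma poly_trace_approx_conjugate:
  "\<exists>K. \<forall>xs ys V \<theta>. approx_conjugate N \<theta> V xs ys \<and> poly_vars p \<subseteq> {..<length xs} \<longrightarrow>
     cmod (\<tau> (poly_eval xs p) - \<tau> (poly_eval ys p)) \<le> K * \<theta>"
proof -
  obtain K where
    K: "\<And>xs ys V \<theta>. approx_conjugate N \<theta> V xs ys \<Longrightarrow> poly_vars p \<subseteq> {..<length xs} \<Longrightarrow>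
      tn (poly_eval xs p - V \<cdot> poly_eval ys p \<cdot> V\<^sup>\<dagger>) \<le> K * \<theta>"
    using poly_eval_approx_conjugate[of N p] by blast
  show ?thesis
  proof (intro exI allI impI)
    fix xs ys V \<theta> assume a: "approx_conjugate N \<theta> V xs ys \<and> poly_vars p \<subseteq> {..<length xs}"
    then have m: "V \<in> M" "set xs \<subseteq> M" "set ys \<subseteq> M" "length xs = length ys"
      and v: "poly_vars p \<subseteq> {..<length xs}" "poly_vars p \<subseteq> {..<length ys}"
      and n: "\<And>x. x \<in> set ys \<Longrightarrow> norm x \<le> N"
      and D: "tn (\<one> - V\<^sup>\<dagger> \<cdot> V) \<le> \<theta>"
      by (auto simp: approx_conjugate_def)
    define p1 p2 where "p1 = poly_eval xs p" and "p2 = poly_eval ys p"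
    have mem: "p1 \<in> M" "p2 \<in> M"
      unfolding p1_def p2_def using poly_eval_mem m v by auto
    have "\<tau> (V \<cdot> p2 \<cdot> V\<^sup>\<dagger>) = \<tau> (V\<^sup>\<dagger> \<cdot> (V \<cdot> p2))"
      using m mem by (intro tr_commute) auto
    then have "\<tau> p1 - \<tau> p2 = \<tau> (p1 - V \<cdot> p2 \<cdot> V\<^sup>\<dagger>) - \<tau> ((\<one> - V\<^sup>\<dagger> \<cdot> V) \<cdot> p2)"
      using m mem by (simp add: tr_diff op_distrib op_times_assoc)
    also have "cmod \<dots> \<le> K * \<theta> + \<theta> * poly_bound N p"
    proof (rule order_trans[OF norm_triangle_ineq4 add_mono])
      show "cmod (\<tau> (p1 - V \<cdot> p2 \<cdot> V\<^sup>\<dagger>)) \<le> K * \<theta>"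
        using K[of \<theta> V xs ys] a m mem
        by (intro order_trans[OF cmod_tr_le_tn]) (auto simp: p1_def p2_def)
      show "cmod (\<tau> ((\<one> - V\<^sup>\<dagger> \<cdot> V) \<cdot> p2)) \<le> \<theta> * poly_bound N p"
        using norm_poly_eval_le[of ys N p] m mem n v D
        by (intro order_trans[OF cmod_tr_le_tn] tn_times_right_le) (auto simp: p2_def)
    qed
    finally show "cmod (\<tau> (poly_eval xs p) - \<tau> (poly_eval ys p)) \<le> (K + poly_bound N p) * \<theta>"
      by (simp add: p1_def p2_def algebra_simps)
  qed
qed

end

lemma (in tracial_embedding) emb_poly_eval:
  assumes "set xs \<subseteq> N" "poly_vars p \<subseteq> {..<length xs}"
  shows "poly_eval (map \<iota> xs) p = \<iota> (poly_eval xs p)"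
  using assms(2)
  by (induction p) (use N.poly_eval_mem[OF assms(1)] in \<open>simp_all add: emb_scalar emb_add emb_times emb_adj\<close>)

lemma poly_eval_append:
  "poly_vars p \<subseteq> {..<length xs} \<Longrightarrow> poly_eval (xs @ ys) p = poly_eval xs p"
  by (induction p) (auto simp: nth_append)

section \<open>Quantifier-free formulas\<close>

text \<open>The finitely many moments on which the value of the formula depends.\<close>

primrec qf_atoms :: "qf_formula \<Rightarrow> star_poly set" where
  "qf_atoms (ReTr p) = {p}"
| "qf_atoms (ImTr p) = {p}"
| "qf_atoms (Conn u \<phi>s) = \<Union> (set (map qf_atoms \<phi>s))"

lemma finite_qf_atoms: "finite (qf_atoms \<phi>)"
  by (induction \<phi>) auto

lemma qf_atoms_vars: "p \<in> qf_atoms \<phi> \<Longrightarrow> poly_vars p \<subseteq> qf_vars \<phi>"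
  by (induction \<phi>) fastforce+

lemma qf_eval_cong: "(\<And>p. p \<in> qf_atoms \<phi> \<Longrightarrow> m p = m' p) \<Longrightarrow> qf_eval m \<phi> = qf_eval m' \<phi>"
proof (induction \<phi>)
  case (Conn u \<phi>s)
  then have "map (qf_eval m) \<phi>s = map (qf_eval m') \<phi>s"
    by (intro map_cong) auto
  then show ?case by (simp only: qf_eval.simps)
qed auto

text \<open>Assignments carry the topology of pointwise convergence, in which reading off one moment
  is continuous; connectives compose by the universal property of products.\<close>

lemma continuous_qf_eval: "qf_wf \<phi> \<Longrightarrow> continuous_on UNIV (\<lambda>m. qf_eval m \<phi>)"
proof (induction \<phi>)
  case (ReTr p)
  show ?case by (simp add: continuous_on_product_coordinates continuous_on_Re)
next
  case (ImTr p)
  show ?case by (simp add: continuous_on_product_coordinates continuous_on_Im)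
next
  case (Conn u \<phi>s)
  have u: "continuous_map (powertop_real {..<length \<phi>s}) euclideanreal u"
    using Conn.prems by simp
  have "continuous_map euclidean (powertop_real {..<length \<phi>s})
      (\<lambda>m. \<lambda>i\<in>{..<length \<phi>s}. map (qf_eval m) \<phi>s ! i)"
  proof (subst continuous_map_componentwise, intro conjI ballI)
    fix k assume k: "k \<in> {..<length \<phi>s}"
    then have "continuous_on UNIV (\<lambda>m. qf_eval m (\<phi>s ! k))"
      using Conn by (intro Conn.IH) (auto simp: list_all_iff)
    then show "continuous_map euclidean euclideanreal
        (\<lambda>m. (\<lambda>i\<in>{..<length \<phi>s}. map (qf_eval m) \<phi>s ! i) k)"
      using k by simp
  qed auto
  from continuous_map_compose[OF this u] show ?case
    by (simp add: o_def)
qed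

lemma tendsto_qf_eval:
  assumes "qf_wf \<phi>" "\<And>p. p \<in> qf_atoms \<phi> \<Longrightarrow> (\<lambda>n. m n p) \<longlonglongrightarrow> l p"
  shows "(\<lambda>n. qf_eval (m n) \<phi>) \<longlonglongrightarrow> qf_eval l \<phi>"
proof -
  \<comment> \<open>Redefined as the limit outside the atoms, the assignments converge at every
    polynomial, with unchanged values of the formula.\<close>
  define m' where "m' n p = (if p \<in> qf_atoms \<phi> then m n p else l p)" for n p
  have "(\<lambda>n. m' n p) \<longlonglongrightarrow> l p" for p
    using assms(2) by (cases "p \<in> qf_atoms \<phi>") (simp_all add: m'_def)
  then have "m' \<longlonglongrightarrow> l"
    unfolding limitin_canonical_iff[symmetric] euclidean_product_topology[symmetric]
    by (simp add: limitin_componentwise)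
  then have "(\<lambda>n. qf_eval (m' n) \<phi>) \<longlonglongrightarrow> qf_eval l \<phi>"
    using continuous_on_tendsto_compose[OF continuous_qf_eval[OF assms(1)]] by simp
  moreover have "qf_eval (m' n) \<phi> = qf_eval (m n) \<phi>" for n
    by (rule qf_eval_cong) (simp add: m'_def)
  ultimately show ?thesis by simp
qed

text \<open>The assignments bounded by \<open>N\<close> range over a product of discs, compact by
  Tychonoff. This makes the infima of the theorem infima of sets bounded below.\<close>

lemma qf_eval_bounded:
  assumes "qf_wf \<phi>"
  obtains K where "\<And>m. (\<And>p. p \<in> qf_atoms \<phi> \<Longrightarrow> cmod (m p) \<le> N p) \<Longrightarrow> \<bar>qf_eval m \<phi>\<bar> \<le> K"
proof -
  define S where "S = PiE UNIV (\<lambda>p. cball (0::complex) \<bar>N p\<bar>)"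
  have "compactin (product_topology (\<lambda>_. euclidean) UNIV) S"
    unfolding S_def by (subst compactin_PiE) simp
  then have "compact S"
    by (simp add: euclidean_product_topology compactin_euclidean_iff)
  then have "compact ((\<lambda>m. qf_eval m \<phi>) ` S)"
    using continuous_qf_eval[OF assms] continuous_on_subset by (intro compact_continuous_image) auto
  then have "bounded ((\<lambda>m. qf_eval m \<phi>) ` S)"
    by (rule compact_imp_bounded)
  then obtain K where K: "\<And>m. m \<in> S \<Longrightarrow> \<bar>qf_eval m \<phi>\<bar> \<le> K"
    unfolding bounded_iff by auto
  have "\<bar>qf_eval m \<phi>\<bar> \<le> K" if "\<And>p. p \<in> qf_atoms \<phi> \<Longrightarrow> cmod (m p) \<le> N p" for m
  proof -
    have "(\<lambda>p. if p \<in> qf_atoms \<phi> then m p else 0) \<in> S"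
      using that by (fastforce simp: S_def)
    moreover have "qf_eval (\<lambda>p. if p \<in> qf_atoms \<phi> then m p else 0) \<phi> = qf_eval m \<phi>"
      by (rule qf_eval_cong) simp
    ultimately show ?thesis using K by metis
  qed
  then show ?thesis using that by blast
qed

section \<open>Balls and microstates\<close>

lemma ball_tuplesD:
  assumes "xs \<in> ball_tuples M rs"
  shows "length xs = length rs" "set xs \<subseteq> M" "\<And>i. i < length rs \<Longrightarrow> norm (xs ! i) \<le> rs ! i"
  using assms by (auto simp: ball_tuples_def list_all2_conv_all_nth in_set_conv_nth)

lemma ball_tuplesI:
  assumes "length xs = length rs" "\<And>i. i < length rs \<Longrightarrow> xs ! i \<in> M \<and> norm (xs ! i) \<le> rs ! i"
  shows "xs \<in> ball_tuples M rs"
  using assms by (auto simp: ball_tuples_def list_all2_conv_all_nth)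

text \<open>If no tuple of \<open>R\<close> realized the finitely many moments of \<open>xs\<close> up to \<open>\<epsilon>\<close>, the truncated
  \<open>\<epsilon> - \<Sum> distances\<close> would vanish identically on \<open>R\<close>, hence on \<open>M\<close>.\<close>

lemma microstates:
  assumes "tracial_vna R \<tau>" "is_model M \<sigma> (universal_theory R \<tau>)"
    and rs: "\<And>r. r \<in> set rs \<Longrightarrow> 0 < r" and xs: "xs \<in> ball_tuples M rs"
    and P: "finite P" "\<And>p. p \<in> P \<Longrightarrow> poly_vars p \<subseteq> {..<length rs}" and "0 < \<epsilon>"
  obtains ys where "ys \<in> ball_tuples R rs"
    "\<And>p. p \<in> P \<Longrightarrow> cmod (\<tau> (poly_eval ys p) - \<sigma> (poly_eval xs p)) < \<epsilon>"
proof -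
  interpret R: tracial_vna R \<tau> by fact
  obtain ps where ps: "set ps = P" using finite_list[OF P(1)] by blast
  define n where "n = length ps"
  define t where "t i = \<sigma> (poly_eval xs (ps ! i))" for i
  define \<phi>s where "\<phi>s = map ReTr ps @ map ImTr ps"
  \<comment> \<open>The first \<open>n\<close> arguments are real parts, the next \<open>n\<close>
    imaginary parts. The value is \<open>\<epsilon>\<close> at the target moments and 0 as soon as
    one moment is off by \<open>\<epsilon>\<close>.\<close>
  define u where "u z = max 0 (\<epsilon> - (\<Sum>i<n. \<bar>z i - Re (t i)\<bar> + \<bar>z (n + i) - Im (t i)\<bar>))"
    for z :: "nat \<Rightarrow> real"
  define \<psi> where "\<psi> = Conn u \<phi>s"
  have len: "length \<phi>s = n + n" by (simp add: \<phi>s_def n_def)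
  have eval: "qf_eval m \<psi> = max 0 (\<epsilon> - (\<Sum>i<n. \<bar>Re (m (ps ! i)) - Re (t i)\<bar> + \<bar>Im (m (ps ! i)) - Im (t i)\<bar>))" for m
    unfolding \<psi>_def qf_eval.simps u_def
    by (intro arg_cong[of _ _ "\<lambda>s. max 0 (\<epsilon> - s)"] sum.cong)
      (auto simp: \<phi>s_def n_def nth_append)
  have "continuous_map (powertop_real {..<n + n}) euclideanreal u"
    unfolding u_def
    by (intro continuous_map_real_max continuous_map_diff continuous_map_sum continuous_map_add
        continuous_map_real_abs continuous_map_product_projection continuous_map_canonical_const) auto
  then have wf: "qf_wf \<psi>"
    by (auto simp: \<psi>_def len \<phi>s_def list_all_iff n_def)
  have vars: "qf_vars \<psi> \<subseteq> {..<length rs}"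
    using P(2) ps by (fastforce simp: \<psi>_def \<phi>s_def)
  have nonneg: "qf_nonneg \<psi>"
    by (simp add: qf_nonneg_def eval)
  have cond: "(rs, \<psi>) \<in> universal_conditions"
    using rs wf vars nonneg by (simp add: universal_conditions_def)
  have "\<exists>ys\<in>ball_tuples R rs. \<forall>p\<in>P. cmod (\<tau> (poly_eval ys p) - \<sigma> (poly_eval xs p)) < \<epsilon>"
  proof (rule ccontr)
    assume no: "\<not> ?thesis"
    have zero: "qf_interp \<tau> \<psi> ys = 0" if ys: "ys \<in> ball_tuples R rs" for ys
    proof -
      obtain p where p: "p \<in> P" "\<epsilon> \<le> cmod (\<tau> (poly_eval ys p) - \<sigma> (poly_eval xs p))"
        using no ys not_le by blast
      then obtain j where j: "j < n" "p = ps ! j"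
        using ps by (auto simp: n_def in_set_conv_nth)
      define z where "z i = \<tau> (poly_eval ys (ps ! i)) - t i" for i
      have "\<epsilon> \<le> cmod (z j)" using p j by (simp add: z_def t_def)
      also have "\<dots> \<le> \<bar>Re (z j)\<bar> + \<bar>Im (z j)\<bar>" by (rule cmod_le)
      also have "\<dots> \<le> (\<Sum>i<n. \<bar>Re (z i)\<bar> + \<bar>Im (z i)\<bar>)"
        using j by (intro member_le_sum) auto
      finally show ?thesis by (simp add: qf_interp_def eval z_def)
    qed
    have "map (\<lambda>_. 0) rs \<in> ball_tuples R rs"
      using rs by (intro ball_tuplesI) (auto simp: less_imp_le)
    then have "condition_true R \<tau> (rs, \<psi>)"
      by (auto simp: condition_true_def zero cong: SUP_cong_simp intro!: cSUP_const)
    then have "condition_true M \<sigma> (rs, \<psi>)"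
      using assms(2) cond by (auto simp: is_model_def universal_theory_def)
    then have sup: "(SUP xs\<in>ball_tuples M rs. qf_interp \<sigma> \<psi> xs) = 0"
      by (simp add: condition_true_def)
    \<comment> \<open>A real supremum is an upper bound only of sets bounded above; the truncation
      provides the bound.\<close>
    have "qf_interp \<sigma> \<psi> ys \<le> \<epsilon>" for ys
      using \<open>0 < \<epsilon>\<close> by (simp add: qf_interp_def eval sum_nonneg)
    then have "bdd_above ((\<lambda>xs. qf_interp \<sigma> \<psi> xs) ` ball_tuples M rs)"
      by (intro bdd_aboveI[where M = \<epsilon>]) auto
    from cSUP_upper[OF xs this] sup have "qf_interp \<sigma> \<psi> xs \<le> 0" by simp
    moreover have "qf_interp \<sigma> \<psi> xs = \<epsilon>"
      using \<open>0 < \<epsilon>\<close> by (simp add: qf_interp_def eval t_def)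
    ultimately show False using \<open>0 < \<epsilon>\<close> by simp
  qed
  then show ?thesis using that by blast
qed

section \<open>Transferring moments through a hyperfinite factor\<close>

context tracial_vna
begin

text \<open>Both defects have the trace \<open>1 - (tn V)\<^sup>2\<close>, and the square of the
  2-norm of a defect is at most its trace; hence the hypothesis with
  \<open>\<theta>\<^sup>2\<close>.\<close>

lemma tn_defect_le:
  assumes "V \<in> M" "norm V \<le> 1" "Re (\<tau> (\<one> - V \<cdot> V\<^sup>\<dagger>)) \<le> \<theta>\<^sup>2" "0 \<le> \<theta>"
  shows "tn (\<one> - V \<cdot> V\<^sup>\<dagger>) \<le> \<theta>" "tn (\<one> - V\<^sup>\<dagger> \<cdot> V) \<le> \<theta>"
proof -
  have le: "tn (\<one> - W \<cdot> W\<^sup>\<dagger>) \<le> \<theta>" if W: "W \<in> M" "norm W \<le> 1" "tn W = tn V" for W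
  proof (rule power2_le_imp_le)
    have trW: "\<tau> (W \<cdot> W\<^sup>\<dagger>) = complex_of_real ((tn V)\<^sup>2)" "\<tau> (V \<cdot> V\<^sup>\<dagger>) = complex_of_real ((tn V)\<^sup>2)"
      using W assms tr_square[of "W\<^sup>\<dagger>"] tr_square[of "V\<^sup>\<dagger>"] by simp_all
    have "tn (W \<cdot> W\<^sup>\<dagger>) \<le> tn V * 1"
      using W by (intro tn_times_right_le) auto
    then have "(tn (W \<cdot> W\<^sup>\<dagger>))\<^sup>2 \<le> (tn V)\<^sup>2"
      using W by (intro power_mono) auto
    moreover have "(tn (\<one> - W \<cdot> W\<^sup>\<dagger>))\<^sup>2 = 1 + (tn (W \<cdot> W\<^sup>\<dagger>))\<^sup>2 - 2 * (tn V)\<^sup>2"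
      using W by (subst tn_diff_power2) (simp_all add: trW)
    moreover have "1 - (tn V)\<^sup>2 \<le> \<theta>\<^sup>2"
      using assms(1,3) by (simp add: tr_diff trW)
    ultimately show "(tn (\<one> - W \<cdot> W\<^sup>\<dagger>))\<^sup>2 \<le> \<theta>\<^sup>2" by linarith
  qed fact
  show "tn (\<one> - V \<cdot> V\<^sup>\<dagger>) \<le> \<theta>" "tn (\<one> - V\<^sup>\<dagger> \<cdot> V) \<le> \<theta>"
    using le[of V] le[of "V\<^sup>\<dagger>"] assms by simp_all
qed

lemma hyperfinite_approx:
  assumes "hyperfinite M \<tau>" "set a \<subseteq> M" "0 < \<theta>"
  obtains B s where "unital_star_subalgebra B" "finite_dim B" "B \<subseteq> M"
    "\<And>j. j < length a \<Longrightarrow> s j \<in> B \<and> tn (a ! j - s j) < \<theta>"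
proof -
  obtain B :: "nat \<Rightarrow> ('a \<Rightarrow>\<^sub>L 'a) set" where
    B: "\<And>n. unital_star_subalgebra (B n) \<and> finite_dim (B n) \<and> B n \<subseteq> M \<and> B n \<subseteq> B (Suc n)"
    and dense: "\<And>T \<epsilon>. T \<in> M \<Longrightarrow> \<epsilon> > 0 \<Longrightarrow> \<exists>n. \<exists>S\<in>B n. tn (T - S) < \<epsilon>"
    using assms(1) unfolding hyperfinite_def by blast
  have mono: "B m \<subseteq> B n" if "m \<le> n" for m n
    by (rule lift_Suc_mono_le[of B]) (use B that in blast)+
  have "\<exists>n S. j < length a \<longrightarrow> S \<in> B n \<and> tn (a ! j - S) < \<theta>" for j
  proof (cases "j < length a")
    case True
    then have "a ! j \<in> M" using assms(2) nth_mem by blast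
    from dense[OF this assms(3)] show ?thesis by blast
  qed blast
  then obtain n s where ns: "\<And>j. j < length a \<Longrightarrow> s j \<in> B (n j) \<and> tn (a ! j - s j) < \<theta>"
    by metis
  \<comment> \<open>The sum serves as an upper bound for the finitely many indices.\<close>
  define m where "m = (\<Sum>j<length a. n j)"
  have "s j \<in> B m \<and> tn (a ! j - s j) < \<theta>" if "j < length a" for j
  proof -
    have "n j \<le> m" unfolding m_def using that by (intro member_le_sum) auto
    then show ?thesis using ns[OF that] mono by blast
  qed
  then show ?thesis using that[of "B m" s] B by blast
qed

lemma finite_dim_closed_frame:
  assumes B: "unital_star_subalgebra B" "B \<subseteq> M" "finite_dim B"
  shows "\<exists>d r e. 1 \<le> r \<and> closed_frame d r e \<and>
    (\<forall>b\<in>B. b = (\<Sum>i<d. scalar_op (\<tau> (e i \<cdot> b)) \<cdot> e i))"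
proof -
  obtain d and e :: "nat \<Rightarrow> ('a \<Rightarrow>\<^sub>L 'a)" where e': "\<forall>i<d. e i \<in> B \<and> (e i)\<^sup>\<dagger> = e i"
    and exp': "\<forall>b\<in>B. b = (\<Sum>i<d. scalar_op (\<tau> (e i \<cdot> b)) \<cdot> e i)"
    using finite_dim_basis[OF B] by (elim exE conjE)
  have e: "e i \<in> B" "(e i)\<^sup>\<dagger> = e i" if "i < d" for i
    using e' that by auto
  note exp = bspec[OF exp']
  \<comment> \<open>The summand 1 makes \<open>r\<close> an admissible, positive radius even for an
    empty basis.\<close>
  define r where "r = 1 + (\<Sum>i<d. norm (e i))"
  have r: "norm (e i) \<le> r" if "i < d" for i
    using member_le_sum[of i "{..<d}" "\<lambda>i. norm (e i)"] that by (simp add: r_def)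
  have "\<one> \<in> B"
    using B(1) scalar_op_1 unfolding unital_star_subalgebra_def by (metis rangeI subsetD)
  then have "\<one> = (\<Sum>i<d. scalar_op (\<tau> (e i)) \<cdot> e i)"
    using exp[of \<one>] by simp
  moreover have "e j \<cdot> e k = (\<Sum>i<d. scalar_op (\<tau> (e i \<cdot> (e j \<cdot> e k))) \<cdot> e i)" if "j < d" "k < d" for j k
    using e(1) that B(1) by (intro exp) (simp add: unital_star_subalgebra_def)
  ultimately have "closed_frame d r e"
    using e r B(2) unfolding closed_frame_def frame_def by blast
  moreover have "1 \<le> r" by (simp add: r_def sum_nonneg)
  ultimately show ?thesis using exp' by (intro exI conjI)
qed

end

text \<open>The tuple \<open>(b, a)\<close> is completed by a basis of a finite-dimensional algebra that nearly contains
  \<open>a\<close>. The copy of this basis among the microstates is conjugated back onto the basis by an approximate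
  unitary, which then also moves the microstates of \<open>a\<close> back to \<open>a\<close>.\<close>

lemma (in tracial_embedding) approximate_moments:
  assumes "factor N" "hyperfinite N \<tau>" "is_model M \<sigma> (universal_theory N \<tau>)"
    and rs: "\<And>r. r \<in> set rs \<Longrightarrow> 0 < r" and b: "b \<in> ball_tuples M rs" and a: "set a \<subseteq> N"
    and P: "finite P" "\<And>p. p \<in> P \<Longrightarrow> poly_vars p \<subseteq> {..<length rs + length a}" and \<epsilon>: "0 < \<epsilon>"
  obtains c where "c \<in> ball_tuples N rs"
    "\<And>p. p \<in> P \<Longrightarrow> cmod (\<tau> (poly_eval (c @ a) p) - \<sigma> (poly_eval (b @ map \<iota> a) p)) < \<epsilon>"
proof -
  define n where "n = length rs"
  define l where "l = length a"
  \<comment> \<open>Bounds \<open>a\<close>, the new tuple and their microstates at once; the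
    summand 1 allows for the enlarged radii given to \<open>a\<close> below.\<close>
  define C0 where "C0 = 1 + (\<Sum>j<l. norm (a ! j)) + (\<Sum>i<n. rs ! i)"
  have rs_nonneg: "0 \<le> rs ! i" if "i < n" for i
    using rs[of "rs ! i"] that by (simp add: n_def)
  have C0_a: "norm (a ! j) + 1 \<le> C0" if "j < l" for j
    using member_le_sum[of j "{..<l}" "\<lambda>j. norm (a ! j)"] that sum_nonneg[of "{..<n}" "\<lambda>i. rs ! i"]
      rs_nonneg by (simp add: C0_def)
  have C0_rs: "rs ! i \<le> C0" if "i < n" for i
    using member_le_sum[of i "{..<n}" "\<lambda>i. rs ! i"] that sum_nonneg[of "{..<l}" "\<lambda>j. norm (a ! j)"]
      rs_nonneg by (simp add: C0_def)
  obtain K where K: "\<And>p xs ys V \<theta>. N.approx_conjugate C0 \<theta> V xs ys \<Longrightarrow> poly_vars p \<subseteq> {..<length xs} \<Longrightarrow>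
      cmod (\<tau> (poly_eval xs p) - \<tau> (poly_eval ys p)) \<le> K p * \<theta>"
    using N.poly_trace_approx_conjugate[of C0] by metis
  define S where "S = 1 + (\<Sum>p\<in>P. \<bar>K p\<bar>)"
  have S: "1 \<le> S" by (simp add: S_def sum_nonneg)
  \<comment> \<open>Conjugation by \<open>V\<close> may use up one half of
    \<open>\<epsilon>\<close>; the other half is left to the microstates.\<close>
  define \<theta> where "\<theta> = \<epsilon> / (2 * S)"
  have \<theta>: "0 < \<theta>" using \<epsilon> S by (simp add: \<theta>_def)
  have K\<theta>: "K p * \<theta> < \<epsilon> / 2" if "p \<in> P" for p
  proof -
    have "K p < S"
      using member_le_sum[of p P "\<lambda>p. \<bar>K p\<bar>"] P(1) that by (simp add: S_def)
    then have "K p * \<theta> < S * \<theta>" using \<theta> by simp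
    then show ?thesis using S by (simp add: \<theta>_def)
  qed
  obtain B s where B: "unital_star_subalgebra B" "finite_dim B" "B \<subseteq> N"
    and s: "\<And>j. j < l \<Longrightarrow> s j \<in> B \<and> N.tn (a ! j - s j) < \<theta> / 6"
    using N.hyperfinite_approx[OF assms(2) a, of "\<theta> / 6"] \<theta> by (auto simp: l_def)
  obtain d r and e :: "nat \<Rightarrow> ('a \<Rightarrow>\<^sub>L 'a)" where r: "1 \<le> r" and e: "N.closed_frame d r e"
    and exp: "\<forall>b\<in>B. b = (\<Sum>i<d. scalar_op (\<tau> (e i \<cdot> b)) \<cdot> e i)"
    using N.finite_dim_closed_frame[OF B(1,3,2)] by (elim exE conjE)
  have eF: "N.frame d r e" using e by (simp add: N.closed_frame_def)
  note eM = N.frameD[OF eF]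
  define c where "c j k = \<tau> (e k \<cdot> s j)" for j k
  have s_eq: "s j = (\<Sum>k<d. scalar_op (c j k) \<cdot> e k)" if "j < l" for j
    unfolding c_def by (rule bspec[OF exp]) (use s[OF that] in blast)
  define Sn where "Sn = 1 + (\<Sum>j<l. norm (s j))"
  have Sn: "1 \<le> Sn" by (simp add: Sn_def sum_nonneg)
  have Sn_le: "norm (s j) \<le> Sn" if "j < l" for j
    using member_le_sum[of j "{..<l}" "\<lambda>j. norm (s j)"] that by (simp add: Sn_def)
  define Cc where "Cc = 1 + (\<Sum>j<l. \<Sum>k<d. cmod (c j k))"
  have Cc: "1 \<le> Cc" by (simp add: Cc_def sum_nonneg)
  have Cc_le: "(\<Sum>k<d. cmod (c j k)) \<le> Cc" if "j < l" for j
    using member_le_sum[of j "{..<l}" "\<lambda>j. \<Sum>k<d. cmod (c j k)"] that by (simp add: Cc_def sum_nonneg)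
  \<comment> \<open>Budget for the distance of \<open>a ! j\<close> from its conjugated microstate:
    \<open>\<theta> / 6\<close> for passing to \<open>s j\<close>, \<open>\<theta> / 4\<close> for
    the defect of \<open>V\<close> next to \<open>s j\<close>, \<open>\<theta> / 4\<close> for the
    intertwining errors weighted by the coordinates, and \<open>\<theta> / 3\<close> for the
    microstates. The sum is \<open>\<theta>\<close>.\<close>
  define \<theta>2 where "\<theta>2 = \<theta> / (4 * Sn)"
  have \<theta>2: "0 < \<theta>2" "\<theta>2 \<le> \<theta>" "Sn * \<theta>2 = \<theta> / 4"
    using \<theta> Sn by (simp_all add: \<theta>2_def field_simps)
  define \<eta> where "\<eta> = \<theta> / (4 * Cc)"
  have \<eta>: "0 < \<eta>" "Cc * \<eta> = \<theta> / 4"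
    using \<theta> Cc by (simp_all add: \<eta>_def)
  have "0 \<le> r" "0 < \<theta>2\<^sup>2" using r \<theta>2 by simp_all
  from N.approx_intertwiner[OF assms(1) e this \<eta>(1)] obtain \<delta> where \<delta>: "0 < \<delta>"
    and intertwiner: "\<And>f. N.frame d r f \<Longrightarrow> N.approx_copy d e f \<delta> \<Longrightarrow>
      \<exists>V\<in>N. norm V \<le> 1 \<and> (\<forall>k<d. N.tn (e k \<cdot> V - V \<cdot> f k) \<le> \<eta>) \<and> Re (\<tau> (\<one> - V \<cdot> V\<^sup>\<dagger>)) \<le> \<theta>2\<^sup>2"
    by blast
  \<comment> \<open>\<open>\<delta>\<close> serves the traces of the copy,
    \<open>\<delta>\<^sup>2\<close> the squared 2-norms of its relations,
    \<open>(\<theta> / 6)\<^sup>2\<close> the squared distances of \<open>a\<close>, and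
    \<open>\<epsilon> / 2\<close> the moments in \<open>P\<close>.\<close>
  define \<mu> where "\<mu> = min (min \<delta> (\<delta>\<^sup>2)) (min ((\<theta> / 6)\<^sup>2) (\<epsilon> / 2))"
  have \<mu>: "0 < \<mu>" "\<mu> \<le> \<delta>" "\<mu> \<le> \<delta>\<^sup>2" "\<mu> \<le> (\<theta> / 6)\<^sup>2" "\<mu> \<le> \<epsilon> / 2"
    using \<delta> \<theta> \<epsilon> by (auto simp: \<mu>_def)

  \<comment> \<open>\<open>h\<close> takes the self-adjoint part, as the microstate of a
    self-adjoint element need not be self-adjoint. At the original tuple \<open>q\<close> vanishes
    and \<open>g j\<close> becomes the image of \<open>a ! j - s j\<close>; \<open>sq\<close>
    expresses their 2-norms as moments.\<close>
  define h where "h i = Times (Scalar (1/2)) (Plus (Var (n + l + i)) (Star (Var (n + l + i))))" for i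
  define q where "q j k = Plus (poly_sum d (\<lambda>i. Times (Scalar (\<tau> (e i \<cdot> (e j \<cdot> e k)))) (h i)))
      (Times (Scalar (-1)) (Times (h j) (h k)))" for j k
  define g where "g j = Plus (Var (n + j)) (Times (Scalar (-1)) (poly_sum d (\<lambda>k. Times (Scalar (c j k)) (h k))))" for j
  define sq where "sq p = Times (Star p) p" for p
  define PP where "PP = P \<union> h ` {..<d} \<union> (\<lambda>(j, k). sq (q j k)) ` ({..<d} \<times> {..<d}) \<union> (\<lambda>j. sq (g j)) ` {..<l}"
  \<comment> \<open>The summand 1 keeps the radius positive when an entry of \<open>a\<close> is
    0.\<close>
  define rs' where "rs' = rs @ map (\<lambda>x. norm x + 1) a @ replicate d r"
  define xs where "xs = b @ map \<iota> a @ map (\<lambda>i. \<iota> (e i)) [0..<d]"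
  have len_rs': "length rs' = n + l + d" by (simp add: rs'_def n_def l_def)
  have len_b: "length b = n" using ball_tuplesD(1)[OF b] by (simp add: n_def)
  have xs_ball: "xs \<in> ball_tuples M rs'"
    unfolding ball_tuples_def xs_def rs'_def
  proof (intro CollectI list_all2_appendI)
    show "list_all2 (\<lambda>x r. x \<in> M \<and> norm x \<le> r) b rs"
      using b by (simp add: ball_tuples_def)
    show "list_all2 (\<lambda>x r. x \<in> M \<and> norm x \<le> r) (map \<iota> a) (map (\<lambda>x. norm x + 1) a)"
    proof -
      have "\<iota> x \<in> M \<and> norm (\<iota> x) \<le> norm x + 1" if "x \<in> set a" for x
        using a that emb_mem[of x] emb_norm[of x] by auto
      then show ?thesis by (simp add: list.rel_map list_all2_same)
    qed
    show "list_all2 (\<lambda>x r. x \<in> M \<and> norm x \<le> r) (map (\<lambda>i. \<iota> (e i)) [0..<d]) (replicate d r)"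
      using order_trans[OF emb_norm[OF eM(1)] eM(3)] emb_mem[OF eM(1)]
      by (simp add: list_all2_conv_all_nth)
  qed
  have rs'_pos: "0 < t" if "t \<in> set rs'" for t
    using that rs r by (auto simp: rs'_def add_nonneg_pos)
  have PP_fin: "finite PP"
    using P(1) by (simp add: PP_def)
  have PP_vars: "poly_vars p \<subseteq> {..<length rs'}" if "p \<in> PP" for p
    using that P(2) unfolding PP_def len_rs'
    by (fastforce simp: sq_def q_def g_def h_def poly_vars_sum n_def l_def)
  obtain ys where ys: "ys \<in> ball_tuples N rs'"
    and close: "\<And>p. p \<in> PP \<Longrightarrow> cmod (\<tau> (poly_eval ys p) - \<sigma> (poly_eval xs p)) < \<mu>"
    using microstates[OF N.tracial_vna_axioms assms(3) rs'_pos xs_ball PP_fin PP_vars \<mu>(1)] by blast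
  have len_ys: "length ys = n + l + d" using ball_tuplesD(1)[OF ys] len_rs' by simp
  have ysN: "set ys \<subseteq> N" using ball_tuplesD(2)[OF ys] .
  have ys_nth: "ys ! i \<in> N" if "i < n + l + d" for i
    using ysN that len_ys nth_mem by (metis subsetD)
  have ys_norm: "norm (ys ! i) \<le> rs' ! i" if "i < n + l + d" for i
    using ball_tuplesD(3)[OF ys] that len_rs' by simp

  define f where "f i = (1/2) *\<^sub>R (ys ! (n + l + i) + (ys ! (n + l + i))\<^sup>\<dagger>)" for i
  have f: "N.frame d r f"
    unfolding N.frame_def
  proof (intro allI impI conjI)
    fix i assume i: "i < d"
    define y where "y = ys ! (n + l + i)"
    have y: "y \<in> N" "norm y \<le> r"
      using ys_nth[of "n + l + i"] ys_norm[of "n + l + i"] i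
      by (simp_all add: y_def rs'_def nth_append n_def l_def)
    show "f i \<in> N" "(f i)\<^sup>\<dagger> = f i"
      unfolding f_def y_def[symmetric] using y by (simp_all add: N.adj_simps add.commute)
    have "norm (f i) = norm (y + y\<^sup>\<dagger>) / 2"
      unfolding f_def y_def[symmetric] by simp
    also have "\<dots> \<le> r"
      using norm_triangle_ineq[of y "y\<^sup>\<dagger>"] y by simp
    finally show "norm (f i) \<le> r" .
  qed
  note fM = N.frameD[OF f]
  have half: "scalar_op (1/2) \<cdot> T = (1/2) *\<^sub>R T" for T :: "'c::complex_hilbert \<Rightarrow>\<^sub>L 'c"
    using scaleR_op_eq[of "1/2" T] by simp
  have neg: "scalar_op (-1) \<cdot> T = - T" for T :: "'c::complex_hilbert \<Rightarrow>\<^sub>L 'c"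
    by (simp add: scalar_op_minus op_distrib)
  have h_ys: "poly_eval ys (h i) = f i" for i
    by (simp add: h_def f_def half)
  have h_xs: "poly_eval xs (h i) = \<iota> (e i)" if "i < d" for i
  proof -
    have "xs ! (n + l + i) = \<iota> (e i)"
      using that by (simp add: xs_def nth_append len_b l_def)
    moreover have "(\<iota> (e i))\<^sup>\<dagger> = \<iota> (e i)"
      using eM[OF that] emb_adj by metis
    ultimately show ?thesis by (simp add: h_def half flip: scaleR_2)
  qed
  have q_ys: "poly_eval ys (q j k) = (\<Sum>i<d. scalar_op (\<tau> (e i \<cdot> (e j \<cdot> e k))) \<cdot> f i) - f j \<cdot> f k" for j k
    by (simp add: q_def poly_eval_sum h_ys neg)
  have q_xs: "poly_eval xs (q j k) = 0" if "j < d" "k < d" for j k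
  proof -
    have "poly_eval xs (q j k) = (\<Sum>i<d. scalar_op (\<tau> (e i \<cdot> (e j \<cdot> e k))) \<cdot> \<iota> (e i)) - \<iota> (e j \<cdot> e k)"
      using that eM by (simp add: q_def poly_eval_sum h_xs neg emb_times)
    also have "(\<Sum>i<d. scalar_op (\<tau> (e i \<cdot> (e j \<cdot> e k))) \<cdot> \<iota> (e i))
        = \<iota> (\<Sum>i<d. scalar_op (\<tau> (e i \<cdot> (e j \<cdot> e k))) \<cdot> e i)"
      using eM by (subst emb_sum) (auto simp: emb_times emb_scalar)
    also have "(\<Sum>i<d. scalar_op (\<tau> (e i \<cdot> (e j \<cdot> e k))) \<cdot> e i) = e j \<cdot> e k"
      using N.closed_frame_product[OF e that] by (rule sym)
    finally show ?thesis by simp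
  qed
  have copy: "N.approx_copy d e f \<delta>"
    unfolding N.approx_copy_def
  proof (intro conjI allI impI)
    fix i assume i: "i < d"
    then have "cmod (\<tau> (f i) - \<tau> (e i)) < \<mu>"
      using close[of "h i"] eM by (simp add: PP_def h_ys h_xs emb_tr)
    then show "cmod (\<tau> (e i) - \<tau> (f i)) \<le> \<delta>"
      using \<mu>(2) by (simp add: norm_minus_commute)
  next
    fix j k assume jk: "j < d" "k < d"
    define Q where "Q = (\<Sum>i<d. scalar_op (\<tau> (e i \<cdot> (e j \<cdot> e k))) \<cdot> f i) - f j \<cdot> f k"
    have Q: "Q \<in> N"
      using fM jk by (auto simp: Q_def intro!: N.diff_mem N.sum_mem N.times_mem)
    have "sq (q j k) \<in> PP" using jk by (auto simp: PP_def)
    from close[OF this] have "cmod (\<tau> (Q\<^sup>\<dagger> \<cdot> Q)) < \<mu>"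
      using jk by (simp add: sq_def q_ys q_xs M.tr_zero op_distrib flip: Q_def)
    then have "(N.tn Q)\<^sup>2 \<le> \<delta>\<^sup>2"
      using \<mu>(3) Q by (simp add: N.tr_square norm_power)
    then show "N.tn Q \<le> \<delta>"
      using \<delta> by - (rule power2_le_imp_le, auto)
  qed
  obtain V where V: "V \<in> N" "norm V \<le> 1" "\<And>k. k < d \<Longrightarrow> N.tn (e k \<cdot> V - V \<cdot> f k) \<le> \<eta>"
    "Re (\<tau> (\<one> - V \<cdot> V\<^sup>\<dagger>)) \<le> \<theta>2\<^sup>2"
    using intertwiner[OF f copy] by blast
  have V_adj: "norm (V\<^sup>\<dagger>) \<le> 1" using V by simp
  have defect: "N.tn (\<one> - V \<cdot> V\<^sup>\<dagger>) \<le> \<theta>2" "N.tn (\<one> - V\<^sup>\<dagger> \<cdot> V) \<le> \<theta>2"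
    using N.tn_defect_le[OF V(1,2,4)] \<theta>2(1) by auto

  have a_mem: "a ! j \<in> N" if "j < l" for j
    using a that by (metis l_def nth_mem subsetD)
  have s_mem: "s j \<in> N" if "j < l" for j
    using s[OF that] B(3) by blast
  have G_le: "N.tn (ys ! (n + j) - (\<Sum>k<d. scalar_op (c j k) \<cdot> f k)) \<le> \<theta> / 3" if j: "j < l" for j
  proof -
    define G where "G = ys ! (n + j) - (\<Sum>k<d. scalar_op (c j k) \<cdot> f k)"
    have G: "G \<in> N" "poly_eval ys (g j) = G"
      using fM ys_nth[of "n + j"] j
      by (auto simp: G_def g_def poly_eval_sum h_ys neg intro!: N.diff_mem N.sum_mem N.times_mem)
    have "xs ! (n + j) = \<iota> (a ! j)"
      using j by (simp add: xs_def nth_append len_b l_def)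
    then have "poly_eval xs (g j) = \<iota> (a ! j) - (\<Sum>k<d. scalar_op (c j k) \<cdot> \<iota> (e k))"
      by (simp add: g_def poly_eval_sum h_xs neg)
    also have "(\<Sum>k<d. scalar_op (c j k) \<cdot> \<iota> (e k)) = \<iota> (s j)"
      using eM unfolding s_eq[OF j] by (subst emb_sum) (auto simp: emb_times emb_scalar)
    also have "\<iota> (a ! j) - \<iota> (s j) = \<iota> (a ! j - s j)"
      using a_mem s_mem j by (simp add: emb_diff)
    finally have g_xs: "poly_eval xs (g j) = \<iota> (a ! j - s j)" .
    have "\<sigma> (poly_eval xs (sq (g j))) = \<tau> ((a ! j - s j)\<^sup>\<dagger> \<cdot> (a ! j - s j))"
      using a_mem s_mem j by (simp add: sq_def g_xs emb_adj[symmetric] emb_times[symmetric] emb_tr)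
    also have "\<dots> = complex_of_real ((N.tn (a ! j - s j))\<^sup>2)"
      using a_mem s_mem j by (intro N.tr_square) auto
    finally have sx: "\<sigma> (poly_eval xs (sq (g j))) = complex_of_real ((N.tn (a ! j - s j))\<^sup>2)" .
    have sy: "\<tau> (poly_eval ys (sq (g j))) = complex_of_real ((N.tn G)\<^sup>2)"
      using G by (simp add: sq_def N.tr_square)
    have "sq (g j) \<in> PP" using j by (auto simp: PP_def)
    from close[OF this] have "\<bar>(N.tn G)\<^sup>2 - (N.tn (a ! j - s j))\<^sup>2\<bar> < \<mu>"
      unfolding sx sy by (metis norm_of_real of_real_diff)
    moreover have "(N.tn (a ! j - s j))\<^sup>2 \<le> (\<theta> / 6)\<^sup>2"
      using s[OF j] a_mem s_mem j by (intro power_mono) auto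
    moreover have "(\<theta> / 6)\<^sup>2 + (\<theta> / 6)\<^sup>2 \<le> (\<theta> / 3)\<^sup>2"
      by (simp add: power2_eq_square)
    ultimately have "(N.tn G)\<^sup>2 \<le> (\<theta> / 3)\<^sup>2"
      using \<mu>(4) by linarith
    then show ?thesis
      using \<theta> unfolding G_def[symmetric] by - (rule power2_le_imp_le, auto)
  qed
  have a_close: "N.tn (a ! j - V \<cdot> ys ! (n + j) \<cdot> V\<^sup>\<dagger>) \<le> \<theta>" if j: "j < l" for j
  proof -
    define G where "G = ys ! (n + j) - (\<Sum>k<d. scalar_op (c j k) \<cdot> f k)"
    define X where "X = (\<Sum>k<d. scalar_op (c j k) \<cdot> (e k \<cdot> V - V \<cdot> f k))"
    have y: "ys ! (n + j) \<in> N" using ys_nth[of "n + j"] j by simp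
    have G: "G \<in> N"
      using fM y by (auto simp: G_def intro!: N.diff_mem N.sum_mem N.times_mem)
    have X: "X \<in> N"
      using fM eM V(1) by (auto simp: X_def intro!: N.diff_mem N.sum_mem N.times_mem)
    have "X = (\<Sum>k<d. scalar_op (c j k) \<cdot> e k \<cdot> V) - (\<Sum>k<d. V \<cdot> (scalar_op (c j k) \<cdot> f k))"
      using V(1) by (simp add: X_def op_distrib sum_subtractf op_times_assoc N.scalar_op_left)
    also have "\<dots> = s j \<cdot> V - V \<cdot> (ys ! (n + j) - G)"
      by (simp add: s_eq[OF j] G_def op_sum)
    finally have X_eq: "X = s j \<cdot> V - V \<cdot> (ys ! (n + j) - G)" .
    \<comment> \<open>\<open>a ! j\<close> is replaced by \<open>s j\<close>, then
      \<open>V \<cdot> V\<^sup>\<dagger>\<close> is inserted, \<open>s j\<close> is carried across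
      \<open>V\<close> at the cost of \<open>X\<close>, and its counterpart in terms of
      \<open>f\<close> is replaced by the microstate at the cost of \<open>G\<close>.\<close>
    have "a ! j - V \<cdot> ys ! (n + j) \<cdot> V\<^sup>\<dagger>
        = ((a ! j - s j) + s j \<cdot> (\<one> - V \<cdot> V\<^sup>\<dagger>)) + (X \<cdot> V\<^sup>\<dagger> - V \<cdot> G \<cdot> V\<^sup>\<dagger>)"
      unfolding X_eq by (simp add: op_distrib op_times_assoc)
    also have "N.tn \<dots> \<le> (\<theta> / 6 + Sn * \<theta>2) + (Cc * \<eta> * 1 + 1 * (\<theta> / 3) * 1)"
    proof (rule order_trans[OF N.tn_triangle add_mono[OF
            order_trans[OF N.tn_triangle add_mono] order_trans[OF N.tn_triangle_diff add_mono]]])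
      show "N.tn (a ! j - s j) \<le> \<theta> / 6" using s[OF j] by simp
      show "N.tn (s j \<cdot> (\<one> - V \<cdot> V\<^sup>\<dagger>)) \<le> Sn * \<theta>2"
        using s_mem[OF j] V(1) Sn_le[OF j] defect(1) by (intro N.tn_times_left_le) auto
      have "N.tn X \<le> (\<Sum>k<d. N.tn (scalar_op (c j k) \<cdot> (e k \<cdot> V - V \<cdot> f k)))"
        unfolding X_def using fM eM V(1) by (intro N.tn_sum) auto
      also have "\<dots> \<le> (\<Sum>k<d. cmod (c j k) * \<eta>)"
        using fM eM V(1,3) by (intro sum_mono) (simp add: N.tn_scalar mult_left_mono)
      also have "\<dots> \<le> Cc * \<eta>"
        unfolding sum_distrib_right[symmetric] using Cc_le[OF j] \<eta>(1) by (intro mult_right_mono) auto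
      finally show "N.tn (X \<cdot> V\<^sup>\<dagger>) \<le> Cc * \<eta> * 1"
        using X V(1) V_adj by (intro N.tn_times_right_le) auto
      have "N.tn (V \<cdot> G) \<le> 1 * (\<theta> / 3)"
        using G V G_le[OF j] by (intro N.tn_times_left_le) (auto simp: G_def)
      then show "N.tn (V \<cdot> G \<cdot> V\<^sup>\<dagger>) \<le> 1 * (\<theta> / 3) * 1"
        by (rule N.tn_times_right_le[rotated 2]) (use G V(1) V_adj in auto)
    qed (use a_mem[OF j] s_mem[OF j] V(1) X G in auto)
    also have "\<dots> = \<theta>"
      unfolding \<theta>2(3) \<eta>(2) by simp
    finally show ?thesis .
  qed

  define b' where "b' = take n ys"
  define a' where "a' = take l (drop n ys)"
  \<comment> \<open>Conjugation by a contraction does not increase norms, so the sorts of the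
    variables are respected exactly.\<close>
  define cs where "cs = map (\<lambda>x. V \<cdot> x \<cdot> V\<^sup>\<dagger>) b'"
  have len: "length b' = n" "length a' = l" "length cs = n"
    by (simp_all add: b'_def a'_def cs_def len_ys)
  have a'_nth: "a' ! j = ys ! (n + j)" if "j < l" for j
    using that by (simp add: a'_def len_ys)
  have b'_nth: "b' ! i = ys ! i" if "i < n" for i
    using that by (simp add: b'_def)
  have ys_split: "ys = (b' @ a') @ drop l (drop n ys)"
    by (simp add: b'_def a'_def del: drop_drop)
  have cs_nth: "cs ! i \<in> N" "norm (cs ! i) \<le> rs ! i" if i: "i < n" for i
  proof -
    have y: "ys ! i \<in> N" "norm (ys ! i) \<le> rs ! i"
      using ys_nth[of i] ys_norm[of i] i by (simp_all add: rs'_def nth_append n_def)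
    have eq: "cs ! i = V \<cdot> ys ! i \<cdot> V\<^sup>\<dagger>"
      using i len by (simp add: cs_def b'_nth)
    show "cs ! i \<in> N" using y V(1) by (simp add: eq)
    have "norm (cs ! i) \<le> 1 * rs ! i * 1"
      unfolding eq using y V V_adj by (intro N.norm_times_le) auto
    then show "norm (cs ! i) \<le> rs ! i" by simp
  qed
  have cs_ball: "cs \<in> ball_tuples N rs"
    using cs_nth len by (intro ball_tuplesI) (auto simp: n_def)
  have conj: "N.approx_conjugate C0 \<theta> V (cs @ a) (b' @ a')"
    unfolding N.approx_conjugate_def
  proof (intro conjI ballI allI impI)
    show "V \<in> N" "norm V \<le> 1" by fact+
    show "N.tn (\<one> - V \<cdot> V\<^sup>\<dagger>) \<le> \<theta>" "N.tn (\<one> - V\<^sup>\<dagger> \<cdot> V) \<le> \<theta>"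
      using defect \<theta>2(2) by linarith+
    show "length (cs @ a) = length (b' @ a')" using len by (simp add: l_def)
    show "set (cs @ a) \<subseteq> N" using cs_ball ball_tuplesD(2) a by auto
    show "set (b' @ a') \<subseteq> N" using ysN ys_split by (metis Un_subset_iff set_append)
    show "norm x \<le> C0" if x: "x \<in> set (cs @ a) \<union> set (b' @ a')" for x
    proof -
      consider i where "i < n" "x = cs ! i" | j where "j < l" "x = a ! j"
        | i where "i < n" "x = ys ! i" | j where "j < l" "x = ys ! (n + j)"
        using x len a'_nth b'_nth by (auto simp: in_set_conv_nth l_def)
      then show ?thesis
      proof cases
        case 1
        then show ?thesis using cs_nth(2) C0_rs by (metis order_trans)
      next
        case 2
        then show ?thesis using C0_a[of j] by simp
      next
        case (3 i)
        then have "norm x \<le> rs ! i"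
          using ys_norm[of i] by (simp add: rs'_def nth_append n_def)
        then show ?thesis using C0_rs[OF 3(1)] by simp
      next
        case (4 j)
        then have "norm x \<le> norm (a ! j) + 1"
          using ys_norm[of "n + j"] by (simp add: rs'_def nth_append n_def l_def)
        then show ?thesis using C0_a[OF 4(1)] by simp
      qed
    qed
    fix i assume i: "i < length (cs @ a)"
    show "N.tn ((cs @ a) ! i - V \<cdot> (b' @ a') ! i \<cdot> V\<^sup>\<dagger>) \<le> \<theta>"
    proof (cases "i < n")
      case True
      then have "(cs @ a) ! i = V \<cdot> (b' @ a') ! i \<cdot> V\<^sup>\<dagger>"
        using len by (simp add: nth_append cs_def)
      then show ?thesis using \<theta> by simp
    next
      case False
      then obtain j where j: "i = n + j" "j < l"
        using i len by (metis add_diff_inverse_nat l_def length_append nat_add_left_cancel_less)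
      then show ?thesis
        using a_close[OF j(2)] len by (simp add: nth_append a'_nth)
    qed
  qed
  have "cmod (\<tau> (poly_eval (cs @ a) p) - \<sigma> (poly_eval (b @ map \<iota> a) p)) < \<epsilon>" if p: "p \<in> P" for p
  proof -
    have v: "poly_vars p \<subseteq> {..<n + l}" using P(2)[OF p] by (simp add: n_def l_def)
    have "poly_eval ys p = poly_eval (b' @ a') p"
      using v len poly_eval_append[of p "b' @ a'" "drop l (drop n ys)"] ys_split by simp
    moreover have "poly_eval xs p = poly_eval (b @ map \<iota> a) p"
      using v len_b poly_eval_append[of p "b @ map \<iota> a"] by (simp add: xs_def l_def)
    moreover have "cmod (\<tau> (poly_eval ys p) - \<sigma> (poly_eval xs p)) < \<mu>"
      using close p by (simp add: PP_def)
    ultimately have 1: "cmod (\<tau> (poly_eval (b' @ a') p) - \<sigma> (poly_eval (b @ map \<iota> a) p)) < \<epsilon> / 2"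
      using \<mu>(5) by simp
    have "cmod (\<tau> (poly_eval (cs @ a) p) - \<tau> (poly_eval (b' @ a') p)) \<le> K p * \<theta>"
      using v len by (intro K[OF conj]) (simp add: l_def)
    then have 2: "cmod (\<tau> (poly_eval (cs @ a) p) - \<tau> (poly_eval (b' @ a') p)) < \<epsilon> / 2"
      using K\<theta>[OF p] by simp
    show ?thesis
      using norm_diff_triangle_less[OF 2 1] by simp
  qed
  with cs_ball show ?thesis using that by blast
qed

text \<open>Tuples of \<open>N\<close> embed into the balls of \<open>M\<close> with the same value.
  Conversely a tuple of \<open>M\<close> is approximated in its finitely many moments with
  \<open>a\<close> fixed, and continuity of the formula carries this over to values.\<close>

lemma (in tracial_embedding) qf_inf_eq:
  assumes "factor N" "hyperfinite N \<tau>" "is_model M \<sigma> (universal_theory N \<tau>)"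
    and rs: "\<And>r. r \<in> set rs \<Longrightarrow> 0 < r" and a: "set a \<subseteq> N"
    and \<phi>: "qf_wf \<phi>" "qf_vars \<phi> \<subseteq> {..<length rs + length a}"
  shows "(INF c\<in>ball_tuples N rs. qf_interp \<tau> \<phi> (c @ a))
    = (INF b\<in>ball_tuples M rs. qf_interp \<sigma> \<phi> (b @ map \<iota> a))"
proof -
  have atoms: "poly_vars p \<subseteq> {..<length rs + length a}" if "p \<in> qf_atoms \<phi>" for p
    using qf_atoms_vars[OF that] \<phi>(2) by blast
  have emb: "map \<iota> c \<in> ball_tuples M rs"
    "qf_interp \<sigma> \<phi> (map \<iota> c @ map \<iota> a) = qf_interp \<tau> \<phi> (c @ a)" if c: "c \<in> ball_tuples N rs" for c
  proof -
    note cD = ball_tuplesD[OF c]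
    have cN: "c ! i \<in> N" if "i < length rs" for i
      using cD(1,2) that by (metis nth_mem subsetD)
    show "map \<iota> c \<in> ball_tuples M rs"
      using cD cN emb_mem emb_norm order_trans by (intro ball_tuplesI) (auto, blast)
    have "\<sigma> (poly_eval (map \<iota> c @ map \<iota> a) p) = \<tau> (poly_eval (c @ a) p)" if "p \<in> qf_atoms \<phi>" for p
      using emb_poly_eval[of "c @ a" p] N.poly_eval_mem[of "c @ a" p] emb_tr atoms[OF that] cD a
      by simp
    then show "qf_interp \<sigma> \<phi> (map \<iota> c @ map \<iota> a) = qf_interp \<tau> \<phi> (c @ a)"
      unfolding qf_interp_def by (rule qf_eval_cong)
  qed
  \<comment> \<open>A uniform norm bound on all tuples confines the moments, hence the values, so
    that the real infima are genuine lower bounds.\<close>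
  have "\<exists>C. \<forall>b\<in>ball_tuples M rs. \<forall>x\<in>set (b @ map \<iota> a). norm x \<le> C"
  proof (intro exI ballI)
    fix b x assume b: "b \<in> ball_tuples M rs" and x: "x \<in> set (b @ map \<iota> a)"
    have "\<exists>t\<in>set rs \<union> (\<lambda>y. norm (\<iota> y)) ` set a. norm x \<le> t"
      using x ball_tuplesD[OF b] by (fastforce simp: in_set_conv_nth)
    moreover have "t \<le> Max (set rs \<union> (\<lambda>y. norm (\<iota> y)) ` set a)" if "t \<in> set rs \<union> (\<lambda>y. norm (\<iota> y)) ` set a" for t
      using that by (intro Max_ge) auto
    ultimately show "norm x \<le> Max (set rs \<union> (\<lambda>y. norm (\<iota> y)) ` set a)"
      using order_trans by blast
  qed
  then obtain C where C: "\<And>b x. b \<in> ball_tuples M rs \<Longrightarrow> x \<in> set (b @ map \<iota> a) \<Longrightarrow> norm x \<le> C"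
    by blast
  obtain K where K: "\<And>m. (\<And>p. p \<in> qf_atoms \<phi> \<Longrightarrow> cmod (m p) \<le> poly_bound C p) \<Longrightarrow> \<bar>qf_eval m \<phi>\<bar> \<le> K"
    using qf_eval_bounded[OF \<phi>(1)] by metis
  have bound: "- K \<le> qf_interp \<sigma> \<phi> (b @ map \<iota> a)" if b: "b \<in> ball_tuples M rs" for b
  proof -
    have sub: "set (b @ map \<iota> a) \<subseteq> M"
      using ball_tuplesD(2)[OF b] a emb_mem by auto
    have "cmod (\<sigma> (poly_eval (b @ map \<iota> a) p)) \<le> poly_bound C p" if p: "p \<in> qf_atoms \<phi>" for p
    proof -
      have v: "poly_vars p \<subseteq> {..<length (b @ map \<iota> a)}"
        using atoms[OF p] ball_tuplesD(1)[OF b] by simp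
      show ?thesis
        using M.cmod_tr_le_norm[OF M.poly_eval_mem[OF sub v]] M.norm_poly_eval_le[OF sub C[OF b] v]
        by linarith
    qed
    from K[OF this] show ?thesis by (simp add: qf_interp_def abs_le_iff)
  qed
  have bddM: "bdd_below ((\<lambda>b. qf_interp \<sigma> \<phi> (b @ map \<iota> a)) ` ball_tuples M rs)"
    using bound by (intro bdd_belowI[where m = "- K"]) auto
  have bddN: "bdd_below ((\<lambda>c. qf_interp \<tau> \<phi> (c @ a)) ` ball_tuples N rs)"
    using bound[OF emb(1)] emb(2) by (intro bdd_belowI[where m = "- K"]) auto
  have zero: "map (\<lambda>_. 0) rs \<in> ball_tuples N rs"
    using rs by (intro ball_tuplesI) (auto simp: less_imp_le)
  show ?thesis
  proof (rule antisym)
    show "(INF c\<in>ball_tuples N rs. qf_interp \<tau> \<phi> (c @ a)) \<le> (INF b\<in>ball_tuples M rs. qf_interp \<sigma> \<phi> (b @ map \<iota> a))"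
    proof (rule cINF_greatest)
      show "ball_tuples M rs \<noteq> {}" using emb(1)[OF zero] by blast
      fix b assume b: "b \<in> ball_tuples M rs"
      have "\<exists>c\<in>ball_tuples N rs. \<forall>p\<in>qf_atoms \<phi>.
          cmod (\<tau> (poly_eval (c @ a) p) - \<sigma> (poly_eval (b @ map \<iota> a) p)) < 1 / real (Suc k)" for k
        by (rule approximate_moments[OF assms(1-3) rs b a finite_qf_atoms atoms, of \<phi> "1 / real (Suc k)"])
          auto
      then obtain c where c: "\<And>k. c k \<in> ball_tuples N rs"
        "\<And>k p. p \<in> qf_atoms \<phi> \<Longrightarrow>
          cmod (\<tau> (poly_eval (c k @ a) p) - \<sigma> (poly_eval (b @ map \<iota> a) p)) < 1 / real (Suc k)"
        by metis
      have "(\<lambda>k. qf_interp \<tau> \<phi> (c k @ a)) \<longlonglongrightarrow> qf_interp \<sigma> \<phi> (b @ map \<iota> a)"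
        unfolding qf_interp_def
      proof (rule tendsto_qf_eval[OF \<phi>(1)])
        fix p assume p: "p \<in> qf_atoms \<phi>"
        have "(\<lambda>k. 1 / real (Suc k)) \<longlonglongrightarrow> 0"
          by (intro LIMSEQ_Suc lim_1_over_n)
        then have "(\<lambda>k. \<tau> (poly_eval (c k @ a) p) - \<sigma> (poly_eval (b @ map \<iota> a) p)) \<longlonglongrightarrow> 0"
          by (rule Lim_null_comparison[rotated]) (simp add: less_imp_le[OF c(2)[OF p]] del: of_nat_Suc)
        then show "(\<lambda>k. \<tau> (poly_eval (c k @ a) p)) \<longlonglongrightarrow> \<sigma> (poly_eval (b @ map \<iota> a) p)"
          by (rule LIM_zero_cancel)
      qed
      moreover have "(INF c\<in>ball_tuples N rs. qf_interp \<tau> \<phi> (c @ a)) \<le> qf_interp \<tau> \<phi> (c k @ a)" for k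
        by (rule cINF_lower[OF bddN c(1)])
      ultimately show "(INF c\<in>ball_tuples N rs. qf_interp \<tau> \<phi> (c @ a)) \<le> qf_interp \<sigma> \<phi> (b @ map \<iota> a)"
        by (intro LIMSEQ_le_const) auto
    qed
    show "(INF b\<in>ball_tuples M rs. qf_interp \<sigma> \<phi> (b @ map \<iota> a)) \<le> (INF c\<in>ball_tuples N rs. qf_interp \<tau> \<phi> (c @ a))"
    proof (rule cINF_greatest)
      show "ball_tuples N rs \<noteq> {}" using zero by blast
      fix c assume c: "c \<in> ball_tuples N rs"
      show "(INF b\<in>ball_tuples M rs. qf_interp \<sigma> \<phi> (b @ map \<iota> a)) \<le> qf_interp \<tau> \<phi> (c @ a)"
        using cINF_lower[OF bddM emb(1)[OF c]] by (simp add: emb(2)[OF c])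
    qed
  qed
qed

theorem proposition3p2:
  fixes R :: "('h::complex_hilbert \<Rightarrow>\<^sub>L 'h) set"
    and \<tau> :: "('h \<Rightarrow>\<^sub>L 'h) \<Rightarrow> complex"
  assumes "hyperfinite_II1_factor R \<tau>"
  shows "is_model R \<tau> (universal_theory R \<tau>) \<and>
    (\<forall>(M :: ('k::complex_hilbert \<Rightarrow>\<^sub>L 'k) set) \<sigma> \<iota>.
       is_model M \<sigma> (universal_theory R \<tau>) \<and> trace_preserving_embedding R \<tau> M \<sigma> \<iota> \<longrightarrow>
       (\<forall>rs a \<phi>.
          (\<forall>r\<in>set rs. 0 < r) \<and> set a \<subseteq> R \<and>
          qf_wf \<phi> \<and> qf_vars \<phi> \<subseteq> {..<length rs + length a} \<longrightarrow>
          (INF c\<in>ball_tuples R rs. qf_interp \<tau> \<phi> (c @ a)) =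
          (INF b\<in>ball_tuples M rs. qf_interp \<sigma> \<phi> (b @ map \<iota> a))))"
proof -
  have R: "tracial_von_neumann_algebra R \<tau>" "factor R" "hyperfinite R \<tau>"
    using assms by (simp_all add: hyperfinite_II1_factor_def II1_factor_def)
  have "is_model R \<tau> (universal_theory R \<tau>)"
    using R(1) by (simp add: is_model_def universal_theory_def)
  moreover have "(INF c\<in>ball_tuples R rs. qf_interp \<tau> \<phi> (c @ a))
      = (INF b\<in>ball_tuples M rs. qf_interp \<sigma> \<phi> (b @ map \<iota> a))"
    if M: "is_model M \<sigma> (universal_theory R \<tau>)" "trace_preserving_embedding R \<tau> M \<sigma> \<iota>"
      and \<phi>: "\<forall>r\<in>set rs. 0 < r" "set a \<subseteq> R" "qf_wf \<phi>" "qf_vars \<phi> \<subseteq> {..<length rs + length a}"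
    for M :: "('k \<Rightarrow>\<^sub>L 'k) set" and \<sigma> \<iota> rs a \<phi>
  proof -
    interpret tracial_embedding R \<tau> M \<sigma> \<iota>
      using R(1) M by unfold_locales (simp_all add: is_model_def)
    show ?thesis
      using R M(1) \<phi> by (intro qf_inf_eq) auto
  qed
  ultimately show ?thesis by blast
qed

end
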